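(* An arbitrary $N$-partite quantum state $\rho$ admits an $S_1\times\underbrace{1\times\dots\times1}_{N-1}$-setting LHV description for any $S_1\ge2$.
   Context: An $N$-partite quantum state $\rho$ is a density operator (positive, trace one) on $\mathcal{H}_1\otimes\dots\otimes\mathcal{H}_N$, where the $\mathcal{H}_n$ are complex separable Hilbert spaces. A POV measure $\mathrm{M}$ on an outcome set $\Lambda$ (an arbitrary measurable space; outcomes need not be real numbers and may be of any spectral type, discrete or continuous) with values in bounded operators on $\mathcal{H}$ is a $\sigma$-additive map from measurable sets to positive operators with $\mathrm{M}(\Lambda)=I$. An $S_1\times\dots\times S_N$-setting family of EPR local $N$-partite joint measurements performed on $\rho$ is given by POV measures $\mathrm{M}_n^{(s_n)}$ on $\Lambda_n^{(s_n)}$ with values on $\mathcal{H}_n$, $s_n=1,\dots,S_n$, $n=1,\dots,N$, with joint probability distributions $$P_{(s_1,\dots,s_N)}(D_1\times\dots\times D_N\,|\,\rho)=\mathrm{tr}\big[\rho\{\mathrm{M}_1^{(s_1)}(D_1)\otimes\dots\otimes\mathrm{M}_N^{(s_N)}(D_N)\}\big].$$ Such a family (with $S_1+\dots+S_N>N$) admits an LHV model if there exist a probability space $(\Omega,\mathcal{F}_\Omega,\nu)$ (which may depend on the whole family) and, for each $n$ and $s_n$, a conditional probability distribution $P_n^{(s_n)}(\cdot|\omega)$ on $\Lambda_n^{(s_n)}$, defined for $\nu$-a.e. $\omega$, measurable in $\omega$, depending only on the setting $s_n$ at site $n$, such that for all $(s_1,\dots,s_N)$ and measurable $D_n$, $$P_{(s_1,\dots,s_N)}(D_1\times\dots\times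 D_N|\rho)=\int_\Omega P_1^{(s_1)}(D_1|\omega)\cdots P_N^{(s_N)}(D_N|\omega)\,\nu(d\omega).$$ The state $\rho$ admits an $S_1\times\dots\times S_N$-setting LHV description if every $S_1\times\dots\times S_N$-setting family of EPR local $N$-partite joint measurements performed on $\rho$ admits an LHV model. *)

theory Defs
  imports "HOL-Probability.Probability"
begin

text \<open>
  Complex Hilbert spaces as a type class on top of the library's complete real inner product spaces.
  The complex inner product is linear in its second argument; the real inner product, and with it
  the norm and the topology, is its real part, so positive definiteness is inherited from
  \<^class>\<open>real_inner\<close>.
\<close>

class complex_hilbert_space = real_inner + complete_space +
  fixes scaleC :: "complex \<Rightarrow> 'a \<Rightarrow> 'a"  (infixr \<open>*\<^sub>C\<close> 75)
    and cinner :: "'a \<Rightarrow> 'a \<Rightarrow> complex"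
  assumes scaleC_add_right: "a *\<^sub>C (x + y) = a *\<^sub>C x + a *\<^sub>C y"
    and scaleC_add_left: "(a + b) *\<^sub>C x = a *\<^sub>C x + b *\<^sub>C x"
    and scaleC_scaleC: "a *\<^sub>C b *\<^sub>C x = (a * b) *\<^sub>C x"
    and scaleC_of_real: "complex_of_real r *\<^sub>C x = r *\<^sub>R x"
    and cinner_commute: "cinner x y = cnj (cinner y x)"
    and cinner_add_right: "cinner x (y + z) = cinner x y + cinner x z"
    and cinner_scaleC_right: "cinner x (a *\<^sub>C y) = a * cinner x y"
    and inner_eq_Re_cinner: "inner x y = Re (cinner x y)"

global_interpretation complex_vector: vector_space
  "scaleC :: complex \<Rightarrow> 'a \<Rightarrow> 'a :: complex_hilbert_space"
  defines csubspace = complex_vector.subspace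
    and cspan = complex_vector.span
  by unfold_locales
    (simp_all add: scaleC_add_right scaleC_add_left scaleC_scaleC,
     metis of_real_1 scaleC_of_real scaleR_one)

text \<open>
  The factors of a tensor product are an arbitrary finite family of Hilbert spaces. They are
  represented as closed complex subspaces of one Hilbert space \<open>'h\<close>. This is no restriction: every
  family embeds isometrically into its Hilbert direct sum.
\<close>

definition separable_hilbert_subspace :: "'h::complex_hilbert_space set \<Rightarrow> bool" where
  "separable_hilbert_subspace H \<longleftrightarrow> csubspace H \<and> closed H \<and> separable_space (top_of_set H)"

text \<open>Operators on \<open>H\<close> are functions whose values outside \<open>H\<close> are irrelevant.\<close>

definition bounded_op :: "'h::complex_hilbert_space set \<Rightarrow> ('h \<Rightarrow> 'h) \<Rightarrow> bool" where
  "bounded_op H A \<longleftrightarrow>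
     A \<in> H \<rightarrow> H \<and>
     (\<forall>x\<in>H. \<forall>y\<in>H. A (x + y) = A x + A y) \<and>
     (\<forall>c. \<forall>x\<in>H. A (c *\<^sub>C x) = c *\<^sub>C A x) \<and>
     (\<exists>B. \<forall>x\<in>H. norm (A x) \<le> B * norm x)"

definition positive_op :: "'h::complex_hilbert_space set \<Rightarrow> ('h \<Rightarrow> 'h) \<Rightarrow> bool" where
  "positive_op H A \<longleftrightarrow> bounded_op H A \<and> (\<forall>x\<in>H. cinner x (A x) \<in> \<real>\<^sub>\<ge>\<^sub>0)"

definition orthonormal_basis :: "'k::complex_hilbert_space set \<Rightarrow> bool" where
  "orthonormal_basis B \<longleftrightarrow>
     (\<forall>e\<in>B. norm e = 1) \<and> pairwise (\<lambda>e f. cinner e f = 0) B \<and> closure (cspan B) = UNIV"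

text \<open>
  The trace of a trace-class operator does not depend on the orthonormal basis, so any one may be
  chosen.
\<close>

definition op_trace :: "('k::complex_hilbert_space \<Rightarrow> 'k) \<Rightarrow> complex" where
  "op_trace A = (\<Sum>\<^sub>\<infinity>e\<in>(SOME B. orthonormal_basis B). cinner e (A e))"

text \<open>
  A non-summable \<^const>\<open>infsum\<close> is \<open>0\<close>; hence trace one already forces a positive operator to
  be of trace class.
\<close>

definition density_operator :: "('k::complex_hilbert_space \<Rightarrow> 'k) \<Rightarrow> bool" where
  "density_operator \<rho> \<longleftrightarrow> positive_op UNIV \<rho> \<and> op_trace \<rho> = 1"

text \<open>
  The Hilbert space \<open>'k\<close> together with the map \<open>T\<close>, which sends \<open>x\<close> to the product vector
  \<open>x 1 \<otimes> \<dots> \<otimes> x N\<close>, is the Hilbert space tensor product of \<open>H 1, \<dots>, H N\<close>. These conditions determine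
  the pair up to a unique unitary map.
\<close>

definition hilbert_tensor_product ::
  "nat \<Rightarrow> (nat \<Rightarrow> 'h::complex_hilbert_space set) \<Rightarrow> ((nat \<Rightarrow> 'h) \<Rightarrow> 'k::complex_hilbert_space) \<Rightarrow> bool"
where
  "hilbert_tensor_product N H T \<longleftrightarrow>
     (\<forall>x\<in>Pi {1..N} H. \<forall>n\<in>{1..N}. \<forall>u\<in>H n. \<forall>v\<in>H n. \<forall>a.
        T (x(n := a *\<^sub>C u + v)) = a *\<^sub>C T (x(n := u)) + T (x(n := v))) \<and>
     (\<forall>x\<in>Pi {1..N} H. \<forall>y\<in>Pi {1..N} H. cinner (T x) (T y) = (\<Prod>n=1..N. cinner (x n) (y n))) \<and>
     closure (cspan (T ` Pi {1..N} H)) = UNIV"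

text \<open>The operator \<open>A 1 \<otimes> \<dots> \<otimes> A N\<close>.\<close>

definition tensor_op ::
  "nat \<Rightarrow> (nat \<Rightarrow> 'h::complex_hilbert_space set) \<Rightarrow> ((nat \<Rightarrow> 'h) \<Rightarrow> 'k::complex_hilbert_space) \<Rightarrow>
   (nat \<Rightarrow> 'h \<Rightarrow> 'h) \<Rightarrow> 'k \<Rightarrow> 'k"
where
  "tensor_op N H T A =
     (THE F. bounded_op UNIV F \<and> (\<forall>x\<in>Pi {1..N} H. F (T x) = T (\<lambda>n. A n (x n))))"

text \<open>
  Only the measurable space underlying \<open>L :: 'l measure\<close> matters. Countable additivity is
  convergence in the strong operator topology, which for positive operators is equivalent to
  convergence in the weak one.
\<close>

definition pov_measure ::
  "'h::complex_hilbert_space set \<Rightarrow> 'l measure \<Rightarrow> ('l set \<Rightarrow> 'h \<Rightarrow> 'h) \<Rightarrow> bool"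
where
  "pov_measure H L M \<longleftrightarrow>
     (\<forall>D\<in>sets L. positive_op H (M D)) \<and>
     (\<forall>x\<in>H. M (space L) x = x) \<and>
     (\<forall>D :: nat \<Rightarrow> 'l set. range D \<subseteq> sets L \<longrightarrow> disjoint_family D \<longrightarrow>
        (\<forall>x\<in>H. (\<lambda>i. M (D i) x) sums M (\<Union>i. D i) x))"

text \<open>
  A measurement family: at site \<open>n\<close>, the setting \<open>s \<in> {1..S n}\<close> has outcome space \<open>L n s\<close> and
  POV measure \<open>M n s\<close>. The outcome spaces may differ; they live in a common type \<open>'l\<close>.
\<close>

definition epr_local_family ::
  "nat \<Rightarrow> (nat \<Rightarrow> nat) \<Rightarrow> (nat \<Rightarrow> 'h::complex_hilbert_space set) \<Rightarrow>
   (nat \<Rightarrow> nat \<Rightarrow> 'l measure) \<Rightarrow> (nat \<Rightarrow> nat \<Rightarrow> 'l set \<Rightarrow> 'h \<Rightarrow> 'h) \<Rightarrow> bool"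
where
  "epr_local_family N S H L M \<longleftrightarrow> (\<forall>n\<in>{1..N}. \<forall>s\<in>{1..S n}. pov_measure (H n) (L n s) (M n s))"

text \<open>
  The joint probability of the product event \<open>D 1 \<times> \<dots> \<times> D N\<close> under the joint setting \<open>s\<close>.
\<close>

definition joint_prob ::
  "nat \<Rightarrow> (nat \<Rightarrow> 'h::complex_hilbert_space set) \<Rightarrow> ((nat \<Rightarrow> 'h) \<Rightarrow> 'k::complex_hilbert_space) \<Rightarrow>
   ('k \<Rightarrow> 'k) \<Rightarrow> (nat \<Rightarrow> nat \<Rightarrow> 'l set \<Rightarrow> 'h \<Rightarrow> 'h) \<Rightarrow> (nat \<Rightarrow> nat) \<Rightarrow> (nat \<Rightarrow> 'l set) \<Rightarrow> complex"
where
  "joint_prob N H T \<rho> M s D = op_trace (\<rho> \<circ> tensor_op N H T (\<lambda>n. M n (s n) (D n)))"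

text \<open>
  \<open>Q s D\<close> is the joint probability of \<open>D 1 \<times> \<dots> \<times> D N\<close> under the joint setting \<open>s\<close>, and
  \<open>P n s \<omega>\<close> is the conditional distribution at site \<open>n\<close> under the setting \<open>s\<close>.
\<close>

definition lhv_model ::
  "nat \<Rightarrow> (nat \<Rightarrow> nat) \<Rightarrow> (nat \<Rightarrow> nat \<Rightarrow> 'l measure) \<Rightarrow>
   ((nat \<Rightarrow> nat) \<Rightarrow> (nat \<Rightarrow> 'l set) \<Rightarrow> complex) \<Rightarrow>
   'w measure \<Rightarrow> (nat \<Rightarrow> nat \<Rightarrow> 'w \<Rightarrow> 'l measure) \<Rightarrow> bool"
where
  "lhv_model N S L Q \<nu> P \<longleftrightarrow>
     N < (\<Sum>n=1..N. S n) \<and>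
     prob_space \<nu> \<and>
     (\<forall>n\<in>{1..N}. \<forall>s\<in>{1..S n}.
        (AE \<omega> in \<nu>. prob_space (P n s \<omega>) \<and> sets (P n s \<omega>) = sets (L n s)) \<and>
        (\<forall>D\<in>sets (L n s). (\<lambda>\<omega>. measure (P n s \<omega>) D) \<in> borel_measurable \<nu>)) \<and>
     (\<forall>s\<in>(\<Pi> n\<in>{1..N}. {1..S n}). \<forall>D\<in>(\<Pi> n\<in>{1..N}. sets (L n (s n))).
        Q s D = complex_of_real (\<integral>\<omega>. (\<Prod>n=1..N. measure (P n (s n) \<omega>) (D n)) \<partial>\<nu>))"

text \<open>
  An existential quantifier cannot range over all types of hidden variables. Fixing the type of
  \<open>\<Omega>\<close> to be \<open>nat \<times> nat \<Rightarrow> 'l\<close>, which accommodates the product of all outcome spaces, loses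
  nothing: by the lemma \<open>admits_lhv_modelI\<close> below, a model over a hidden variable of any type
  yields one of this type.
\<close>

definition admits_lhv_model ::
  "nat \<Rightarrow> (nat \<Rightarrow> nat) \<Rightarrow> (nat \<Rightarrow> nat \<Rightarrow> 'l measure) \<Rightarrow>
   ((nat \<Rightarrow> nat) \<Rightarrow> (nat \<Rightarrow> 'l set) \<Rightarrow> complex) \<Rightarrow> bool"
where
  "admits_lhv_model N S L Q \<longleftrightarrow> (\<exists>(\<nu> :: (nat \<times> nat \<Rightarrow> 'l) measure) P. lhv_model N S L Q \<nu> P)"

text \<open>The argument \<open>TYPE('l)\<close> names the type in which the outcome spaces live.\<close>

definition admits_lhv_description ::
  "'l itself \<Rightarrow> nat \<Rightarrow> (nat \<Rightarrow> nat) \<Rightarrow> (nat \<Rightarrow> 'h::complex_hilbert_space set) \<Rightarrow>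
   ((nat \<Rightarrow> 'h) \<Rightarrow> 'k::complex_hilbert_space) \<Rightarrow> ('k \<Rightarrow> 'k) \<Rightarrow> bool"
where
  "admits_lhv_description TYPE('l) N S H T \<rho> \<longleftrightarrow>
     (\<forall>(L :: nat \<Rightarrow> nat \<Rightarrow> 'l measure) M. epr_local_family N S H L M \<longrightarrow>
        admits_lhv_model N S L (joint_prob N H T \<rho> M))"

lemma measurable_PiM_kernel:
  fixes I :: "'i set" and P :: "'i \<Rightarrow> 'w \<Rightarrow> 'l measure"
  assumes "finite I"
    and prob: "\<And>i \<omega>. i \<in> I \<Longrightarrow> prob_space (P i \<omega>)"
    and sets: "\<And>i \<omega>. i \<in> I \<Longrightarrow> sets (P i \<omega>) = sets (L i)"
    and meas: "\<And>i D. i \<in> I \<Longrightarrow> D \<in> sets (L i) \<Longrightarrow> (\<lambda>\<omega>. measure (P i \<omega>) D) \<in> borel_measurable \<nu>"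
  shows "(\<lambda>\<omega>. PiM I (\<lambda>i. P i \<omega>)) \<in> \<nu> \<rightarrow>\<^sub>M prob_algebra (PiM I L)"
    and "\<And>\<omega> X. (\<And>i. i \<in> I \<Longrightarrow> X i \<in> sets (L i)) \<Longrightarrow>
      emeasure (PiM I (\<lambda>i. P i \<omega>)) (PiE I X) = ennreal (\<Prod>i\<in>I. measure (P i \<omega>) (X i))"
proof -
  show box: "emeasure (PiM I (\<lambda>i. P i \<omega>)) (PiE I X) = ennreal (\<Prod>i\<in>I. measure (P i \<omega>) (X i))"
    if X: "\<And>i. i \<in> I \<Longrightarrow> X i \<in> sets (L i)" for \<omega> X
  proof -
    let ?P = "\<lambda>i. if i \<in> I then P i \<omega> else count_space {undefined}"
    interpret M': prob_space "?P i" for i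
      using prob by (cases "i \<in> I") (auto intro!: prob_spaceI)
    interpret finite_product_prob_space ?P I
      by unfold_locales (fact \<open>finite I\<close>)
    have "PiM I (\<lambda>i. P i \<omega>) = PiM I ?P"
      by (intro PiM_cong) auto
    moreover have "emeasure (PiM I ?P) (PiE I X) = ennreal (\<Prod>i\<in>I. measure (?P i) (X i))"
      using finite_measure_PiM_emb[of X] X sets
      by (simp add: P.emeasure_eq_measure)
    ultimately show ?thesis
      by (simp cong: prod.cong)
  qed
  show "(\<lambda>\<omega>. PiM I (\<lambda>i. P i \<omega>)) \<in> \<nu> \<rightarrow>\<^sub>M prob_algebra (PiM I L)"
  proof (rule measurable_prob_algebra_generated[OF sets_PiM Int_stable_prod_algebra
        prod_algebra_sets_into_space])
    fix \<omega> show "prob_space (PiM I (\<lambda>i. P i \<omega>))"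
      by (intro prob_space_PiM prob)
    show "sets (PiM I (\<lambda>i. P i \<omega>)) = sets (PiM I L)"
      by (intro sets_PiM_cong refl sets)
  next
    fix A assume "A \<in> prod_algebra I L"
    then obtain X where X: "A = PiE I X" "\<And>i. i \<in> I \<Longrightarrow> X i \<in> sets (L i)"
      using \<open>finite I\<close> by (auto simp: prod_algebra_eq_finite)
    have "(\<lambda>\<omega>. ennreal (\<Prod>i\<in>I. measure (P i \<omega>) (X i))) \<in> borel_measurable \<nu>"
      using X(2) by (intro measurable_compose[OF _ measurable_ennreal] borel_measurable_prod meas)
    then show "(\<lambda>\<omega>. emeasure (PiM I (\<lambda>i. P i \<omega>)) A) \<in> borel_measurable \<nu>"
      using X by (simp add: box)
  qed
qed

lemma admits_lhv_modelI:
  fixes \<nu> :: "'w measure"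
  assumes model: "lhv_model N S L Q \<nu> P"
  shows "admits_lhv_model N S L Q"
proof -
  define I where "I = (SIGMA n:{1..N}. {1..S n})"
  define L' where "L' = (\<lambda>(n, s). L n s)"
  interpret prob_space \<nu>
    using model by (simp add: lhv_model_def)
  have finI: "finite I"
    by (simp add: I_def)
  have "AE \<omega> in \<nu>. \<forall>i\<in>I. prob_space (P (fst i) (snd i) \<omega>) \<and>
          sets (P (fst i) (snd i) \<omega>) = sets (L' i)"
    using finI by (rule AE_finite_allI) (use model in \<open>auto simp: lhv_model_def I_def L'_def\<close>)
  then obtain Z where Z: "Z \<in> null_sets \<nu>"
    "{\<omega> \<in> space \<nu>. \<not> (\<forall>i\<in>I. prob_space (P (fst i) (snd i) \<omega>) \<and>
          sets (P (fst i) (snd i) \<omega>) = sets (L' i))} \<subseteq> Z"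
    unfolding eventually_ae_filter by blast
  have AEZ: "AE \<omega> in \<nu>. \<omega> \<in> space \<nu> - Z"
    using AE_not_in[OF Z(1)] by auto
  have "space \<nu> - Z \<noteq> {}"
  proof
    assume "space \<nu> - Z = {}"
    then have "AE \<omega> in \<nu>. False" using AEZ by (simp only: empty_iff)
    then show False by simp
  qed
  then obtain \<omega>0 where \<omega>0: "\<omega>0 \<in> space \<nu> - Z"
    by blast
  define P' where "P' = (\<lambda>i \<omega>. P (fst i) (snd i) (if \<omega> \<in> space \<nu> - Z then \<omega> else \<omega>0))"
  have prob: "prob_space (P' i \<omega>)" and sets: "sets (P' i \<omega>) = sets (L' i)" if "i \<in> I" for i \<omega>
    using Z(2) \<omega>0 that by (auto simp: P'_def)
  have meas: "(\<lambda>\<omega>. measure (P' i \<omega>) D) \<in> borel_measurable \<nu>" if "i \<in> I" "D \<in> sets (L' i)" for i D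
  proof -
    have [measurable]: "(\<lambda>\<omega>. measure (P (fst i) (snd i) \<omega>) D) \<in> borel_measurable \<nu>" "Z \<in> sets \<nu>"
      using model that Z(1) by (auto simp: lhv_model_def I_def L'_def)
    have "(\<lambda>\<omega>. if \<omega> \<in> space \<nu> - Z then measure (P (fst i) (snd i) \<omega>) D
        else measure (P (fst i) (snd i) \<omega>0) D) \<in> borel_measurable \<nu>"
      by measurable
    then show ?thesis
      by (simp add: P'_def if_distrib[of "\<lambda>\<omega>. measure (P _ _ \<omega>) _"])
  qed
  define K where "K = (\<lambda>\<omega>. PiM I (\<lambda>i. P' i \<omega>))"
  have K: "K \<in> \<nu> \<rightarrow>\<^sub>M prob_algebra (PiM I L')"
    unfolding K_def by (rule measurable_PiM_kernel(1)[OF finI prob sets meas])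
  have Kbox: "emeasure (K \<omega>) (PiE I X) = ennreal (\<Prod>i\<in>I. measure (P' i \<omega>) (X i))"
    if "\<And>i. i \<in> I \<Longrightarrow> X i \<in> sets (L' i)" for \<omega> X
    unfolding K_def by (rule measurable_PiM_kernel(2)[OF finI prob sets meas that])
  define \<mu> where "\<mu> = \<nu> \<bind> K"
  have \<nu>alg: "\<nu> \<in> space (prob_algebra \<nu>)"
    by (simp add: space_prob_algebra prob_space_axioms)
  have sets_\<mu>: "sets \<mu> = sets (PiM I L')"
    unfolding \<mu>_def by (rule sets_bind'[OF \<nu>alg K])
  have prob_\<mu>: "prob_space \<mu>"
    unfolding \<mu>_def by (rule prob_space_bind'[OF \<nu>alg K])
  interpret \<mu>: prob_space \<mu> by fact
  have space_\<mu>: "space \<mu> = PiE I (\<lambda>i. space (L' i))"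
    using sets_eq_imp_space_eq[OF sets_\<mu>] by (simp add: space_PiM)
  define R where "R = (\<lambda>n s (x :: nat \<times> nat \<Rightarrow> _). return (L n s) (x (n, s)))"
  have "lhv_model N S L Q \<mu> R"
    unfolding lhv_model_def
  proof (intro conjI ballI)
    show "N < (\<Sum>n=1..N. S n)"
      using model by (simp add: lhv_model_def)
  next
    fix n s assume "n \<in> {1..N}" "s \<in> {1..S n}"
    then have i: "(n, s) \<in> I" by (simp add: I_def)
    then have x: "x (n, s) \<in> space (L n s)" if "x \<in> space \<mu>" for x
      using that by (auto simp: space_\<mu> L'_def PiE_iff)
    show "AE x in \<mu>. prob_space (R n s x) \<and> sets (R n s x) = sets (L n s)"
      using x by (auto simp: R_def intro!: prob_space_return)
    fix D assume D: "D \<in> sets (L n s)"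
    have "(\<lambda>x. x (n, s)) \<in> PiM I L' \<rightarrow>\<^sub>M L' (n, s)"
      using i by (rule measurable_component_singleton)
    then have [measurable]: "(\<lambda>x. x (n, s)) \<in> \<mu> \<rightarrow>\<^sub>M L n s"
      by (simp add: L'_def measurable_cong_sets[OF sets_\<mu> refl])
    have "(\<lambda>x. indicator D (x (n, s)) :: real) \<in> borel_measurable \<mu>"
      using D by measurable
    then show "(\<lambda>x. measure (R n s x) D) \<in> borel_measurable \<mu>"
      using D by (simp add: R_def measure_return)
  next
    fix s D assume s: "s \<in> (\<Pi> n\<in>{1..N}. {1..S n})" and D: "D \<in> (\<Pi> n\<in>{1..N}. sets (L n (s n)))"
    define X where "X = (\<lambda>(n, t). if t = s n then D n else space (L n t))"
    have X: "X i \<in> sets (L' i)" if "i \<in> I" for i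
      using that D by (auto simp: X_def L'_def I_def)
    have prod: "(\<Prod>i\<in>I. measure (P' i \<omega>) (X i)) = (\<Prod>n=1..N. measure (P' (n, s n) \<omega>) (D n))" for \<omega>
    proof -
      have "(\<Prod>i\<in>I. measure (P' i \<omega>) (X i)) =
          (\<Prod>n=1..N. \<Prod>t=1..S n. measure (P' (n, t) \<omega>) (X (n, t)))"
        unfolding I_def by (simp add: prod.Sigma split_def)
      also have "\<dots> = (\<Prod>n=1..N. measure (P' (n, s n) \<omega>) (D n))"
      proof (rule prod.cong[OF refl])
        fix n assume n: "n \<in> {1..N}"
        have "measure (P' (n, t) \<omega>) (X (n, t)) =
            (if t = s n then measure (P' (n, s n) \<omega>) (D n) else 1)" if "t \<in> {1..S n}" for t
        proof -
          have i: "(n, t) \<in> I" using n that by (simp add: I_def)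
          have "space (L n t) = space (P' (n, t) \<omega>)"
            using sets_eq_imp_space_eq[OF sets[OF i]] by (simp add: L'_def)
          then show ?thesis
            using prob_space.prob_space[OF prob[OF i]] by (simp add: X_def)
        qed
        then have "(\<Prod>t=1..S n. measure (P' (n, t) \<omega>) (X (n, t))) =
            (\<Prod>t=1..S n. if t = s n then measure (P' (n, s n) \<omega>) (D n) else 1)"
          by (intro prod.cong) auto
        also have "\<dots> = measure (P' (n, s n) \<omega>) (D n)"
          using s n by (subst prod.delta) auto
        finally show "(\<Prod>t=1..S n. measure (P' (n, t) \<omega>) (X (n, t))) = measure (P' (n, s n) \<omega>) (D n)" .
      qed
      finally show ?thesis .
    qed
    have meas_box: "PiE I X \<in> sets (PiM I L')"
      using finI X by (intro sets_PiM_I_finite) auto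
    have "(\<integral>x. (\<Prod>n=1..N. measure (R n (s n) x) (D n)) \<partial>\<mu>) = (\<integral>x. indicator (PiE I X) x \<partial>\<mu>)"
    proof (rule Bochner_Integration.integral_cong[OF refl])
      fix x assume x: "x \<in> space \<mu>"
      have "(\<Prod>n=1..N. measure (R n (s n) x) (D n)) = (\<Prod>n=1..N. indicator (D n) (x (n, s n)) :: real)"
        using D by (intro prod.cong refl) (auto simp: R_def Pi_iff intro!: measure_return)
      also have "\<dots> = (if \<forall>n\<in>{1..N}. x (n, s n) \<in> D n then 1 else 0)"
        by (auto simp: indicator_def)
      also have "(\<forall>n\<in>{1..N}. x (n, s n) \<in> D n) \<longleftrightarrow> x \<in> PiE I X"
      proof
        assume l: "\<forall>n\<in>{1..N}. x (n, s n) \<in> D n"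
        have "x i \<in> X i" if i: "i \<in> I" for i
        proof -
          obtain n t where nt: "i = (n, t)" "n \<in> {1..N}"
            using i unfolding I_def by blast
          have "x i \<in> space (L' i)"
            using x i unfolding space_\<mu> by (rule PiE_mem)
          then show ?thesis
            using l nt by (simp add: X_def L'_def)
        qed
        with x show "x \<in> PiE I X"
          by (simp add: space_\<mu> PiE_iff)
      next
        assume r: "x \<in> PiE I X"
        have "x (n, s n) \<in> D n" if n: "n \<in> {1..N}" for n
        proof -
          have "(n, s n) \<in> I"
            using s n by (auto simp: I_def)
          with r have "x (n, s n) \<in> X (n, s n)" by (rule PiE_mem)
          then show ?thesis by (simp add: X_def)
        qed
        then show "\<forall>n\<in>{1..N}. x (n, s n) \<in> D n" by blast
      qed
      finally show "(\<Prod>n=1..N. measure (R n (s n) x) (D n)) = indicator (PiE I X) x"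
        by (simp add: indicator_def)
    qed
    also have "\<dots> = measure \<mu> (PiE I X)"
      using meas_box sets_\<mu> by simp
    also have "\<dots> = (\<integral>\<omega>. measure (K \<omega>) (PiE I X) \<partial>\<nu>)"
      unfolding \<mu>_def by (rule measure_bind[OF measurable_prob_algebraD[OF K] meas_box])
    also have "\<dots> = (\<integral>\<omega>. (\<Prod>n=1..N. measure (P' (n, s n) \<omega>) (D n)) \<partial>\<nu>)"
    proof (rule Bochner_Integration.integral_cong[OF refl])
      fix \<omega>
      have "measure (K \<omega>) (PiE I X) = (\<Prod>i\<in>I. measure (P' i \<omega>) (X i))"
        by (rule measure_eq_emeasure_eq_ennreal[OF _ Kbox[OF X]]) (simp_all add: prod_nonneg)
      then show "measure (K \<omega>) (PiE I X) = (\<Prod>n=1..N. measure (P' (n, s n) \<omega>) (D n))"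
        by (simp only: prod)
    qed
    also have "\<dots> = (\<integral>\<omega>. (\<Prod>n=1..N. measure (P n (s n) \<omega>) (D n)) \<partial>\<nu>)"
    proof (rule integral_cong_AE)
      show "(\<lambda>\<omega>. \<Prod>n=1..N. measure (P' (n, s n) \<omega>) (D n)) \<in> borel_measurable \<nu>"
        using s D by (intro borel_measurable_prod meas) (auto simp: I_def L'_def)
      show "(\<lambda>\<omega>. \<Prod>n=1..N. measure (P n (s n) \<omega>) (D n)) \<in> borel_measurable \<nu>"
      proof (rule borel_measurable_prod)
        fix n assume n: "n \<in> {1..N}"
        with s D have "s n \<in> {1..S n}" "D n \<in> sets (L n (s n))" by blast+
        with model n show "(\<lambda>\<omega>. measure (P n (s n) \<omega>) (D n)) \<in> borel_measurable \<nu>"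
          unfolding lhv_model_def by blast
      qed
      show "AE \<omega> in \<nu>. (\<Prod>n=1..N. measure (P' (n, s n) \<omega>) (D n)) =
          (\<Prod>n=1..N. measure (P n (s n) \<omega>) (D n))"
        using AEZ by eventually_elim (simp add: P'_def)
    qed
    finally show "Q s D = complex_of_real (\<integral>x. (\<Prod>n=1..N. measure (R n (s n) x) (D n)) \<partial>\<mu>)"
      using model s D by (simp add: lhv_model_def)
  qed (fact prob_\<mu>)
  then show ?thesis
    unfolding admits_lhv_model_def by blast
qed

end

theory Submission
  imports Defs "HOL-Library.Complex_Order"
begin

text \<open>
  The hidden variable is the tuple of outcomes at the sites \<open>2, \<dots>, N\<close>, where there is only one
  setting: these sites answer deterministically, and site \<open>1\<close> answers with the conditional
  distribution of its outcome given the others. By no-signalling the law of the hidden variable does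
  not depend on the setting at site \<open>1\<close>.

  On arbitrary measurable spaces neither the extension of the joint probabilities to a measure nor the
  conditional distribution is automatic. Both come from a density with respect to a product measure.
  By separability each POV measure is dominated by a finite measure \<open>\<mu> n\<close>, hence has a positive
  semidefinite density kernel \<open>g n u v\<close> for \<open>\<langle>u, M n(\<cdot>) v\<rangle>\<close>. For a finite combination \<open>\<psi>\<close> of product
  vectors the joint probability has the density \<open>\<Sum> cnj (c x) * c y * (\<Prod>n. g n (x n) (y n))\<close>, which
  is nonnegative by the Schur product theorem and depends continuously in \<open>L\<^sup>1\<close> on \<open>\<psi>\<close>; so every
  vector state has a density, and a density operator is a countable sum of vector states.
\<close>

subsection \<open>Complex inner products\<close>

text \<open>Radon-Nikodym densities are determined only up to null sets, and these depend on the
  vectors involved, so uncountably many vectors cannot be expected to share one positive kernel.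
  This dictates the order of choices: the measures \<open>\<mu> n\<close> are fixed first, for all
  vectors at once; next a sequence of finite combinations of product vectors tending to the state
  vector, hence a countable set of product vectors; only then the kernels, corrected to be positive
  at every point. Pointwise positivity bounds the increments of the densities, while the integrals
  of the densities are squared Hilbert norms because the POV measures are normalised; a geometric
  rate of approximation then gives one limit that serves all boxes. Since the reference measures do
  not depend on the vectors, the densities of countably many vector states may be added. The joint
  settings differ at site 1 alone, so the reference measures of the other sites are shared, and the
  laws of the other outcomes agree as soon as they agree on boxes. Schur products serve a second
  time, to show that the tensor operators exist and are positive.\<close>

lemma cinner_add_left:
  fixes x y z :: "'a::complex_hilbert_space"
  shows "cinner (x + y) z = cinner x z + cinner y z"
  by (metis cinner_add_right cinner_commute complex_cnj_add)

lemma cinner_scaleC_left: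
  fixes x y :: "'a::complex_hilbert_space"
  shows "cinner (a *\<^sub>C x) y = cnj a * cinner x y"
  by (metis cinner_scaleC_right cinner_commute complex_cnj_mult)

lemma cinner_self:
  fixes x :: "'a::complex_hilbert_space"
  shows "cinner x x = complex_of_real ((norm x)\<^sup>2)"
proof -
  have "Im (cinner x x) = 0"
    using cinner_commute[of x x] by (metis cnj.simps(2) add.inverse_neutral equal_neg_zero)
  moreover have "Re (cinner x x) = (norm x)\<^sup>2"
    by (metis inner_eq_Re_cinner power2_norm_eq_inner)
  ultimately show ?thesis
    by (simp add: complex_eq_iff)
qed

lemma norm_scaleC:
  fixes x :: "'a::complex_hilbert_space"
  shows "norm (a *\<^sub>C x) = cmod a * norm x"
proof -
  have "complex_of_real ((norm (a *\<^sub>C x))\<^sup>2) = complex_of_real ((cmod a * norm x)\<^sup>2)"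
    unfolding cinner_self[symmetric] cinner_scaleC_left cinner_scaleC_right
    by (simp only: cinner_self of_real_mult of_real_power power_mult_distrib mult.assoc[symmetric])
      (simp add: mult.assoc[symmetric] complex_norm_square[symmetric] mult.commute[of "cnj _"])
  then show ?thesis
    by (metis of_real_eq_iff norm_ge_zero power2_eq_imp_eq zero_le_mult_iff)
qed

text \<open>The real Cauchy-Schwarz inequality bounds only the real part of
  \<open>cinner x y\<close>. Multiplying \<open>x\<close> by the unimodular \<open>a\<close> turns
  the inner product into its own modulus.\<close>

lemma norm_cinner_le:
  fixes x y :: "'a::complex_hilbert_space"
  shows "cmod (cinner x y) \<le> norm x * norm y"
proof (cases "cinner x y = 0")
  case False
  define a where "a = cinner x y / complex_of_real (cmod (cinner x y))"
  have a: "cmod a = 1"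
    using False by (simp add: a_def norm_divide)
  have "cnj a * cinner x y = complex_of_real (cmod (cinner x y))"
    using False by (simp add: a_def complex_norm_square[symmetric] power2_eq_square
        mult.commute[of "cnj _"])
  then have "cmod (cinner x y) = inner (a *\<^sub>C x) y"
    by (simp add: inner_eq_Re_cinner cinner_scaleC_left)
  also have "\<dots> \<le> norm (a *\<^sub>C x) * norm y"
    by (rule norm_cauchy_schwarz)
  finally show ?thesis
    using a by (simp add: norm_scaleC)
qed simp

interpretation scaleC: bounded_bilinear "scaleC :: complex \<Rightarrow> 'a::complex_hilbert_space \<Rightarrow> 'a"
proof
  fix a :: complex and x :: 'a and r :: real
  show "(r *\<^sub>R a) *\<^sub>C x = r *\<^sub>R a *\<^sub>C x" "a *\<^sub>C r *\<^sub>R x = r *\<^sub>R a *\<^sub>C x"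
    by (simp_all add: scaleC_of_real[symmetric] scaleC_scaleC scaleR_conv_of_real mult.commute)
  show "\<exists>K. \<forall>a (x::'a). norm (a *\<^sub>C x) \<le> norm a * norm x * K"
    by (intro exI[of _ 1]) (simp add: norm_scaleC)
qed (simp_all add: scaleC_add_left scaleC_add_right)

text \<open>Conjugate-linearity in the first argument is invisible to real scalars, so the rules for
  limits, sums and differences of real bilinear maps apply.\<close>

interpretation cinner: bounded_bilinear "cinner :: 'a::complex_hilbert_space \<Rightarrow> 'a \<Rightarrow> complex"
proof
  fix x y :: 'a and r :: real
  show "cinner (r *\<^sub>R x) y = r *\<^sub>R cinner x y" "cinner x (r *\<^sub>R y) = r *\<^sub>R cinner x y"
    by (simp_all add: scaleC_of_real[symmetric] cinner_scaleC_left cinner_scaleC_right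
        scaleR_conv_of_real)
  show "\<exists>K. \<forall>x y::'a. norm (cinner x y) \<le> norm x * norm y * K"
    by (intro exI[of _ 1]) (simp add: norm_cinner_le)
qed (simp_all add: cinner_add_left cinner_add_right)

lemma cinner_self_eq_0_iff:
  fixes x :: "'a::complex_hilbert_space"
  shows "cinner x x = 0 \<longleftrightarrow> x = 0"
  by (simp add: cinner_self)

lemma scaleC_one [simp]: "1 *\<^sub>C (x::'a::complex_hilbert_space) = x"
  using scaleC_of_real[of 1 x] by simp

lemma scaleC_minus1: "(-1) *\<^sub>C (x::'a::complex_hilbert_space) = - x"
  using scaleC.minus_left[of 1 x] by simp

lemma cinner_sum_sum:
  fixes x :: "'i \<Rightarrow> 'a::complex_hilbert_space"
  shows "cinner (\<Sum>i\<in>I. c i *\<^sub>C x i) (\<Sum>j\<in>J. d j *\<^sub>C y j) =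
    (\<Sum>i\<in>I. \<Sum>j\<in>J. cnj (c i) * d j * cinner (x i) (y j))"
  by (simp add: cinner.sum_left cinner.sum_right cinner_scaleC_left cinner_scaleC_right
      mult.assoc sum_distrib_left mult.left_commute sum.swap[of _ J I])

lemma csubspace_iff:
  "csubspace (V :: 'a::complex_hilbert_space set) \<longleftrightarrow>
    0 \<in> V \<and> (\<forall>x\<in>V. \<forall>y\<in>V. x + y \<in> V) \<and> (\<forall>c. \<forall>x\<in>V. c *\<^sub>C x \<in> V)"
  by (rule complex_vector.subspace_def)

lemma nonneg_Reals_iff: "z \<in> \<real>\<^sub>\<ge>\<^sub>0 \<longleftrightarrow> 0 \<le> (z::complex)"
  by (auto simp: complex_nonneg_Reals_iff less_eq_complex_def)

subsection \<open>Positive semidefinite kernels\<close>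

lemma cnj_mult_self_nonneg: "0 \<le> cnj z * z"
  by (simp add: less_eq_complex_def)

text \<open>In the complex order \<open>0 \<le>\<close> includes a vanishing imaginary part, so
  Hermitian symmetry is a consequence and not a clause. Kernels on a set, in place of matrices, can
  be pulled back along maps such as the coordinates of a product vector.\<close>

definition psd_kernel :: "'i set \<Rightarrow> ('i \<Rightarrow> 'i \<Rightarrow> complex) \<Rightarrow> bool" where
  "psd_kernel X a \<longleftrightarrow>
     (\<forall>I c. finite I \<longrightarrow> I \<subseteq> X \<longrightarrow> 0 \<le> (\<Sum>i\<in>I. \<Sum>j\<in>I. cnj (c i) * c j * a i j))"

lemma psd_kernelI:
  assumes "\<And>I c. finite I \<Longrightarrow> I \<subseteq> X \<Longrightarrow> 0 \<le> (\<Sum>i\<in>I. \<Sum>j\<in>I. cnj (c i) * c j * a i j)"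
  shows "psd_kernel X a"
  using assms unfolding psd_kernel_def by blast

lemma psd_kernelD:
  assumes "psd_kernel X a" "finite I" "I \<subseteq> X"
  shows "0 \<le> (\<Sum>i\<in>I. \<Sum>j\<in>I. cnj (c i) * c j * a i j)"
  using assms unfolding psd_kernel_def by blast

lemma psd_kernel_add:
  assumes "psd_kernel X a" "psd_kernel X b"
  shows "psd_kernel X (\<lambda>x y. a x y + b x y)"
proof (rule psd_kernelI)
  fix I and c :: "'a \<Rightarrow> complex" assume "finite I" "I \<subseteq> X"
  with assms have "0 \<le> (\<Sum>i\<in>I. \<Sum>j\<in>I. cnj (c i) * c j * a i j) + (\<Sum>i\<in>I. \<Sum>j\<in>I. cnj (c i) * c j * b i j)"
    by (intro add_nonneg_nonneg psd_kernelD)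
  then show "0 \<le> (\<Sum>i\<in>I. \<Sum>j\<in>I. cnj (c i) * c j * (a i j + b i j))"
    by (simp add: sum.distrib distrib_left)
qed

text \<open>The map may identify indices: the coefficients over each fibre are added up to
  \<open>d\<close>, and the form reduces to one over distinct points of \<open>Y\<close>.\<close>

lemma psd_kernel_vimage:
  assumes "psd_kernel Y a" "f ` X \<subseteq> Y"
  shows "psd_kernel X (\<lambda>x y. a (f x) (f y))"
proof (rule psd_kernelI)
  fix I and c :: "'b \<Rightarrow> complex" assume I: "finite I" "I \<subseteq> X"
  define d where "d = (\<lambda>u. \<Sum>i\<in>{i\<in>I. f i = u}. c i)"
  have group: "(\<Sum>i\<in>I. c' i * h (f i)) = (\<Sum>u\<in>f ` I. (\<Sum>i\<in>{i\<in>I. f i = u}. c' i) * h u)"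
    for c' and h :: "'a \<Rightarrow> complex"
    using I sum.group[of I "f ` I" f "\<lambda>i. c' i * h (f i)"] by (simp add: sum_distrib_right)
  have "(\<Sum>i\<in>I. \<Sum>j\<in>I. cnj (c i) * c j * a (f i) (f j)) =
      (\<Sum>i\<in>I. cnj (c i) * (\<Sum>v\<in>f`I. d v * a (f i) v))"
    by (simp add: group d_def sum_distrib_left[symmetric] mult.assoc)
  also have "\<dots> = (\<Sum>u\<in>f`I. cnj (d u) * (\<Sum>v\<in>f`I. d v * a u v))"
    by (subst group) (simp add: d_def)
  also have "\<dots> = (\<Sum>u\<in>f`I. \<Sum>v\<in>f`I. cnj (d u) * d v * a u v)"
    by (simp add: sum_distrib_left mult.assoc)
  finally show "0 \<le> (\<Sum>i\<in>I. \<Sum>j\<in>I. cnj (c i) * c j * a (f i) (f j))"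
    using psd_kernelD[OF assms(1) finite_imageI, of I f d] image_mono[OF I(2), of f] I(1) assms(2)
    by simp
qed

lemma psd_kernel_diag:
  assumes "psd_kernel X a" "x \<in> X"
  shows "0 \<le> a x x"
  using psd_kernelD[OF assms(1), of "{x}" "\<lambda>_. 1"] assms(2) by simp

text \<open>Pulling back to \<open>bool\<close> keeps two separate coefficients even if
  \<open>x = y\<close>, so no case distinction is needed.\<close>

lemma psd_kernel_pair:
  assumes "psd_kernel X a" "x \<in> X" "y \<in> X"
  shows "0 \<le> cnj s * s * a x x + cnj s * t * a x y + cnj t * s * a y x + cnj t * t * a y y"
proof -
  have "psd_kernel {False, True} (\<lambda>u v. a (if u then y else x) (if v then y else x))"
    by (rule psd_kernel_vimage[OF assms(1)]) (use assms in auto)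
  from psd_kernelD[OF this, of "{False, True}" "\<lambda>u. if u then t else s"]
  show ?thesis
    by (simp add: algebra_simps)
qed

text \<open>Reality of the form at the coefficients \<open>1, 1\<close> makes the imaginary parts
  opposite, and at \<open>1, \<i>\<close> it makes the real parts equal.\<close>

lemma psd_kernel_cnj:
  assumes "psd_kernel X a" "x \<in> X" "y \<in> X"
  shows "a y x = cnj (a x y)"
proof -
  have "Im (a x x) = 0" "Im (a y y) = 0"
    using psd_kernel_diag[OF assms(1)] assms by (auto simp: less_eq_complex_def)
  moreover have "Im (a x x + a x y + a y x + a y y) = 0"
    using psd_kernel_pair[OF assms, of 1 1] by (simp add: less_eq_complex_def)
  moreover have "Im (a x x + \<i> * a x y - \<i> * a y x + a y y) = 0"
    using psd_kernel_pair[OF assms, of 1 \<i>] by (simp add: less_eq_complex_def)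
  ultimately show ?thesis
    by (simp add: complex_eq_iff)
qed

lemma psd_kernel_zero:
  assumes "psd_kernel X a" "x \<in> X" "y \<in> X" "a y y = 0"
  shows "a x y = 0"
proof (rule ccontr)
  assume nz: "a x y \<noteq> 0"
  \<comment> \<open>With \<open>t = - (r / a x y)\<close> both mixed terms of the form equal
    \<open>-r\<close>. As \<open>a x x = r - 1\<close>, the total is \<open>- r - 1\<close>, which
    is negative.\<close>
  define r where "r = Re (a x x) + 1"
  have r: "a x x = complex_of_real (r - 1)"
    using psd_kernel_diag[OF assms(1,2)] by (simp add: r_def less_eq_complex_def complex_eq_iff)
  define t where "t = - (complex_of_real r / a x y)"
  have "0 \<le> a x x + t * a x y + cnj t * cnj (a x y)"
    using psd_kernel_pair[OF assms(1-3), of 1 t] psd_kernel_cnj[OF assms(1-3)] assms(4) by simp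
  also have "\<dots> = complex_of_real (- r - 1)"
    using nz by (simp add: t_def r)
  finally show False
    using psd_kernel_diag[OF assms(1,2)] by (simp add: r_def less_eq_complex_def)
qed

section \<open>Schur complements and Cholesky elimination\<close>

lemma psd_kernel_schur_complement:
  assumes a: "psd_kernel X a" and e: "e \<in> X"
  shows "psd_kernel X (\<lambda>x y. a x y - a x e * a e y / a e e)"
proof (cases "a e e = 0")
  case True
  then show ?thesis using a by simp
next
  case False
  show ?thesis
  proof (rule psd_kernelI)
    fix I and c :: "'a \<Rightarrow> complex" assume I: "finite I" "I \<subseteq> X"
    define s where "s = (\<Sum>j\<in>I. c j * a e j)"
    \<comment> \<open>This \<open>t\<close> minimises the form of \<open>a\<close> over the
      coefficient of one additional copy of \<open>e\<close>, and the minimum is the form of the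
      Schur complement at \<open>c\<close>. The copy gets the index \<open>None\<close> because
      \<open>e\<close> may already belong to \<open>I\<close>.\<close>
    define t where "t = - (s / a e e)"
    define f where "f = case_option e (\<lambda>i::'a. i)"
    have real: "cnj (a e e) = a e e"
      using psd_kernel_cnj[OF a e e] by simp
    have s: "(\<Sum>i\<in>I. cnj (c i) * a i e) = cnj s"
      unfolding s_def cnj_sum complex_cnj_mult
      by (intro sum.cong refl arg_cong2[where f="(*)"] psd_kernel_cnj[OF a e]) (use I in auto)
    have "psd_kernel (insert None (Some ` I)) (\<lambda>x y. a (f x) (f y))"
      by (rule psd_kernel_vimage[OF a]) (use I e in \<open>auto simp: f_def\<close>)
    from psd_kernelD[OF this, of "insert None (Some ` I)" "case_option t c"]
    have "0 \<le> cnj t * t * a e e + (\<Sum>j\<in>I. cnj t * c j * a e j)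
        + (\<Sum>i\<in>I. cnj (c i) * t * a i e + (\<Sum>j\<in>I. cnj (c i) * c j * a i j))"
      using I by (simp add: f_def sum.reindex add.assoc)
    also have "(\<Sum>j\<in>I. cnj t * c j * a e j) = cnj t * s"
      by (simp add: s_def sum_distrib_left mult.assoc)
    also have "(\<Sum>i\<in>I. cnj (c i) * t * a i e + (\<Sum>j\<in>I. cnj (c i) * c j * a i j)) =
        t * cnj s + (\<Sum>i\<in>I. \<Sum>j\<in>I. cnj (c i) * c j * a i j)"
      by (simp add: s[symmetric] sum_distrib_left sum.distrib mult_ac)
    also have "cnj t * t * a e e + cnj t * s + (t * cnj s
        + (\<Sum>i\<in>I. \<Sum>j\<in>I. cnj (c i) * c j * a i j)) =
        cnj t * t * a e e + cnj t * s + t * cnj s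
        + (\<Sum>i\<in>I. \<Sum>j\<in>I. cnj (c i) * c j * a i j)"
      by (simp add: add.assoc)
    also have "cnj t * t * a e e + cnj t * s + t * cnj s = - (cnj s * s / a e e)"
      using False by (simp add: t_def real field_simps)
    also have "cnj s * s / a e e = (\<Sum>i\<in>I. \<Sum>j\<in>I. cnj (c i) * c j * (a i e * a e j / a e e))"
      by (subst s[symmetric], subst s_def, subst sum_product)
        (simp add: sum_divide_distrib mult_ac)
    finally show "0 \<le> (\<Sum>i\<in>I. \<Sum>j\<in>I. cnj (c i) * c j * (a i j - a i e * a e j / a e e))"
      by (simp add: right_diff_distrib sum_subtractf)
  qed
qed

text \<open>If the pivot vanishes, \<open>x / 0 = 0\<close> makes the step trivial.\<close>

primrec schur_rest :: "('i \<Rightarrow> 'i \<Rightarrow> complex) \<Rightarrow> (nat \<Rightarrow> 'i) \<Rightarrow> nat \<Rightarrow> 'i \<Rightarrow> 'i \<Rightarrow> complex" where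
  "schur_rest a e 0 = a"
| "schur_rest a e (Suc k) = (\<lambda>x y. schur_rest a e k x y -
     schur_rest a e k x (e k) * schur_rest a e k (e k) y / schur_rest a e k (e k) (e k))"

text \<open>Dividing by the root of the pivot turns the rank-one term removed in step
  \<open>k\<close> into \<open>cholesky a e k x * cnj (cholesky a e k y)\<close>. A zero pivot
  yields a zero column.\<close>

definition cholesky :: "('i \<Rightarrow> 'i \<Rightarrow> complex) \<Rightarrow> (nat \<Rightarrow> 'i) \<Rightarrow> nat \<Rightarrow> 'i \<Rightarrow> complex" where
  "cholesky a e k x =
     schur_rest a e k x (e k) / complex_of_real (sqrt (Re (schur_rest a e k (e k) (e k))))"

context
  fixes X :: "'i set" and a :: "'i \<Rightarrow> 'i \<Rightarrow> complex" and e :: "nat \<Rightarrow> 'i"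
  assumes a: "psd_kernel X a" and e: "range e \<subseteq> X"
begin

lemma psd_kernel_schur_rest: "psd_kernel X (schur_rest a e k)"
proof (induction k)
  case (Suc k)
  show ?case
    using psd_kernel_schur_complement[OF Suc, of "e k"] e by auto
qed (simp add: a)

text \<open>Column \<open>e j\<close> is cleared in step \<open>j\<close>, and later steps only
  subtract multiples of rows in which its entry is zero. If the pivot vanishes nothing is
  subtracted, but then positivity has already made the column zero.\<close>

lemma schur_rest_eq_0:
  assumes "x \<in> X" "j < k"
  shows "schur_rest a e k x (e j) = 0"
  using assms
proof (induction k arbitrary: x)
  case (Suc k)
  have ek: "e k \<in> X" using e by auto
  show ?case
  proof (cases "j = k")
    case True
    then show ?thesis
      using psd_kernel_zero[OF psd_kernel_schur_rest Suc.prems(1) ek, of k] by auto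
  next
    case False
    then show ?thesis
      using Suc.IH[OF Suc.prems(1)] Suc.IH[OF ek] Suc.prems(2) by simp
  qed
qed simp

lemma cholesky_mult_cnj:
  assumes "x \<in> X" "y \<in> X"
  shows "cholesky a e k x * cnj (cholesky a e k y) =
    schur_rest a e k x (e k) * schur_rest a e k (e k) y / schur_rest a e k (e k) (e k)"
proof -
  have ek: "e k \<in> X" using e by auto
  have "cnj (schur_rest a e k y (e k)) = schur_rest a e k (e k) y"
    using psd_kernel_cnj[OF psd_kernel_schur_rest assms(2) ek] by simp
  moreover have "0 \<le> schur_rest a e k (e k) (e k)"
    by (rule psd_kernel_diag[OF psd_kernel_schur_rest ek])
  then have "complex_of_real (sqrt (Re (schur_rest a e k (e k) (e k)))) *
      complex_of_real (sqrt (Re (schur_rest a e k (e k) (e k)))) = schur_rest a e k (e k) (e k)"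
    unfolding of_real_mult[symmetric] by (simp add: less_eq_complex_def complex_eq_iff)
  ultimately show ?thesis
    by (simp add: cholesky_def)
qed

lemma cholesky_expansion:
  assumes "x \<in> X" "y \<in> X"
  shows "a x y = (\<Sum>k<m. cholesky a e k x * cnj (cholesky a e k y)) + schur_rest a e m x y"
  by (induction m) (simp_all add: cholesky_mult_cnj[OF assms])

end

section \<open>Schur products and their monotonicity\<close>

lemma psd_kernel_mult:
  assumes a: "psd_kernel X a" and b: "psd_kernel X b"
  shows "psd_kernel X (\<lambda>x y. a x y * b x y)"
proof (rule psd_kernelI)
  fix I and c :: "'a \<Rightarrow> complex" assume I: "finite I" "I \<subseteq> X"
  show "0 \<le> (\<Sum>i\<in>I. \<Sum>j\<in>I. cnj (c i) * c j * (a i j * b i j))"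
  proof (cases "I = {}")
    case False
    define e where "e = from_nat_into I"
    have range_e: "range e = I"
      using False I by (simp add: e_def countable_finite)
    \<comment> \<open>The enumeration \<open>e\<close> repeats elements of \<open>I\<close>, which
      is harmless since a repeated pivot is zero. It is enough that \<open>m\<close> passes a finite
      set of positions covering \<open>I\<close>; the remainder then vanishes on
      \<open>I\<close>.\<close>
    then obtain C where C: "finite C" "I = e ` C"
      using I finite_subset_image[of I e UNIV] by auto
    then obtain m where m: "C \<subseteq> {..<m}"
      using finite_nat_iff_bounded by blast
    have e: "range e \<subseteq> X" using range_e I by simp
    define v where "v = cholesky a e"
    have a_eq: "a i j = (\<Sum>k<m. v k i * cnj (v k j))" if "i \<in> I" "j \<in> I" for i j
    proof -
      obtain l where "j = e l" "l < m" using \<open>j \<in> I\<close> C m by auto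
      then have "schur_rest a e m i j = 0"
        using schur_rest_eq_0[OF a e, of i l m] that I by auto
      then show ?thesis
        using cholesky_expansion[OF a e, of i j m] that I by (auto simp: v_def)
    qed
    \<comment> \<open>On \<open>I\<close> the kernel \<open>a\<close> is a sum of rank-one kernels,
      so the form of the product at \<open>c\<close> is a sum of forms of \<open>b\<close>, the
      \<open>k\<close>-th one at the coefficients \<open>c i * cnj (v k i)\<close>.\<close>
    have "(\<Sum>i\<in>I. \<Sum>j\<in>I. cnj (c i) * c j * (a i j * b i j)) =
        (\<Sum>i\<in>I. \<Sum>j\<in>I. \<Sum>k<m. cnj (c i * cnj (v k i)) * (c j * cnj (v k j)) * b i j)"
      by (intro sum.cong refl)
        (simp add: a_eq sum_distrib_left sum_distrib_right mult.assoc mult.left_commute)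
    also have "\<dots> = (\<Sum>k<m. \<Sum>i\<in>I. \<Sum>j\<in>I. cnj (c i * cnj (v k i)) * (c j * cnj (v k j)) * b i j)"
      by (simp only: sum.swap[of _ "{..<m}" I])
    finally show ?thesis
      by (simp only:) (intro sum_nonneg psd_kernelD[OF b I])
  qed simp
qed

lemma psd_kernel_one: "psd_kernel X (\<lambda>_ _. 1)"
proof (rule psd_kernelI)
  fix I and c :: "'a \<Rightarrow> complex"
  have "(\<Sum>i\<in>I. \<Sum>j\<in>I. cnj (c i) * c j * 1) = cnj (sum c I) * sum c I"
    by (simp add: sum_product cnj_sum)
  then show "0 \<le> (\<Sum>i\<in>I. \<Sum>j\<in>I. cnj (c i) * c j * 1)"
    by (simp only: cnj_mult_self_nonneg)
qed

lemma psd_kernel_prod: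
  assumes "\<And>n. n \<in> A \<Longrightarrow> psd_kernel X (a n)"
  shows "psd_kernel X (\<lambda>x y. \<Prod>n\<in>A. a n x y)"
  using assms
  by (induction A rule: infinite_finite_induct) (simp_all add: psd_kernel_one psd_kernel_mult)

text \<open>Exchanging one factor at a time writes the difference as \<open>b m - a m\<close> times
  the product of the other \<open>b n\<close>, plus \<open>a m\<close> times the difference for the
  other factors. Both are Schur products of positive kernels, because
  \<open>b n = (b n - a n) + a n\<close> is positive too.\<close>

lemma psd_kernel_prod_mono:
  assumes "finite A" "\<And>n. n \<in> A \<Longrightarrow> psd_kernel X (a n)"
    and "\<And>n. n \<in> A \<Longrightarrow> psd_kernel X (\<lambda>x y. b n x y - a n x y)"
  shows "psd_kernel X (\<lambda>x y. (\<Prod>n\<in>A. b n x y) - (\<Prod>n\<in>A. a n x y))"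
  using assms
proof (induction A rule: finite_induct)
  case empty
  then show ?case by (simp add: psd_kernel_def)
next
  case (insert m A)
  have b: "psd_kernel X (b n)" if "n \<in> A" for n
    using psd_kernel_add[OF insert.prems(1,2)[of n]] that by simp
  have "psd_kernel X (\<lambda>x y. (b m x y - a m x y) * (\<Prod>n\<in>A. b n x y) +
      a m x y * ((\<Prod>n\<in>A. b n x y) - (\<Prod>n\<in>A. a n x y)))"
    using insert.prems by (intro psd_kernel_add psd_kernel_mult psd_kernel_prod b insert.IH) auto
  moreover have "(b m x y - a m x y) * (\<Prod>n\<in>A. b n x y) +
      a m x y * ((\<Prod>n\<in>A. b n x y) - (\<Prod>n\<in>A. a n x y)) =
      (\<Prod>n\<in>insert m A. b n x y) - (\<Prod>n\<in>insert m A. a n x y)" for x y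
    using insert.hyps by (simp add: algebra_simps)
  ultimately show ?case by simp
qed

lemma psd_kernel_cinner: "psd_kernel X (\<lambda>x y. cinner (f x) (f y :: 'a::complex_hilbert_space))"
proof (rule psd_kernelI)
  fix I and c :: "'b \<Rightarrow> complex"
  show "0 \<le> (\<Sum>i\<in>I. \<Sum>j\<in>I. cnj (c i) * c j * cinner (f i) (f j))"
    unfolding cinner_sum_sum[symmetric] cinner_self by (simp add: less_eq_complex_def)
qed

subsection \<open>Orthonormal bases\<close>

lemma csubspace_imp_subspace: "csubspace V \<Longrightarrow> subspace (V :: 'a::complex_hilbert_space set)"
  unfolding csubspace_iff subspace_def by (metis scaleC_of_real)

lemma csubspace_closure:
  assumes "csubspace (V :: 'a::complex_hilbert_space set)"
  shows "csubspace (closure V)"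
  unfolding csubspace_iff
proof (intro conjI ballI allI)
  show "0 \<in> closure V"
    using assms closure_subset by (auto simp: csubspace_iff)
next
  fix x y assume "x \<in> closure V" "y \<in> closure V"
  then obtain f g where "\<And>n. f n \<in> V" "f \<longlonglongrightarrow> x" "\<And>n. g n \<in> V" "g \<longlonglongrightarrow> y"
    by (metis closure_sequential)
  then show "x + y \<in> closure V"
    using assms unfolding closure_sequential csubspace_iff
    by (intro exI[of _ "\<lambda>n. f n + g n"]) (auto intro: tendsto_add)
next
  fix c x assume "x \<in> closure V"
  then obtain f where "\<And>n. f n \<in> V" "f \<longlonglongrightarrow> x"
    by (metis closure_sequential)
  then show "c *\<^sub>C x \<in> closure V"
    using assms unfolding closure_sequential csubspace_iff
    by (intro exI[of _ "\<lambda>n. c *\<^sub>C f n"]) (auto intro: scaleC.tendsto)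
qed

lemma closed_subspace_projection:
  fixes V :: "'a::{real_inner, complete_space} set"
  assumes "closed V" "subspace V"
  obtains p where "p \<in> V" "\<And>v. v \<in> V \<Longrightarrow> inner (x - p) v = 0"
proof -
  define d where "d = (INF v\<in>V. norm (x - v))"
  have ne: "V \<noteq> {}" using \<open>subspace V\<close> subspace_0 by blast
  have bdd: "bdd_below ((\<lambda>v. norm (x - v)) ` V)"
    by (rule bdd_belowI2[of _ 0]) simp
  have d_le: "d \<le> norm (x - v)" if "v \<in> V" for v
    unfolding d_def using bdd that by (rule cINF_lower)
  have d0: "0 \<le> d"
    unfolding d_def using ne by (intro cINF_greatest) auto
  have "\<exists>v\<in>V. norm (x - v) < d + 1 / Suc n" for n
  proof -
    have "(INF v\<in>V. norm (x - v)) < d + 1 / Suc n" by (simp add: d_def[symmetric])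
    then show ?thesis using cINF_less_iff[OF ne bdd] by blast
  qed
  then obtain s where s: "\<And>n. s n \<in> V" "\<And>n. norm (x - s n) < d + 1 / Suc n"
    by metis
  \<comment> \<open>The parallelogram law, with the midpoint at distance at least \<open>d\<close>
    from \<open>x\<close>. The constant comes from
    \<open>4 * (d + t)\<^sup>2 - 4 * d\<^sup>2 = (8 * d + 4 * t) * t\<close> and
    \<open>t \<le> 1\<close>.\<close>
  have diff: "(norm (s n - s m))\<^sup>2 \<le> (8 * d + 4) * t"
    if t: "1 / Suc n \<le> t" "1 / Suc m \<le> t" "t \<le> 1" for n m t
  proof -
    have t0: "0 \<le> t" using t(1) by (rule order_trans[rotated]) simp
    have mid: "(1/2) *\<^sub>R (s n + s m) \<in> V"
      using s(1) \<open>subspace V\<close> by (simp add: subspace_add subspace_scale)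
    have "(norm (s n - s m))\<^sup>2 = 2 * (norm (x - s n))\<^sup>2 + 2 * (norm (x - s m))\<^sup>2
        - 4 * (norm (x - (1/2) *\<^sub>R (s n + s m)))\<^sup>2"
      unfolding power2_norm_eq_inner by (simp add: inner_diff inner_add inner_commute field_simps)
    also have "\<dots> \<le> 2 * (d + t)\<^sup>2 + 2 * (d + t)\<^sup>2 - 4 * d\<^sup>2"
      using s(2)[of n] s(2)[of m] t d_le[OF mid] d0
      by (intro diff_mono add_mono mult_left_mono power_mono) auto
    also have "\<dots> = (8 * d + 4 * t) * t"
      by (simp add: power2_eq_square algebra_simps)
    also have "\<dots> \<le> (8 * d + 4) * t"
      using t t0 by (intro mult_right_mono) auto
    finally show ?thesis .
  qed
  have "Cauchy s"
  proof (rule CauchyI)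
    fix r :: real assume r: "0 < r"
    \<comment> \<open>Taking \<open>5\<close> in place of the \<open>4\<close> above makes the
      resulting bound by \<open>r\<^sup>2\<close> strict.\<close>
    define t where "t = min 1 (r\<^sup>2 / (8 * d + 5))"
    have t: "0 < t" "t \<le> 1" "t * (8 * d + 5) \<le> r\<^sup>2"
    proof -
      show "0 < t" "t \<le> 1" using r d0 by (auto simp: t_def)
      have "t * (8 * d + 5) \<le> r\<^sup>2 / (8 * d + 5) * (8 * d + 5)"
        using d0 by (intro mult_right_mono) (auto simp: t_def)
      then show "t * (8 * d + 5) \<le> r\<^sup>2" using d0 by simp
    qed
    obtain M where M: "1 / Suc M < t"
      using t(1) nat_approx_posE by metis
    have "norm (s m - s n) < r" if "M \<le> m" "M \<le> n" for m n
    proof -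
      have le: "1 / Suc k \<le> t" if "M \<le> k" for k
      proof -
        have "1 / Suc k \<le> 1 / Suc M" using that by (intro divide_left_mono) auto
        with M show ?thesis by linarith
      qed
      have "(norm (s m - s n))\<^sup>2 \<le> (8 * d + 4) * t"
        using diff[of m t n] le that t by simp
      also have "\<dots> < r\<^sup>2"
        using t by (simp add: algebra_simps)
      finally show ?thesis
        using r by (simp add: power_less_imp_less_base)
    qed
    then show "\<exists>M. \<forall>m\<ge>M. \<forall>n\<ge>M. norm (s m - s n) < r" by blast
  qed
  then obtain p where p: "s \<longlonglongrightarrow> p"
    using Cauchy_convergent_iff convergent_def by blast
  have pV: "p \<in> V"
    using \<open>closed V\<close> s(1) p by (metis closed_sequentially)
  have "norm (x - p) \<le> d"
  proof (rule LIMSEQ_le)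
    show "(\<lambda>n. norm (x - s n)) \<longlonglongrightarrow> norm (x - p)"
      by (intro tendsto_intros p)
    show "(\<lambda>n. d + 1 / Suc n) \<longlonglongrightarrow> d"
      using tendsto_add[OF tendsto_const LIMSEQ_inverse_real_of_nat, of d]
      by (simp add: inverse_eq_divide)
    show "\<exists>N. \<forall>n\<ge>N. norm (x - s n) \<le> d + 1 / Suc n"
      using s(2) less_imp_le by blast
  qed
  then have min: "norm (x - p) \<le> norm (x - v)" if "v \<in> V" for v
    using d_le[OF that] by linarith
  have "inner (x - p) v = 0" if v: "v \<in> V" for v
  proof (rule ccontr)
    assume nz: "inner (x - p) v \<noteq> 0"
    \<comment> \<open>The minimiser of the distance to \<open>x\<close> along the line
      \<open>p + c *\<^sub>R v\<close>; it would lower the squared distance by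
      \<open>(inner (x - p) v)\<^sup>2 / inner v v\<close>.\<close>
    define c where "c = inner (x - p) v / inner v v"
    have v0: "inner v v \<noteq> 0" using nz by auto
    have "p + c *\<^sub>R v \<in> V"
      using pV v \<open>subspace V\<close> by (simp add: subspace_add subspace_scale)
    then have "(norm (x - p))\<^sup>2 \<le> (norm (x - (p + c *\<^sub>R v)))\<^sup>2"
      by (intro power_mono min) auto
    also have "x - (p + c *\<^sub>R v) = (x - p) - c *\<^sub>R v"
      by simp
    also have "(norm ((x - p) - c *\<^sub>R v))\<^sup>2 = (norm (x - p))\<^sup>2 - 2 * c * inner (x - p) v + c * c * inner v v"
      unfolding power2_norm_eq_inner by (simp add: inner_diff_left inner_diff_right inner_commute algebra_simps)
    also have "\<dots> = (norm (x - p))\<^sup>2 - (inner (x - p) v)\<^sup>2 / inner v v"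
      using v0 by (simp add: c_def field_simps power2_eq_square)
    finally have "(inner (x - p) v)\<^sup>2 / inner v v \<le> 0" by simp
    moreover have "0 < (inner (x - p) v)\<^sup>2 / inner v v"
      using nz v0 by (intro divide_pos_pos) (auto simp: less_le)
    ultimately show False by linarith
  qed
  with pV that show thesis by blast
qed

text \<open>Existence gives the choice made in \<open>op_trace\<close> its meaning. A maximal
  orthonormal set is total, since otherwise the normalised component of some vector orthogonal to
  the closed span could be adjoined.\<close>

lemma orthonormal_basis_exists: "\<exists>B. orthonormal_basis (B :: 'k::complex_hilbert_space set)"
proof -
  define \<A> where "\<A> = {B :: 'k set. (\<forall>e\<in>B. norm e = 1) \<and> pairwise (\<lambda>e f. cinner e f = 0) B}"
  have "\<exists>B\<in>\<A>. \<forall>X\<in>\<A>. B \<subseteq> X \<longrightarrow> X = B"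
  proof (rule subset_Zorn_nonempty)
    show "\<A> \<noteq> {}" by (auto simp: \<A>_def intro!: exI[of _ "{}"])
  next
    fix \<C> assume \<C>: "\<C> \<noteq> {}" "subset.chain \<A> \<C>"
    have "cinner e f = 0" if ef: "e \<in> \<Union>\<C>" "f \<in> \<Union>\<C>" "e \<noteq> f" for e f
    proof -
      obtain B1 B2 where "B1 \<in> \<C>" "e \<in> B1" "B2 \<in> \<C>" "f \<in> B2"
 using ef by blast
      then obtain B where "B \<in> \<C>" "e \<in> B" "f \<in> B"
        using \<C>(2) unfolding subset_chain_def by blast
      with \<C>(2) ef show ?thesis
        by (auto simp: subset_chain_def \<A>_def pairwise_def subset_iff)
    qed
    then show "\<Union>\<C> \<in> \<A>"
      using \<C>(2) by (auto simp: \<A>_def subset_chain_def pairwise_def subset_iff)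
  qed
  then obtain B where B: "B \<in> \<A>" and max: "\<And>X. X \<in> \<A> \<Longrightarrow> B \<subseteq> X \<Longrightarrow> X = B"
    by blast
  have "closure (cspan B) = UNIV"
  proof (rule ccontr)
    assume "closure (cspan B) \<noteq> UNIV"
    then obtain x where x: "x \<notin> closure (cspan B)" by blast
    have sub: "csubspace (closure (cspan B))"
      by (intro csubspace_closure complex_vector.subspace_span)
    obtain p where p: "p \<in> closure (cspan B)" "\<And>v. v \<in> closure (cspan B) \<Longrightarrow> inner (x - p) v = 0"
      using closed_subspace_projection[OF closed_closure csubspace_imp_subspace[OF sub]] by blast
    define u where "u = x - p"
    have u0: "u \<noteq> 0" using x p by (auto simp: u_def)
    define e where "e = complex_of_real (1 / norm u) *\<^sub>C u"
    have orth: "cinner e f = 0" if "f \<in> B" for f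
    proof -
      have f: "f \<in> closure (cspan B)"
        using that closure_subset complex_vector.span_base by blast
      \<comment> \<open>The projection gives only real orthogonality; testing with \<open>f\<close>
        and with \<open>\<i> *\<^sub>C f\<close> removes both parts of
        \<open>cinner u f\<close>.\<close>
      then have "\<i> *\<^sub>C f \<in> closure (cspan B)"
        using sub by (auto simp: csubspace_iff)
      with f p have "Re (cinner u f) = 0" "Re (cinner u (\<i> *\<^sub>C f)) = 0"
        by (auto simp: inner_eq_Re_cinner u_def)
      then show ?thesis
        by (simp add: e_def cinner_scaleC_left cinner_scaleC_right complex_eq_iff)
    qed
    have e1: "norm e = 1"
      using u0 by (simp add: e_def norm_scaleC norm_divide)
    have "insert e B \<in> \<A>"
      using B e1 orth by (auto simp: \<A>_def pairwise_insert) (metis cinner_commute complex_cnj_zero)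
    then have "e \<in> B" using max by blast
    then have "cinner e e = 0" by (rule orth)
    with e1 show False by (simp add: cinner_self)
  qed
  with B show ?thesis
    unfolding orthonormal_basis_def \<A>_def by blast
qed

text \<open>Parseval's identity for a basis of any cardinality. Once the finite set \<open>Y\<close>
  contains the support of an approximant \<open>z\<close>, the projection \<open>q\<close> of
  \<open>x\<close> onto the span of \<open>Y\<close> is at least as close to \<open>x\<close> as
  \<open>z\<close>, and Cauchy-Schwarz against \<open>y\<close> bounds the error of the partial sum.
  The \<open>+ 1\<close> in \<open>\<delta>\<close> covers \<open>y = 0\<close>.\<close>

lemma orthonormal_basis_has_sum:
  assumes B: "orthonormal_basis B"
  shows "((\<lambda>e. cinner x e * cinner e y) has_sum cinner x y) B"
  unfolding has_sum_def tendsto_iff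
proof (intro allI impI)
  fix r :: real assume r: "0 < r"
  define \<delta> where "\<delta> = r / (norm y + 1)"
  have \<delta>: "0 < \<delta>" using r by (simp add: \<delta>_def add_nonneg_pos)
  have "x \<in> closure (cspan B)" using B by (simp add: orthonormal_basis_def)
  then obtain z where z: "z \<in> cspan B" "norm (x - z) < \<delta>"
    using \<delta> by (metis closure_approachable dist_norm norm_minus_commute)
  then obtain J c where J: "finite J" "J \<subseteq> B" "z = (\<Sum>e\<in>J. c e *\<^sub>C e)"
    unfolding complex_vector.span_explicit by blast
  have "dist (\<Sum>e\<in>Y. cinner x e * cinner e y) (cinner x y) < r"
    if Y: "finite Y" "J \<subseteq> Y" "Y \<subseteq> B" for Y
  proof -
    define q where "q = (\<Sum>e\<in>Y. cinner e x *\<^sub>C e)"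
    have one: "cinner e e = 1" if "e \<in> B" for e
      using B that by (simp add: orthonormal_basis_def cinner_self)
    have zero: "cinner e f = 0" if "e \<in> B" "f \<in> B" "e \<noteq> f" for e f
      using B that by (auto simp: orthonormal_basis_def pairwise_def)
    have orth: "cinner (x - q) e = 0" if e: "e \<in> Y" for e
    proof -
      have "cinner q e = (\<Sum>f\<in>Y. if f = e then cinner x e else 0)"
        unfolding q_def cinner.sum_left using e Y
        by (intro sum.cong) (auto simp: cinner_scaleC_left one zero cinner_commute[of x e] subset_iff)
      then show ?thesis
        using e Y by (simp add: cinner.diff_left)
    qed
    have "cinner (x - q) (q - z) = 0"
    proof -
      have "cinner (x - q) q = 0"
        by (subst q_def, subst cinner.sum_right) (simp add: cinner_scaleC_right orth)
      moreover have "cinner (x - q) z = 0"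
        using Y orth by (simp add: J(3) cinner.sum_right cinner_scaleC_right subset_iff)
      ultimately show ?thesis by (simp add: cinner.diff_right)
    qed
    then have "inner (x - q) (q - z) = 0"
      by (simp add: inner_eq_Re_cinner)
    then have "(norm (x - z))\<^sup>2 = (norm (x - q))\<^sup>2 + (norm (q - z))\<^sup>2"
      using norm_add_Pythagorean[of "x - q" "q - z"] by (simp add: orthogonal_def)
    then have "norm (x - q) \<le> norm (x - z)"
      by - (rule power2_le_imp_le, simp_all)
    have "cinner x y - (\<Sum>e\<in>Y. cinner x e * cinner e y) = cinner (x - q) y"
      unfolding q_def cinner.diff_left cinner.sum_left cinner_scaleC_left
      by (simp add: cinner_commute[symmetric])
    then have "dist (\<Sum>e\<in>Y. cinner x e * cinner e y) (cinner x y) = cmod (cinner (x - q) y)"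
      by (metis dist_norm norm_minus_commute)
    also have "\<dots> \<le> norm (x - q) * norm y"
      by (rule norm_cinner_le)
    also have "\<dots> \<le> \<delta> * norm y"
      using \<open>norm (x - q) \<le> norm (x - z)\<close> z(2) by (intro mult_right_mono) auto
    also have "\<dots> < \<delta> * (norm y + 1)"
      using \<delta> by simp
    also have "\<dots> = r"
      using add_nonneg_pos[OF norm_ge_zero[of y] zero_less_one] by (simp add: \<delta>_def)
    finally show ?thesis .
  qed
  then show "\<forall>\<^sub>F Y in finite_subsets_at_top B. dist (\<Sum>e\<in>Y. cinner x e * cinner e y) (cinner x y) < r"
    unfolding eventually_finite_subsets_at_top using J by blast
qed

subsection \<open>Positive operators\<close>

lemma bounded_op_sum:
  assumes "csubspace H" "bounded_op H A" "\<And>i. i \<in> I \<Longrightarrow> x i \<in> H"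
  shows "A (\<Sum>i\<in>I. c i *\<^sub>C x i) = (\<Sum>i\<in>I. c i *\<^sub>C A (x i))"
  using assms(3)
proof (induction I rule: infinite_finite_induct)
  case (insert i I)
  then have "(\<Sum>i\<in>I. c i *\<^sub>C x i) \<in> H" "c i *\<^sub>C x i \<in> H"
    using assms(1) by (auto intro!: complex_vector.subspace_sum complex_vector.subspace_scale)
  with insert assms(2) show ?case
    by (simp add: bounded_op_def)
next
  case empty
  have "0 \<in> H" "A (0 *\<^sub>C 0) = 0 *\<^sub>C A 0"
    using assms(1,2) unfolding csubspace_iff bounded_op_def by blast+
  then show ?case by (simp add: scaleC.zero_left)
next
  case (infinite I)
  have "0 \<in> H" "A (0 *\<^sub>C 0) = 0 *\<^sub>C A 0"
    using assms(1,2) unfolding csubspace_iff bounded_op_def by blast+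
  with infinite show ?case by (simp add: scaleC.zero_left)
qed

lemma bounded_opE:
  assumes "bounded_op H A"
  obtains C where "0 \<le> C" "\<And>x. x \<in> H \<Longrightarrow> norm (A x) \<le> C * norm x"
proof -
  obtain B where B: "\<And>x. x \<in> H \<Longrightarrow> norm (A x) \<le> B * norm x"
    using assms unfolding bounded_op_def by blast
  have "norm (A x) \<le> \<bar>B\<bar> * norm x" if "x \<in> H" for x
    using B[OF that] by (rule order_trans) (simp add: mult_right_mono)
  then show thesis using that[of "\<bar>B\<bar>"] by simp
qed

lemma csubspace_UNIV: "csubspace (UNIV :: 'a::complex_hilbert_space set)"
  by (simp add: csubspace_iff)

lemma bounded_op_UNIV_bounded_linear:
  assumes "bounded_op UNIV A"
  shows "bounded_linear A"
proof -
  obtain C where "0 \<le> C" "\<And>x. norm (A x) \<le> C * norm x"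
    using bounded_opE[OF assms] by auto
  moreover have "A (r *\<^sub>R x) = r *\<^sub>R A x" for r x
    using assms unfolding bounded_op_def by (metis scaleC_of_real UNIV_I)
  ultimately show ?thesis
    using assms by (intro bounded_linear_intro[of _ C]) (auto simp: bounded_op_def mult.commute)
qed

lemma positive_op_psd_kernel:
  assumes H: "csubspace H" and A: "positive_op H A"
  shows "psd_kernel H (\<lambda>x y. cinner x (A y))"
proof (rule psd_kernelI)
  fix I :: "'a set" and c :: "'a \<Rightarrow> complex" assume I: "finite I" "I \<subseteq> H"
  define v where "v = (\<Sum>i\<in>I. c i *\<^sub>C i)"
  have v: "v \<in> H"
    unfolding v_def using H I
    by (intro complex_vector.subspace_sum complex_vector.subspace_scale) auto
  have "A v = (\<Sum>i\<in>I. c i *\<^sub>C A i)"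
    unfolding v_def using A I by (intro bounded_op_sum[OF H]) (auto simp: positive_op_def)
  then have eq: "cinner v (A v) = (\<Sum>i\<in>I. \<Sum>j\<in>I. cnj (c i) * c j * cinner i (A j))"
    by (simp only: v_def cinner_sum_sum)
  have "0 \<le> cinner v (A v)"
    using A v by (simp add: positive_op_def nonneg_Reals_iff)
  then show "0 \<le> (\<Sum>i\<in>I. \<Sum>j\<in>I. cnj (c i) * c j * cinner i (A j))"
    by (simp only: eq)
qed

lemma positive_op_symmetric:
  assumes "csubspace H" "positive_op H A" "x \<in> H" "y \<in> H"
  shows "cinner (A x) y = cinner x (A y)"
  using psd_kernel_cnj[OF positive_op_psd_kernel[OF assms(1,2)] assms(4,3)]
  by (metis cinner_commute)

subsection \<open>The trace of a density operator against a positive operator\<close>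

lemma density_operator_summable:
  assumes \<rho>: "density_operator \<rho>" and B_def: "B = (SOME B. orthonormal_basis B)"
  shows "((\<lambda>e. cinner e (\<rho> e)) has_sum 1) B"
proof -
  have eq: "infsum (\<lambda>e. cinner e (\<rho> e)) B = 1"
    using \<rho> by (simp add: B_def density_operator_def op_trace_def)
  then have "(\<lambda>e. cinner e (\<rho> e)) summable_on B"
    using infsum_not_exists by fastforce
  then show ?thesis using eq by (metis has_sum_infsum)
qed

text \<open>
  The Cholesky factors of the kernel \<open>\<langle>x, \<rho> y\<rangle>\<close> along an enumeration of the basis are of the form
  \<open>\<langle>x, w k\<rangle>\<close>, so that \<open>\<rho> = \<Sum>k. |w k\<rangle>\<langle>w k|\<close>; no spectral theorem or square root is needed.
\<close>

lemma density_operator_decomposition: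
  fixes \<rho> :: "'k::complex_hilbert_space \<Rightarrow> 'k"
  assumes \<rho>: "density_operator \<rho>" and B_def: "B = (SOME B. orthonormal_basis B)"
  shows "\<exists>w :: nat \<Rightarrow> 'k. \<forall>x. \<forall>b\<in>B.
    ((\<lambda>k. cinner x (w k) * cinner (w k) b) has_sum cinner x (\<rho> b)) UNIV"
proof -
  define a where "a = (\<lambda>x y. cinner x (\<rho> y))"
  have a: "psd_kernel UNIV a"
    unfolding a_def using \<rho>
    by (intro positive_op_psd_kernel csubspace_UNIV) (simp add: density_operator_def)
  have sum: "((\<lambda>b. a b b) has_sum 1) B"
    unfolding a_def by (rule density_operator_summable[OF \<rho> B_def])
  \<comment> \<open>A summable diagonal has countable support, so the elimination can run along a
    sequence even for an uncountable basis. The support is nonempty because the trace is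
    \<open>1\<close>.\<close>
  define S where "S = {b \<in> B. a b b \<noteq> 0}"
  have "countable S"
    unfolding S_def using sum by (intro summable_countable_complex) (auto simp: summable_on_def)
  moreover have "S \<noteq> {}"
  proof
    assume "S = {}"
    then have "((\<lambda>b. a b b) has_sum 0) B"
      by (intro has_sum_0) (auto simp: S_def)
    then show False using sum has_sum_unique by fastforce
  qed
  define e where "e = from_nat_into S"
  have e: "range e = S"
    using \<open>countable S\<close> \<open>S \<noteq> {}\<close> by (simp add: e_def)
  note U = a subset_UNIV
  \<comment> \<open>A column starts as \<open>cinner x (\<rho> y)\<close>, and each step subtracts a
    multiple of another column, so it remains the inner product with a fixed vector.\<close>
  have "\<exists>u. \<forall>x. schur_rest a e k x y = cinner x u" for k y
  proof (induction k arbitrary: y)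
    case 0
    show ?case by (auto simp: a_def)
  next
    case (Suc k)
    obtain u u' where "\<And>x. schur_rest a e k x y = cinner x u"
      "\<And>x. schur_rest a e k x (e k) = cinner x u'"
      using Suc.IH by metis
    then show ?case
      by (intro exI[of _ "u - (schur_rest a e k (e k) y / schur_rest a e k (e k) (e k)) *\<^sub>C u'"])
        (simp add: cinner.diff_right cinner_scaleC_right)
  qed
  then have "\<forall>k. \<exists>u. \<forall>x. schur_rest a e k x (e k) = cinner x u"
    by blast
  then obtain u where u: "\<And>x k. schur_rest a e k x (e k) = cinner x (u k)"
    by metis
  define w where
    "w k = (1 / complex_of_real (sqrt (Re (schur_rest a e k (e k) (e k))))) *\<^sub>C u k" for k
  have w: "cholesky a e k x = cinner x (w k)" for k x
    by (simp add: cholesky_def u w_def cinner_scaleC_right)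
  have exp: "a x y = (\<Sum>k<m. cinner x (w k) * cinner (w k) y) + schur_rest a e m x y" for x y m
    using cholesky_expansion[OF U, of x y e m] by (simp add: w cinner_commute[symmetric])
  have "((\<lambda>k. cinner x (w k) * cinner (w k) b) has_sum a x b) UNIV" if "b \<in> B" for x b
  proof (cases "b \<in> S")
    case True
    then obtain j where j: "b = e j" using e by blast
    have r: "schur_rest a e m x b = 0" if "j < m" for x m
      using schur_rest_eq_0[OF U, of x j m e] that j by simp
    \<comment> \<open>Since \<open>b = e j\<close> is eliminated in step \<open>j\<close>, all later
      \<open>w k\<close> are orthogonal to it and the series is finite.\<close>
    have 0: "cinner (w k) b = 0" if "k \<notin> {..<Suc j}" for k
    proof -
      have "schur_rest a e k b (e k) = 0"
        using psd_kernel_cnj[OF psd_kernel_schur_rest[OF U], of "e k" b e k] r[of k "e k"] that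
        by simp
      then show ?thesis
        using w[of k b] by (simp add: cholesky_def cinner_commute[of "w k"])
    qed
    show ?thesis
      by (rule has_sum_finite_neutralI[of "{..<Suc j}"])
        (use exp[of x b "Suc j"] r[of "Suc j" x] 0 in auto)
  next
    case False
    then have b0: "a b b = 0" using that by (simp add: S_def)
    then have x0: "a x b = 0" using psd_kernel_zero[OF a] by simp
    \<comment> \<open>At \<open>x = y = b\<close> the expansion writes \<open>a b b = 0\<close> as a
      sum of nonnegative terms and a nonnegative remainder, so every term vanishes.\<close>
    have 0: "cinner (w k) b = 0" for k
    proof -
      have nn: "0 \<le> cinner b (w i) * cinner (w i) b" for i
        using cnj_mult_self_nonneg[of "cinner (w i) b"] by (simp add: cinner_commute[symmetric])
      have nn': "0 \<le> schur_rest a e (Suc k) b b"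
        by (rule psd_kernel_diag[OF psd_kernel_schur_rest[OF U] UNIV_I])
      have "cinner b (w k) * cinner (w k) b \<le> (\<Sum>i<Suc k. cinner b (w i) * cinner (w i) b)"
        using sum_nonneg[of "{..<k}" "\<lambda>i. cinner b (w i) * cinner (w i) b"] nn by simp
      also have "\<dots> \<le> 0"
        using exp[of b b "Suc k"] b0 nn' by (metis add_nonneg_nonneg eq_iff le_add_same_cancel1)
      finally have "cinner b (w k) * cinner (w k) b = 0"
        using nn[of k] by (rule antisym)
      then show ?thesis by (metis cinner_commute complex_cnj_zero mult_eq_0_iff)
    qed
    show ?thesis by (simp add: 0 x0)
  qed
  then show ?thesis unfolding a_def by blast
qed

lemma Re_cinner_mult_cinner:
  fixes x y :: "'a::complex_hilbert_space"
  shows "Re (cinner x y * cinner y x) = (cmod (cinner y x))\<^sup>2"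
    and "Re (cinner y x * cinner x y) = (cmod (cinner y x))\<^sup>2"
proof -
  have "cinner x y = cnj (cinner y x)" by (rule cinner_commute)
  then show "Re (cinner x y * cinner y x) = (cmod (cinner y x))\<^sup>2"
    "Re (cinner y x * cinner x y) = (cmod (cinner y x))\<^sup>2"
    by (simp_all only: cmod_power2) (simp_all add: power2_eq_square)
qed

lemma orthonormal_basis_norm_has_sum:
  assumes "orthonormal_basis B"
  shows "((\<lambda>e. (cmod (cinner e x))\<^sup>2) has_sum (norm x)\<^sup>2) B"
  using has_sum_Re[OF orthonormal_basis_has_sum[OF assms, of x x]]
  by (simp only: Re_cinner_mult_cinner) (simp add: cinner_self)

text \<open>Both sides are iterated sums of \<open>t (k, b)\<close>: over \<open>b\<close> first,
  Parseval gives \<open>cinner (F (w k)) (w k)\<close>; over \<open>k\<close> first, the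
  decomposition of \<open>\<rho>\<close> gives \<open>cinner b (\<rho> (F b))\<close>. The vectors
  \<open>w\<close> are chosen before \<open>F\<close>, so one countable family of vector states
  serves all measurements.\<close>

lemma density_operator_trace:
  fixes \<rho> :: "'k::complex_hilbert_space \<Rightarrow> 'k"
  assumes \<rho>: "density_operator \<rho>"
  shows "\<exists>w :: nat \<Rightarrow> 'k. \<forall>F. positive_op UNIV F \<longrightarrow>
    (\<lambda>k. cinner (w k) (F (w k))) sums op_trace (\<rho> \<circ> F)"
proof -
  define B :: "'k set" where "B = (SOME B. orthonormal_basis B)"
  have B: "orthonormal_basis B"
    unfolding B_def using orthonormal_basis_exists by (rule someI_ex)
  obtain w :: "nat \<Rightarrow> 'k" where
    "\<forall>x. \<forall>b\<in>B. ((\<lambda>k. cinner x (w k) * cinner (w k) b) has_sum cinner x (\<rho> b)) UNIV"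
    using density_operator_decomposition[OF \<rho> B_def] by (rule exE)
  then have w: "((\<lambda>k. cinner x (w k) * cinner (w k) b) has_sum cinner x (\<rho> b)) UNIV"
    if "b \<in> B" for x b
    using that by blast
  have pos: "positive_op UNIV \<rho>" using \<rho> by (simp add: density_operator_def)
  \<comment> \<open>Summed over \<open>k\<close> these squares give the diagonal of
    \<open>\<rho>\<close>, which is summable; summed over \<open>b\<close> they give
    \<open>(norm (w k))\<^sup>2\<close>. Hence the squared norms of the \<open>w k\<close> are
    summable.\<close>
  have 1: "(\<lambda>(b, k). (cmod (cinner b (w k)))\<^sup>2) summable_on B \<times> UNIV"
  proof (rule summable_on_SigmaI)
    fix b assume "b \<in> B"
    show "((\<lambda>k. case (b, k) of (b, k) \<Rightarrow> (cmod (cinner b (w k)))\<^sup>2) has_sum Re (cinner b (\<rho> b))) UNIV"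
      using has_sum_Re[OF w[OF \<open>b \<in> B\<close>, of b]] by (simp only: Re_cinner_mult_cinner(2) prod.case)
  next
    show "(\<lambda>b. Re (cinner b (\<rho> b))) summable_on B"
      using has_sum_Re[OF density_operator_summable[OF \<rho> B_def]] by (auto simp: summable_on_def)
  qed simp
  then have 1: "(\<lambda>(k, b). (cmod (cinner b (w k)))\<^sup>2) summable_on UNIV \<times> B"
    by (subst summable_on_swap) (simp add: case_prod_unfold)
  have w_summable: "(\<lambda>k. (norm (w k))\<^sup>2) summable_on UNIV"
  proof -
    have "(\<lambda>k. infsum (\<lambda>b. case (k, b) of (k, b) \<Rightarrow> (cmod (cinner b (w k)))\<^sup>2) B) summable_on UNIV"
      using orthonormal_basis_norm_has_sum[OF B]
      by (intro summable_on_SigmaD[OF 1]) (auto simp: summable_on_def)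
    then show ?thesis
      by (simp add: infsumI[OF orthonormal_basis_norm_has_sum[OF B]])
  qed
  have "(\<lambda>k. cinner (w k) (F (w k))) sums op_trace (\<rho> \<circ> F)" if F: "positive_op UNIV F" for F
  proof -
    obtain C where C: "0 \<le> C" "\<And>x. norm (F x) \<le> C * norm x"
      using F bounded_opE[of UNIV F] by (auto simp: positive_op_def)
    have "(\<lambda>k. (norm (F (w k)))\<^sup>2) summable_on UNIV"
    proof (rule summable_on_comparison_test)
      show "(\<lambda>k. C\<^sup>2 * (norm (w k))\<^sup>2) summable_on UNIV"
        by (intro summable_on_cmult_right w_summable)
      show "(norm (F (w k)))\<^sup>2 \<le> C\<^sup>2 * (norm (w k))\<^sup>2" for k
        using C(2)[of "w k"] by (simp add: power_mult_distrib[symmetric] power_mono)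
    qed auto
    then have 2: "(\<lambda>(k, b). (cmod (cinner b (F (w k))))\<^sup>2) summable_on UNIV \<times> B"
      using orthonormal_basis_norm_has_sum[OF B] by (intro summable_on_SigmaI) auto
    define t where "t = (\<lambda>(k, b). cinner (F (w k)) b * cinner b (w k))"
    \<comment> \<open>The product of two moduli is at most the sum of their squares, and boundedness
      of \<open>F\<close> carries summability from \<open>w k\<close> to
      \<open>F (w k)\<close>.\<close>
    have "(\<lambda>z. norm (t z)) summable_on UNIV \<times> B"
    proof (rule Infinite_Sum.abs_summable_on_comparison_test')
      show "(\<lambda>z. (\<lambda>(k, b). (cmod (cinner b (F (w k))))\<^sup>2) z + (\<lambda>(k, b). (cmod (cinner b (w k)))\<^sup>2) z)
          summable_on UNIV \<times> B"
        by (intro summable_on_add 1 2)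
      fix z assume "z \<in> (UNIV :: nat set) \<times> B"
      obtain k b where z: "z = (k, b)" by (cases z)
      have "norm (t z) = cmod (cinner b (F (w k))) * cmod (cinner b (w k))"
        by (simp add: z t_def norm_mult) (metis cinner_commute complex_mod_cnj)
      also have "\<dots> \<le> (cmod (cinner b (F (w k))))\<^sup>2 + (cmod (cinner b (w k)))\<^sup>2"
        by (rule order_trans[OF _ sum_squares_bound]) (simp add: mult.assoc)
      finally show "norm (t z) \<le> (\<lambda>(k, b). (cmod (cinner b (F (w k))))\<^sup>2) z + (\<lambda>(k, b). (cmod (cinner b (w k)))\<^sup>2) z"
        by (simp add: z)
    qed
    then obtain s where s: "(t has_sum s) (UNIV \<times> B)"
      using abs_summable_summable by (auto simp: summable_on_def)
    have "((\<lambda>k. cinner (F (w k)) (w k)) has_sum s) UNIV"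
      by (rule has_sum_SigmaD[OF s]) (simp add: t_def orthonormal_basis_has_sum[OF B])
    moreover have "((\<lambda>b. cinner b (\<rho> (F b))) has_sum s) B"
    proof (rule has_sum_SigmaD[OF has_sum_swap[THEN iffD1, OF s]])
      fix b assume b: "b \<in> B"
      have "((\<lambda>k. cnj (cinner (F b) (w k) * cinner (w k) b)) has_sum cnj (cinner (F b) (\<rho> b))) UNIV"
        using w[OF b] by (simp only: has_sum_cnj_iff)
      moreover have "cnj (cinner (F b) (\<rho> b)) = cinner b (\<rho> (F b))"
        using positive_op_symmetric[OF csubspace_UNIV pos, of b "F b"] by (simp add: cinner_commute[symmetric])
      moreover have "cnj (cinner (F b) (w k) * cinner (w k) b) = cinner (F (w k)) b * cinner b (w k)" for k
        using positive_op_symmetric[OF csubspace_UNIV F, of "w k" b] by (simp add: cinner_commute[symmetric])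
      ultimately show "((\<lambda>k. case (b, k) of (x, y) \<Rightarrow> t (y, x)) has_sum cinner b (\<rho> (F b))) UNIV"
        by (simp add: t_def)
    qed
    then have "op_trace (\<rho> \<circ> F) = s"
      unfolding op_trace_def B_def[symmetric] by (simp add: infsumI)
    moreover have "cinner (F (w k)) (w k) = cinner (w k) (F (w k))" for k
      by (rule positive_op_symmetric[OF csubspace_UNIV F]) auto
    ultimately show ?thesis by (simp add: has_sum_imp_sums)
  qed
  then show ?thesis by blast
qed

subsection \<open>Tensor products of positive operators\<close>

text \<open>A vector of the span has many representations by product vectors, so the operator is
  given by its graph: the bound, applied to differences, makes the closure \<open>R\<close> of the
  graph single-valued, and well-definedness needs no separate argument.\<close>

lemma bounded_op_extension:
  fixes G :: "('k::complex_hilbert_space \<times> 'k) set"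
  assumes add: "\<And>a b a' b'. (a, b) \<in> G \<Longrightarrow> (a', b') \<in> G \<Longrightarrow> (a + a', b + b') \<in> G"
    and scale: "\<And>a b c. (a, b) \<in> G \<Longrightarrow> (c *\<^sub>C a, c *\<^sub>C b) \<in> G"
    and bound: "\<And>a b. (a, b) \<in> G \<Longrightarrow> norm b \<le> C * norm a"
    and dense: "closure (fst ` G) = UNIV"
  obtains F where "bounded_op UNIV F" "\<And>a b. (a, b) \<in> G \<Longrightarrow> F a = b"
proof -
  define R where "R x y \<longleftrightarrow> (\<exists>s t. (\<forall>n. (s n, t n) \<in> G) \<and> s \<longlonglongrightarrow> x \<and> t \<longlonglongrightarrow> y)" for x y
  have R_G: "R a b" if "(a, b) \<in> G" for a b
    unfolding R_def using that by (intro exI[of _ "\<lambda>_. a"] exI[of _ "\<lambda>_. b"]) auto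
  have R_add: "R (x + x') (y + y')" if "R x y" "R x' y'" for x x' y y'
  proof -
    from that obtain s t s' t' where "\<And>n. (s n, t n) \<in> G" "s \<longlonglongrightarrow> x" "t \<longlonglongrightarrow> y"
      "\<And>n. (s' n, t' n) \<in> G" "s' \<longlonglongrightarrow> x'" "t' \<longlonglongrightarrow> y'"
      unfolding R_def by metis
    then show ?thesis unfolding R_def
      by (intro exI[of _ "\<lambda>n. s n + s' n"] exI[of _ "\<lambda>n. t n + t' n"]) (auto intro!: add tendsto_add)
  qed
  have R_scale: "R (c *\<^sub>C x) (c *\<^sub>C y)" if "R x y" for c x y
  proof -
    from that obtain s t where "\<And>n. (s n, t n) \<in> G" "s \<longlonglongrightarrow> x" "t \<longlonglongrightarrow> y"
      unfolding R_def by metis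
    then show ?thesis unfolding R_def
      by (intro exI[of _ "\<lambda>n. c *\<^sub>C s n"] exI[of _ "\<lambda>n. c *\<^sub>C t n"]) (auto intro!: scale scaleC.tendsto)
  qed
  have R_bound: "norm y \<le> C * norm x" if "R x y" for x y
  proof -
    from that obtain s t where st: "\<And>n. (s n, t n) \<in> G" "s \<longlonglongrightarrow> x" "t \<longlonglongrightarrow> y"
      unfolding R_def by metis
    show ?thesis
      by (rule LIMSEQ_le[of "\<lambda>n. norm (t n)" _ "\<lambda>n. C * norm (s n)"])
        (use st bound in \<open>auto intro!: tendsto_intros\<close>)
  qed
  have R_unique: "y = y'" if "R x y" "R x y'" for x y y'
  proof -
    have "R (x + (-1) *\<^sub>C x) (y + (-1) *\<^sub>C y')"
      using that by (intro R_add R_scale)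
    then show ?thesis using R_bound[of 0 "y - y'"] by (simp add: scaleC_minus1)
  qed
  have "\<exists>y. R x y" for x
  proof -
    have "x \<in> closure (fst ` G)" using dense by simp
    then obtain s where s: "\<And>n. s n \<in> fst ` G" "s \<longlonglongrightarrow> x"
      unfolding closure_sequential by blast
    then have "\<forall>n. \<exists>b. (s n, b) \<in> G" by force
    then obtain t where t: "\<And>n. (s n, t n) \<in> G" by metis
    have diff: "norm (t m - t n) \<le> C * norm (s m - s n)" for m n
      using bound[OF add[OF t[of m] scale[OF t[of n], of "-1"]]] by (simp add: scaleC_minus1)
    have "Cauchy t"
    proof (rule CauchyI)
      fix r :: real assume r: "0 < r"
      have "Cauchy s" using s(2) by (rule LIMSEQ_imp_Cauchy)
      then obtain M where M: "\<And>m n. M \<le> m \<Longrightarrow> M \<le> n \<Longrightarrow> norm (s m - s n) < r / (\<bar>C\<bar> + 1)"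
        using r by (auto dest!: CauchyD[of s "r / (\<bar>C\<bar> + 1)"])
      have "norm (t m - t n) < r" if "M \<le> m" "M \<le> n" for m n
      proof -
        have "norm (t m - t n) \<le> C * norm (s m - s n)" by (rule diff)
        also have "\<dots> \<le> (\<bar>C\<bar> + 1) * norm (s m - s n)" by (intro mult_right_mono) auto
        also have "\<dots> < (\<bar>C\<bar> + 1) * (r / (\<bar>C\<bar> + 1))"
          using M[OF that] by (intro mult_strict_left_mono) auto
        also have "\<dots> = r" by (simp add: add_nonneg_eq_0_iff)
        finally show ?thesis .
      qed
      then show "\<exists>M. \<forall>m\<ge>M. \<forall>n\<ge>M. norm (t m - t n) < r" by blast
    qed
    then obtain y where "t \<longlonglongrightarrow> y"
      using Cauchy_convergent_iff convergent_def by blast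
    with s t show ?thesis unfolding R_def by blast
  qed
  then obtain F where F: "\<And>x. R x (F x)" by metis
  have "bounded_op UNIV F"
    unfolding bounded_op_def using F R_add R_scale R_bound R_unique by blast
  moreover have "F a = b" if "(a, b) \<in> G" for a b
    using R_unique[OF F R_G[OF that]] .
  ultimately show thesis by (rule that)
qed

text \<open>Indexing by arguments of \<open>T\<close>, not by its values, lets quadratic forms on
  the span be read as forms of kernels on \<open>P\<close>.\<close>

lemma cspan_image_explicit:
  assumes "v \<in> cspan (T ` P)"
  obtains I c where "finite I" "I \<subseteq> P" "v = (\<Sum>x\<in>I. c x *\<^sub>C T x)"
proof -
  obtain t r where t: "finite t" "t \<subseteq> T ` P" "v = (\<Sum>a\<in>t. r a *\<^sub>C a)"
    using assms unfolding complex_vector.span_explicit by blast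
  have inj: "inj_on (inv_into P T) t"
    using t(2) by (rule inj_on_inv_into)
  have "v = (\<Sum>x\<in>inv_into P T ` t. r (T x) *\<^sub>C T x)"
    using t by (simp add: sum.reindex[OF inj] f_inv_into_f subset_iff)
  moreover have "inv_into P T ` t \<subseteq> P"
    using t(2) by (auto intro: inv_into_into)
  ultimately show thesis using that[of "inv_into P T ` t" "r \<circ> T"] t(1) by simp
qed

lemma bounded_op_eqI:
  assumes "bounded_op UNIV F" "bounded_op UNIV F'" "closure (cspan S) = UNIV"
    and "\<And>x. x \<in> S \<Longrightarrow> F x = F' x"
  shows "F = F'"
proof
  fix v
  have "v \<in> closure (cspan S)" using assms(3) by simp
  then obtain s where s: "\<And>n. s n \<in> cspan S" "s \<longlonglongrightarrow> v"
    unfolding closure_sequential by blast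
  have eq: "F x = F' x" if "x \<in> cspan S" for x
    using that
  proof (rule complex_vector.span_induct)
    have "F 0 = 0" "F' 0 = 0"
      using assms(1,2) bounded_linear.linear[OF bounded_op_UNIV_bounded_linear] linear_0 by blast+
    then show "csubspace {x. F x = F' x}"
      using assms(1,2) by (simp add: csubspace_iff bounded_op_def)
  qed (rule assms(4))
  have "(\<lambda>n. F (s n)) \<longlonglongrightarrow> F v" "(\<lambda>n. F' (s n)) \<longlonglongrightarrow> F' v"
    by (rule bounded_linear.tendsto[OF bounded_op_UNIV_bounded_linear], fact, fact)+
  then show "F v = F' v"
    using eq[OF s(1)] LIMSEQ_unique by simp
qed

section \<open>Operators on the tensor product\<close>

locale tensor_product =
  fixes N :: nat and H :: "nat \<Rightarrow> 'h::complex_hilbert_space set"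
    and T :: "(nat \<Rightarrow> 'h) \<Rightarrow> 'k::complex_hilbert_space"
  assumes tensor: "hilbert_tensor_product N H T"
    and subspaces: "\<And>n. n \<in> {1..N} \<Longrightarrow> csubspace (H n)"
begin

abbreviation P :: "(nat \<Rightarrow> 'h) set" where "P \<equiv> Pi {1..N} H"

lemma cinner_T: "x \<in> P \<Longrightarrow> y \<in> P \<Longrightarrow> cinner (T x) (T y) = (\<Prod>n=1..N. cinner (x n) (y n))"
  using tensor unfolding hilbert_tensor_product_def by blast

lemma dense: "closure (cspan (T ` P)) = UNIV"
  using tensor unfolding hilbert_tensor_product_def by blast

text \<open>That coordinates outside \<open>{1..N}\<close> do not matter is forced by the inner
  products: they make \<open>T x - T y\<close> a vector of norm zero.\<close>

lemma T_cong:
  assumes "x \<in> P" "\<And>n. n \<in> {1..N} \<Longrightarrow> x n = y n"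
  shows "T x = T y"
proof -
  have y: "y \<in> P" using assms by (metis (no_types, lifting) Pi_cong)
  have eq: "(\<Prod>n=1..N. cinner (u n) (v n)) = (\<Prod>n=1..N. cinner (x n) (x n))"
    if "u \<in> {x, y}" "v \<in> {x, y}" for u v
  proof (rule prod.cong[OF refl])
    fix n assume "n \<in> {1..N}"
    then have "u n = x n" "v n = x n" using that assms(2)[of n] by auto
    then show "cinner (u n) (v n) = cinner (x n) (x n)" by simp
  qed
  have "cinner (T x - T y) (T x - T y) = 0"
    using eq[of x y] eq[of y x] eq[of y y] assms(1) y
    by (simp add: cinner.diff_left cinner.diff_right cinner_T)
  then show ?thesis by (simp add: cinner_self_eq_0_iff)
qed

context
  fixes A :: "nat \<Rightarrow> 'h \<Rightarrow> 'h"
  assumes A: "\<And>n. n \<in> {1..N} \<Longrightarrow> positive_op (H n) (A n)"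
begin

lemma tensor_map_in: "x \<in> P \<Longrightarrow> (\<lambda>n. A n (x n)) \<in> P"
  using A unfolding positive_op_def bounded_op_def by (auto simp: Pi_iff)

text \<open>
  Boundedness of the algebraic tensor product on the span of the product vectors is the Loewner
  monotonicity of Schur products, applied to \<open>\<langle>A x, A y\<rangle> \<le> C\<^sup>2 \<langle>x, y\<rangle>\<close> in every factor.
\<close>

lemma tensor_op_exists:
  "\<exists>F. bounded_op UNIV F \<and> (\<forall>x\<in>P. F (T x) = T (\<lambda>n. A n (x n)))"
proof -
  define A' where "A' x = (\<lambda>n. A n (x n))" for x :: "nat \<Rightarrow> 'h"
  have A'P: "A' x \<in> P" if "x \<in> P" for x
    unfolding A'_def by (rule tensor_map_in[OF that])
  have "\<exists>C. 0 \<le> C \<and> (\<forall>x\<in>H n. norm (A n x) \<le> C * norm x)" if n: "n \<in> {1..N}" for n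
    using A[OF n] bounded_opE[of "H n" "A n"] unfolding positive_op_def by metis
  then obtain C where C: "\<And>n. n \<in> {1..N} \<Longrightarrow> 0 \<le> C n"
    "\<And>n x. n \<in> {1..N} \<Longrightarrow> x \<in> H n \<Longrightarrow> norm (A n x) \<le> C n * norm x"
    by metis
  define G where "G = {(a, b). \<exists>I c. finite I \<and> I \<subseteq> P \<and>
    a = (\<Sum>x\<in>I. c x *\<^sub>C T x) \<and> b = (\<Sum>x\<in>I. c x *\<^sub>C T (A' x))}"
  define K where "K = (\<Prod>n=1..N. C n)"
  have K: "0 \<le> K" unfolding K_def using C(1) by (rule prod_nonneg)
  have psd: "psd_kernel P (\<lambda>x y. (\<Prod>n=1..N. complex_of_real ((C n)\<^sup>2) * cinner (x n) (y n)) -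
      (\<Prod>n=1..N. cinner (A n (x n)) (A n (y n))))"
  proof (rule psd_kernel_prod_mono)
    fix n assume n: "n \<in> {1..N}"
    have "psd_kernel (H n) (\<lambda>u v. complex_of_real ((C n)\<^sup>2) * cinner u v - cinner (A n u) (A n v))"
    proof (rule psd_kernelI)
      fix I and c :: "'h \<Rightarrow> complex" assume I: "finite I" "I \<subseteq> H n"
      define v where "v = (\<Sum>i\<in>I. c i *\<^sub>C i)"
      have v: "v \<in> H n"
        unfolding v_def using subspaces[OF n] I
        by (intro complex_vector.subspace_sum complex_vector.subspace_scale) auto
      have Av: "A n v = (\<Sum>i\<in>I. c i *\<^sub>C A n i)"
        unfolding v_def using A[OF n] I
        by (intro bounded_op_sum[OF subspaces[OF n]]) (auto simp: positive_op_def)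
      have "(\<Sum>i\<in>I. \<Sum>j\<in>I. cnj (c i) * c j * (complex_of_real ((C n)\<^sup>2) * cinner i j - cinner (A n i) (A n j)))
          = complex_of_real ((C n)\<^sup>2) * cinner v v - cinner (A n v) (A n v)"
        unfolding Av unfolding v_def cinner_sum_sum
        by (simp add: right_diff_distrib sum_subtractf sum_distrib_left mult_ac)
      also have "\<dots> = complex_of_real ((C n * norm v)\<^sup>2 - (norm (A n v))\<^sup>2)"
        by (simp add: cinner_self power_mult_distrib)
      also have "0 \<le> \<dots>"
        using C(2)[OF n v] by (simp add: less_eq_complex_def power_mono)
      finally show "0 \<le> (\<Sum>i\<in>I. \<Sum>j\<in>I. cnj (c i) * c j *
          (complex_of_real ((C n)\<^sup>2) * cinner i j - cinner (A n i) (A n j)))" .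
    qed
    moreover have "(\<lambda>x. x n) ` P \<subseteq> H n"
      by (rule image_subsetI, erule Pi_mem, rule n)
    ultimately show "psd_kernel P (\<lambda>x y. complex_of_real ((C n)\<^sup>2) * cinner (x n) (y n) - cinner (A n (x n)) (A n (y n)))"
      by (rule psd_kernel_vimage)
    show "psd_kernel P (\<lambda>x y. cinner (A n (x n)) (A n (y n)))"
      by (rule psd_kernel_cinner)
  qed simp
  have bound: "norm b \<le> K * norm a" if G: "(a, b) \<in> G" for a b
  proof -
    obtain I c where I: "finite I" "I \<subseteq> P" "a = (\<Sum>x\<in>I. c x *\<^sub>C T x)" "b = (\<Sum>x\<in>I. c x *\<^sub>C T (A' x))"
      using G unfolding G_def mem_Collect_eq prod.case by blast
    \<comment> \<open>The form of this kernel at \<open>c\<close> equals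
      \<open>(K * norm a)\<^sup>2 - (norm b)\<^sup>2\<close>, so its positivity is the desired
      bound.\<close>
    have "0 \<le> (\<Sum>x\<in>I. \<Sum>y\<in>I. cnj (c x) * c y * ((\<Prod>n=1..N. complex_of_real ((C n)\<^sup>2) * cinner (x n) (y n)) -
      (\<Prod>n=1..N. cinner (A n (x n)) (A n (y n)))))"
      using psd I by (intro psd_kernelD)
    also have "\<dots> = (\<Sum>x\<in>I. \<Sum>y\<in>I. cnj (c x) * c y *
        (complex_of_real (K\<^sup>2) * cinner (T x) (T y) - cinner (T (A' x)) (T (A' y))))"
    proof (intro sum.cong refl arg_cong2[where f="(*)"] arg_cong2[where f="(-)"])
      fix x y assume "x \<in> I" "y \<in> I"
      then have xy: "x \<in> P" "y \<in> P" using I by auto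
      show "(\<Prod>n=1..N. complex_of_real ((C n)\<^sup>2) * cinner (x n) (y n)) = complex_of_real (K\<^sup>2) * cinner (T x) (T y)"
        by (simp add: cinner_T[OF xy] prod.distrib K_def prod_power_distrib)
      show "(\<Prod>n=1..N. cinner (A n (x n)) (A n (y n))) = cinner (T (A' x)) (T (A' y))"
        by (subst cinner_T[OF A'P[OF xy(1)] A'P[OF xy(2)]]) (simp add: A'_def)
    qed
    also have "\<dots> = complex_of_real (K\<^sup>2) * cinner a a - cinner b b"
      unfolding I cinner_sum_sum by (simp add: right_diff_distrib sum_subtractf sum_distrib_left mult_ac)
    also have "\<dots> = complex_of_real ((K * norm a)\<^sup>2 - (norm b)\<^sup>2)"
      by (simp add: cinner_self power_mult_distrib)
    finally have "(norm b)\<^sup>2 \<le> (K * norm a)\<^sup>2"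
      by (simp add: less_eq_complex_def)
    then show ?thesis by (rule power2_le_imp_le) (simp add: K)
  qed
  have add: "(a + a', b + b') \<in> G" if G: "(a, b) \<in> G" "(a', b') \<in> G" for a b a' b'
  proof -
    obtain I c where I: "finite I" "I \<subseteq> P" "a = (\<Sum>x\<in>I. c x *\<^sub>C T x)" "b = (\<Sum>x\<in>I. c x *\<^sub>C T (A' x))"
      using G unfolding G_def mem_Collect_eq prod.case by blast
    obtain J d where J: "finite J" "J \<subseteq> P" "a' = (\<Sum>x\<in>J. d x *\<^sub>C T x)" "b' = (\<Sum>x\<in>J. d x *\<^sub>C T (A' x))"
      using G unfolding G_def mem_Collect_eq prod.case by blast
    define f where "f x = (if x \<in> I then c x else 0) + (if x \<in> J then d x else 0)" for x
    have "(\<Sum>x\<in>I \<union> J. f x *\<^sub>C X x) = (\<Sum>x\<in>I. c x *\<^sub>C X x) + (\<Sum>x\<in>J. d x *\<^sub>C X x)" for X :: "_ \<Rightarrow> 'k"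
    proof -
      have "(\<Sum>x\<in>I \<union> J. f x *\<^sub>C X x) =
          (\<Sum>x\<in>I \<union> J. (if x \<in> I then c x *\<^sub>C X x else 0)) + (\<Sum>x\<in>I \<union> J. (if x \<in> J then d x *\<^sub>C X x else 0))"
        unfolding sum.distrib[symmetric]
        by (intro sum.cong refl) (simp add: f_def scaleC_add_left scaleC.zero_left)
      then show ?thesis
        using I(1) J(1) by (simp add: sum.If_cases Int_absorb1 Int_absorb2)
    qed
    then show ?thesis
      unfolding G_def mem_Collect_eq prod.case using I J
      by (intro exI[of _ "I \<union> J"] exI[of _ f]) simp
  qed
  have scale: "(c *\<^sub>C a, c *\<^sub>C b) \<in> G" if G: "(a, b) \<in> G" for a b c
  proof -
    obtain I d where I: "finite I" "I \<subseteq> P" "a = (\<Sum>x\<in>I. d x *\<^sub>C T x)" "b = (\<Sum>x\<in>I. d x *\<^sub>C T (A' x))"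
      using G unfolding G_def mem_Collect_eq prod.case by blast
    then show ?thesis
      unfolding G_def mem_Collect_eq prod.case
      by (intro exI[of _ I] exI[of _ "\<lambda>x. c * d x"]) (simp add: scaleC.sum_right scaleC_scaleC)
  qed
  have "cspan (T ` P) \<subseteq> fst ` G"
  proof
    fix v assume "v \<in> cspan (T ` P)"
    then obtain I c where "finite I" "I \<subseteq> P" "v = (\<Sum>x\<in>I. c x *\<^sub>C T x)"
      by (rule cspan_image_explicit)
    then have "(v, \<Sum>x\<in>I. c x *\<^sub>C T (A' x)) \<in> G"
      unfolding G_def mem_Collect_eq prod.case by blast
    then show "v \<in> fst ` G" by (rule image_eqI[rotated]) simp
  qed
  then have "closure (fst ` G) = UNIV"
    using dense closure_mono by blast
  from bounded_op_extension[OF add scale bound this]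
  obtain F where F: "bounded_op UNIV F" "\<And>a b. (a, b) \<in> G \<Longrightarrow> F a = b"
    by blast
  have "(T x, T (A' x)) \<in> G" if "x \<in> P" for x
    unfolding G_def mem_Collect_eq prod.case using that
    by (intro exI[of _ "{x}"] exI[of _ "\<lambda>_. 1"]) simp
  with F show ?thesis unfolding A'_def by blast
qed

lemma tensor_op_unique:
  assumes "bounded_op UNIV F" "\<And>x. x \<in> P \<Longrightarrow> F (T x) = T (\<lambda>n. A n (x n))"
  shows "tensor_op N H T A = F"
  unfolding tensor_op_def
proof (rule the_equality)
  fix F' assume "bounded_op UNIV F' \<and> (\<forall>x\<in>P. F' (T x) = T (\<lambda>n. A n (x n)))"
  then show "F' = F"
    using assms by (intro bounded_op_eqI[OF _ _ dense]) auto
qed (use assms in auto)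

lemma bounded_tensor_op: "bounded_op UNIV (tensor_op N H T A)"
  and tensor_op_T: "x \<in> P \<Longrightarrow> tensor_op N H T A (T x) = T (\<lambda>n. A n (x n))"
  using tensor_op_exists tensor_op_unique by blast+

lemma cinner_tensor_op:
  assumes "I \<subseteq> P" "J \<subseteq> P"
  shows "cinner (\<Sum>x\<in>I. c x *\<^sub>C T x) (tensor_op N H T A (\<Sum>x\<in>J. d x *\<^sub>C T x)) =
    (\<Sum>x\<in>I. \<Sum>y\<in>J. cnj (c x) * d y * (\<Prod>n=1..N. cinner (x n) (A n (y n))))"
proof -
  have "tensor_op N H T A (\<Sum>x\<in>J. d x *\<^sub>C T x) = (\<Sum>x\<in>J. d x *\<^sub>C T (\<lambda>n. A n (x n)))"
    using assms
    by (subst bounded_op_sum[OF csubspace_UNIV bounded_tensor_op]) (auto simp: tensor_op_T intro!: sum.cong)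
  moreover have "cinner (T x) (T (\<lambda>n. A n (y n))) = (\<Prod>n=1..N. cinner (x n) (A n (y n)))"
    if "x \<in> I" "y \<in> J" for x y
    using that assms by (intro cinner_T tensor_map_in) blast+
  ultimately show ?thesis
    by (simp only: cinner_sum_sum cong: sum.cong)
qed

text \<open>On combinations of product vectors the quadratic form is that of a Schur product of the
  one-site kernels \<open>cinner (x n) (A n (y n))\<close>. Closedness of the nonnegative reals
  carries positivity to the limits of such combinations.\<close>

lemma positive_tensor_op: "positive_op UNIV (tensor_op N H T A)"
  unfolding positive_op_def
proof (intro conjI ballI bounded_tensor_op)
  let ?F = "tensor_op N H T A"
  have span: "cinner v (?F v) \<in> \<real>\<^sub>\<ge>\<^sub>0" if "v \<in> cspan (T ` P)" for v
  proof -
    obtain I c where I: "finite I" "I \<subseteq> P" "v = (\<Sum>x\<in>I. c x *\<^sub>C T x)"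
      using \<open>v \<in> cspan (T ` P)\<close> by (rule cspan_image_explicit)
    have "psd_kernel P (\<lambda>x y. \<Prod>n=1..N. cinner (x n) (A n (y n)))"
    proof (rule psd_kernel_prod)
      fix n assume n: "n \<in> {1..N}"
      show "psd_kernel P (\<lambda>x y. cinner (x n) (A n (y n)))"
        by (rule psd_kernel_vimage[OF positive_op_psd_kernel[OF subspaces[OF n] A[OF n]]])
          (rule image_subsetI, erule Pi_mem, rule n)
    qed
    from psd_kernelD[OF this I(1,2), of c] show ?thesis
      unfolding I(3) nonneg_Reals_iff using I(2) by (simp only: cinner_tensor_op)
  qed
  fix v
  have "v \<in> closure (cspan (T ` P))" using dense by simp
  then obtain s where s: "\<And>n. s n \<in> cspan (T ` P)" "s \<longlonglongrightarrow> v"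
    unfolding closure_sequential by blast
  have "(\<lambda>n. cinner (s n) (?F (s n))) \<longlonglongrightarrow> cinner v (?F v)"
    using s(2) by (intro cinner.tendsto bounded_linear.tendsto[OF bounded_op_UNIV_bounded_linear[OF bounded_tensor_op]])
  then show "cinner v (?F v) \<in> \<real>\<^sub>\<ge>\<^sub>0"
    by (rule closed_sequentially[OF closed_nonneg_Reals_complex, rotated]) (rule span[OF s(1)])
qed

lemma tensor_op_eq_id:
  assumes "\<And>n x. n \<in> {1..N} \<Longrightarrow> x \<in> H n \<Longrightarrow> A n x = x"
  shows "tensor_op N H T A = (\<lambda>v. v)"
proof (rule tensor_op_unique)
  show "bounded_op UNIV (\<lambda>v :: 'k. v)"
    unfolding bounded_op_def by (auto intro: exI[of _ 1])
  show "T x = T (\<lambda>n. A n (x n))" if "x \<in> P" for x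
    by (rule T_cong[OF that], rule assms[symmetric], assumption, rule Pi_mem[OF that])
qed

end

text \<open>Operators agreeing only on the subspaces \<open>H n\<close> may differ as functions.
  This is what later identifies the tensor operators of different settings when a site registers its
  whole outcome space.\<close>

lemma tensor_op_cong:
  assumes "\<And>n. n \<in> {1..N} \<Longrightarrow> positive_op (H n) (A n)"
    and "\<And>n. n \<in> {1..N} \<Longrightarrow> positive_op (H n) (A' n)"
    and "\<And>n x. n \<in> {1..N} \<Longrightarrow> x \<in> H n \<Longrightarrow> A n x = A' n x"
  shows "tensor_op N H T A = tensor_op N H T A'"
proof (rule tensor_op_unique[OF assms(1) bounded_tensor_op[OF assms(2)]])
  fix x assume x: "x \<in> P"
  have "T (\<lambda>n. A' n (x n)) = T (\<lambda>n. A n (x n))"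
    by (rule T_cong[OF tensor_map_in[OF assms(2) x]], assumption,
        rule assms(3)[symmetric], assumption, rule Pi_mem[OF x])
  then show "tensor_op N H T A' (T x) = T (\<lambda>n. A n (x n))"
    by (simp only: tensor_op_T[OF assms(2) x])
qed

end

subsection \<open>Densities of POV measures\<close>

lemma dominating_finite_measure:
  fixes \<N> :: "nat \<Rightarrow> 'l measure"
  assumes fin: "\<And>k. finite_measure (\<N> k)" and sets: "\<And>k. sets (\<N> k) = sets L"
  obtains \<mu> where "finite_measure \<mu>" "sets \<mu> = sets L" "\<And>k. absolutely_continuous \<mu> (\<N> k)"
proof -
  \<comment> \<open>The weights keep the total mass below the sum of \<open>(1/2) ^ Suc k\<close>,
    which is \<open>1\<close>; the \<open>1 +\<close> admits zero measures. Since all weights are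
    positive, a null set of the weighted sum is null for every \<open>\<N> k\<close>.\<close>
  define c where "c k = (1/2) ^ Suc k / (1 + measure (\<N> k) (space L))" for k
  have c: "0 < c k" for k
    by (simp add: c_def add_pos_nonneg)
  define m where "m D = (\<Sum>k. ennreal (c k) * emeasure (\<N> k) D)" for D
  define \<mu> where "\<mu> = measure_of (space L) (sets L) m"
  have sets_\<mu>: "sets \<mu> = sets L"
    by (simp add: \<mu>_def)
  have em: "emeasure \<mu> D = m D" if "D \<in> sets L" for D
    unfolding \<mu>_def
  proof (rule emeasure_measure_of_sigma[OF _ _ _ that])
    show "sigma_algebra (space L) (sets L)" ..
    show "positive (sets L) m" by (simp add: positive_def m_def)
    show "countably_additive (sets L) m"
      unfolding countably_additive_def
    proof (intro allI impI)
      fix A :: "nat \<Rightarrow> 'l set" assume A: "range A \<subseteq> sets L" "disjoint_family A"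
      have "(\<Sum>i. m (A i)) = (\<Sum>i. \<integral>\<^sup>+k. ennreal (c k) * emeasure (\<N> k) (A i) \<partial>count_space UNIV)"
        by (simp add: m_def nn_integral_count_space_nat)
      also have "\<dots> = (\<integral>\<^sup>+k. (\<Sum>i. ennreal (c k) * emeasure (\<N> k) (A i)) \<partial>count_space UNIV)"
        by (rule nn_integral_suminf[symmetric]) simp
      also have "\<dots> = (\<Sum>k. \<Sum>i. ennreal (c k) * emeasure (\<N> k) (A i))"
        by (rule nn_integral_count_space_nat)
      also have "\<dots> = m (\<Union>i. A i)"
        unfolding m_def using A sets by (intro suminf_cong) (simp add: suminf_emeasure)
      finally show "(\<Sum>i. m (A i)) = m (\<Union>i. A i)" .
    qed
  qed
  show thesis
  proof
    have "emeasure \<mu> (space \<mu>) = (\<Sum>k. ennreal (c k * measure (\<N> k) (space L)))"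
      using sets sets_eq_imp_space_eq[OF sets_\<mu>]
      by (simp add: em m_def finite_measure.emeasure_eq_measure[OF fin] ennreal_mult'' )
    also have "\<dots> \<le> (\<Sum>k. ennreal ((1/2) ^ Suc k))"
    proof (intro suminf_le ennreal_leI)
      fix k
      have "measure (\<N> k) (space L) / (1 + measure (\<N> k) (space L)) \<le> 1"
        by (simp add: divide_le_eq add_pos_nonneg)
      then have "(1/2) ^ Suc k * (measure (\<N> k) (space L) / (1 + measure (\<N> k) (space L))) \<le> (1/2) ^ Suc k * 1"
        by (intro mult_left_mono) auto
      then show "c k * measure (\<N> k) (space L) \<le> (1/2) ^ Suc k"
        by (simp add: c_def)
    qed auto
    also have "\<dots> = ennreal 1"
      by (rule suminf_ennreal_eq[OF _ power_half_series]) simp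
    finally show "finite_measure \<mu>"
      by (intro finite_measureI) (auto simp: top_unique)
    show "absolutely_continuous \<mu> (\<N> k)" for k
      unfolding absolutely_continuous_def
    proof
      fix D assume D: "D \<in> null_sets \<mu>"
      then have DL: "D \<in> sets L" and "emeasure \<mu> D = 0" using sets_\<mu> by (auto simp: null_sets_def)
      then have "m D = 0" using em[OF DL] by simp
      then have "ennreal (c k) * emeasure (\<N> k) D = 0"
        unfolding m_def by (subst (asm) suminf_eq_zero_iff) auto
      then show "D \<in> null_sets (\<N> k)"
        using D c[of k] sets sets_\<mu> by (auto simp: null_sets_def)
    qed
  qed (rule sets_\<mu>)
qed

lemma AE_nonneg_of_set_integral_nonneg:
  fixes r :: "'a \<Rightarrow> real"
  assumes r: "integrable M r" and nonneg: "\<And>S. S \<in> sets M \<Longrightarrow> 0 \<le> (\<integral>x. indicator S x * r x \<partial>M)"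
  shows "AE x in M. 0 \<le> r x"
proof -
  note [measurable] = borel_measurable_integrable[OF r]
  define S where "S = {x\<in>space M. r x < 0}"
  have S[measurable]: "S \<in> sets M" unfolding S_def by measurable
  have int: "integrable M (\<lambda>x. - (indicator S x * r x))"
    using integrable_real_mult_indicator[OF S r] by (simp add: mult.commute)
  have nn: "AE x in M. 0 \<le> - (indicator S x * r x)"
    by (auto simp: S_def indicator_def)
  have "(\<integral>x. - (indicator S x * r x) \<partial>M) = 0"
    using nonneg[OF S] integral_nonneg_AE[OF nn] by simp
  then have "AE x in M. - (indicator S x * r x) = 0"
    using integral_nonneg_eq_0_iff_AE[OF int nn] by simp
  moreover have "AE x in M. x \<in> space M" by simp
  ultimately show ?thesis
    by eventually_elim (auto simp: S_def indicator_def split: if_splits)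
qed

lemma AE_complex_nonneg_of_set_integral_nonneg:
  fixes h :: "'a \<Rightarrow> complex"
  assumes h: "integrable M h"
    and nonneg: "\<And>S. S \<in> sets M \<Longrightarrow> 0 \<le> (\<integral>x. indicator S x *\<^sub>R h x \<partial>M)"
  shows "AE x in M. 0 \<le> h x"
proof -
  have int: "integrable M (\<lambda>x. indicator S x *\<^sub>R h x)" if "S \<in> sets M" for S
    using that h by (rule integrable_mult_indicator)
  have Re: "Re (\<integral>x. indicator S x *\<^sub>R h x \<partial>M) = (\<integral>x. indicator S x * Re (h x) \<partial>M)"
    and Im: "Im (\<integral>x. indicator S x *\<^sub>R h x \<partial>M) = (\<integral>x. indicator S x * Im (h x) \<partial>M)"
    if "S \<in> sets M" for S
    using integral_Re[OF int[OF that]] integral_Im[OF int[OF that]] by simp_all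
  have "AE x in M. 0 \<le> Re (h x)" "AE x in M. 0 \<le> Im (h x)" "AE x in M. 0 \<le> - Im (h x)"
    by (rule AE_nonneg_of_set_integral_nonneg;
        use h nonneg in \<open>auto simp: Re[symmetric] Im[symmetric] less_eq_complex_def\<close>)+
  then show ?thesis
    by eventually_elim (simp add: less_eq_complex_def)
qed

section \<open>Scalar measures of a POV measure and their densities\<close>

locale pov_hilbert =
  fixes H :: "'h::complex_hilbert_space set" and L :: "'l measure" and M :: "'l set \<Rightarrow> 'h \<Rightarrow> 'h"
  assumes H: "separable_hilbert_subspace H" and M: "pov_measure H L M"
begin

lemma csubspace: "csubspace H"
  using H by (simp add: separable_hilbert_subspace_def)

lemma positive: "D \<in> sets L \<Longrightarrow> positive_op H (M D)"
  using M by (simp add: pov_measure_def)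

lemma cinner_sums:
  fixes D :: "nat \<Rightarrow> 'l set"
  assumes "range D \<subseteq> sets L" "disjoint_family D" "v \<in> H"
  shows "(\<lambda>i. cinner u (M (D i) v)) sums cinner u (M (\<Union>i. D i) v)"
  using assms M by (intro bounded_linear.sums[OF cinner.bounded_linear_right]) (auto simp: pov_measure_def)

text \<open>Additivity along the constant sequence of empty sets makes a constant series converge,
  so its term is zero.\<close>

lemma empty: "v \<in> H \<Longrightarrow> M {} v = 0"
proof -
  assume v: "v \<in> H"
  have "(\<lambda>i::nat. M {} v) sums M (\<Union>i::nat. {}) v"
    using M v unfolding pov_measure_def
    by (auto dest: spec[of _ "\<lambda>i::nat. {}"] simp: disjoint_family_on_def)
  then show ?thesis by (auto dest: sums_summable simp: summable_const_iff)
qed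

definition vector_measure :: "'h \<Rightarrow> 'l measure" where
  "vector_measure v = measure_of (space L) (sets L) (\<lambda>D. ennreal (Re (cinner v (M D v))))"

lemma sets_vector_measure: "sets (vector_measure v) = sets L"
  by (simp add: vector_measure_def)

lemma Re_nonneg: "D \<in> sets L \<Longrightarrow> v \<in> H \<Longrightarrow> 0 \<le> Re (cinner v (M D v))"
  using positive by (auto simp: positive_op_def complex_nonneg_Reals_iff)

lemma emeasure_vector_measure:
  assumes "D \<in> sets L" "v \<in> H"
  shows "emeasure (vector_measure v) D = ennreal (Re (cinner v (M D v)))"
  unfolding vector_measure_def
proof (rule emeasure_measure_of_sigma[OF _ _ _ assms(1)])
  show "sigma_algebra (space L) (sets L)" ..
  show "positive (sets L) (\<lambda>D. ennreal (Re (cinner v (M D v))))"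
    using empty[OF assms(2)] by (simp add: positive_def cinner.zero_right)
  show "countably_additive (sets L) (\<lambda>D. ennreal (Re (cinner v (M D v))))"
    unfolding countably_additive_def
  proof (intro allI impI)
    fix A :: "nat \<Rightarrow> 'l set" assume A: "range A \<subseteq> sets L" "disjoint_family A"
    then have "(\<lambda>i. Re (cinner v (M (A i) v))) sums Re (cinner v (M (\<Union>i. A i) v))"
      by (intro sums_Re cinner_sums assms)
    then show "(\<Sum>i. ennreal (Re (cinner v (M (A i) v)))) = ennreal (Re (cinner v (M (\<Union>i. A i) v)))"
      using A assms(2) by (intro suminf_ennreal_eq Re_nonneg) auto
  qed
qed

lemma finite_vector_measure: "v \<in> H \<Longrightarrow> finite_measure (vector_measure v)"
  using sets_eq_imp_space_eq[OF sets_vector_measure, of v]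
  by (intro finite_measureI) (simp add: emeasure_vector_measure)

text \<open>Here separability enters. A measure dominating the vector measures of a countable dense
  set dominates all of them: on a null set \<open>D\<close> the continuous function
  \<open>Re (cinner v (M D v))\<close> vanishes at a dense set of \<open>v\<close>.\<close>

lemma vector_measure_dominated:
  obtains \<mu> where "finite_measure \<mu>" "sets \<mu> = sets L"
    "\<And>v. v \<in> H \<Longrightarrow> absolutely_continuous \<mu> (vector_measure v)"
proof -
  obtain C where C: "countable C" "C \<subseteq> H" "top_of_set H closure_of C = H"
    using H unfolding separable_hilbert_subspace_def separable_space_def by auto
  have closure_C: "H \<subseteq> closure C"
    using C(3) by (auto simp: closure_of_subtopology Int_absorb1[OF C(2)])
  have "C \<noteq> {}"
    using closure_C csubspace by (auto simp: csubspace_iff)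
  define d where "d = from_nat_into C"
  have d: "range d = C" using C(1) \<open>C \<noteq> {}\<close> by (simp add: d_def)
  then have dH: "d k \<in> H" for k using C(2) by auto
  obtain \<mu> where \<mu>: "finite_measure \<mu>" "sets \<mu> = sets L"
    "\<And>k. absolutely_continuous \<mu> (vector_measure (d k))"
    using dominating_finite_measure[of "\<lambda>k. vector_measure (d k)" L]
      finite_vector_measure[OF dH] sets_vector_measure by blast
  have "absolutely_continuous \<mu> (vector_measure v)" if v: "v \<in> H" for v
    unfolding absolutely_continuous_def
  proof
    fix D assume D: "D \<in> null_sets \<mu>"
    then have DL: "D \<in> sets L" using \<mu>(2) by auto
    have 0: "Re (cinner u (M D u)) = 0" if u: "u \<in> C" for u
    proof -
      obtain k where k: "u = d k" using d u by blast
      then have "emeasure (vector_measure u) D = 0"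
        using \<mu>(3)[of k] D unfolding absolutely_continuous_def by auto
      then show ?thesis
        using emeasure_vector_measure[OF DL dH[of k]] Re_nonneg[OF DL dH[of k]] k by simp
    qed
    have "v \<in> closure C" using v closure_C by blast
    then obtain s where s: "\<And>n. s n \<in> C" "s \<longlonglongrightarrow> v"
      unfolding closure_sequential by blast
    obtain B where B: "\<And>x. x \<in> H \<Longrightarrow> norm (M D x) \<le> B * norm x"
      using bounded_opE[of H "M D"] positive[OF DL] unfolding positive_op_def by metis
    have "(\<lambda>n. M D (s n)) \<longlonglongrightarrow> M D v"
    proof (rule LIM_zero_cancel, rule Lim_null_comparison)
      show "\<forall>\<^sub>F n in sequentially. norm (M D (s n) - M D v) \<le> B * norm (s n - v)"
      proof (rule always_eventually, rule allI)
        fix n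
        have sn: "s n \<in> H" using s(1) C(2) by auto
        have "M D (s n + (-1) *\<^sub>C v) = M D (s n) + (-1) *\<^sub>C M D v"
          using positive[OF DL] sn v csubspace unfolding positive_op_def bounded_op_def csubspace_iff by metis
        moreover have "s n + (-1) *\<^sub>C v \<in> H"
          using sn v csubspace unfolding csubspace_iff by blast
        ultimately show "norm (M D (s n) - M D v) \<le> B * norm (s n - v)"
          using B[of "s n - v"] by (simp add: scaleC_minus1)
      qed
      have "(\<lambda>n. B * norm (s n - v)) \<longlonglongrightarrow> B * norm (v - v)"
        using s(2) by (intro tendsto_intros)
      then show "(\<lambda>n. B * norm (s n - v)) \<longlonglongrightarrow> 0" by simp
    qed
    then have "(\<lambda>n. Re (cinner (s n) (M D (s n)))) \<longlonglongrightarrow> Re (cinner v (M D v))"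
      by (intro tendsto_Re cinner.tendsto s)
    then have "Re (cinner v (M D v)) = 0"
      using 0[OF s(1)] by (simp add: LIMSEQ_const_iff)
    then show "D \<in> null_sets (vector_measure v)"
      using DL v by (auto simp: sets_vector_measure emeasure_vector_measure)
  qed
  with \<mu> that show thesis by blast
qed

definition quadratic_density :: "'l measure \<Rightarrow> 'h \<Rightarrow> 'l \<Rightarrow> real" where
  "quadratic_density \<mu> v x = enn2real (RN_deriv \<mu> (vector_measure v) x)"

text \<open>The polarised Radon-Nikodym densities; the factor \<open>cnj c\<close> matches an inner
  product linear in its second argument. Sesquilinearity and positivity are to be expected only off
  null sets depending on the vectors.\<close>

definition density_kernel :: "'l measure \<Rightarrow> 'h \<Rightarrow> 'h \<Rightarrow> 'l \<Rightarrow> complex" where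
  "density_kernel \<mu> u v x =
    (\<Sum>c\<in>{1, -1, \<i>, -\<i>}. cnj c * complex_of_real (quadratic_density \<mu> (u + c *\<^sub>C v) x)) / 4"

context
  fixes \<mu> :: "'l measure"
  assumes fin: "finite_measure \<mu>" and sets_\<mu>: "sets \<mu> = sets L"
    and ac: "\<And>v. v \<in> H \<Longrightarrow> absolutely_continuous \<mu> (vector_measure v)"
begin

interpretation finite_measure \<mu> by (rule fin)

lemma
  assumes v: "v \<in> H"
  shows integrable_quadratic_density: "integrable \<mu> (quadratic_density \<mu> v)"
    and integral_quadratic_density:
      "S \<in> sets L \<Longrightarrow> (\<integral>x. indicator S x * quadratic_density \<mu> v x \<partial>\<mu>) = Re (cinner v (M S v))"
proof -
  interpret V: finite_measure "vector_measure v"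
    by (rule finite_vector_measure[OF v])
  have sets: "sets (vector_measure v) = sets \<mu>"
    by (simp add: sets_vector_measure sets_\<mu>)
  note RN = RN_deriv_integrable[OF V.sigma_finite_measure_axioms ac[OF v] sets]
    RN_deriv_integral[OF V.sigma_finite_measure_axioms ac[OF v] sets]
  have "integrable (vector_measure v) (\<lambda>x. 1 :: real)" by simp
  then show "integrable \<mu> (quadratic_density \<mu> v)"
    unfolding quadratic_density_def by (subst (asm) RN(1)) simp_all
  assume S: "S \<in> sets L"
  then have S': "S \<in> sets (vector_measure v)" by (simp add: sets_vector_measure)
  have "(\<integral>x. indicator S x * quadratic_density \<mu> v x \<partial>\<mu>) = (\<integral>x. indicator S x \<partial>vector_measure v)"
    unfolding quadratic_density_def using S sets_\<mu>
    by (subst RN(2)) (auto simp: mult.commute)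
  also have "\<dots> = measure (vector_measure v) S"
    using S' by simp
  also have "\<dots> = Re (cinner v (M S v))"
    using emeasure_vector_measure[OF S v] Re_nonneg[OF S v] by (simp add: measure_def)
  finally show "(\<integral>x. indicator S x * quadratic_density \<mu> v x \<partial>\<mu>) = Re (cinner v (M S v))" .
qed

lemma polarization:
  assumes A: "positive_op H A" and uv: "u \<in> H" "v \<in> H"
  shows "cinner u (A v) =
    (\<Sum>c\<in>{1, -1, \<i>, -\<i>}. cnj c * complex_of_real (Re (cinner (u + c *\<^sub>C v) (A (u + c *\<^sub>C v))))) / 4"
proof -
  have q: "complex_of_real (Re (cinner (u + c *\<^sub>C v) (A (u + c *\<^sub>C v)))) =
      cinner u (A u) + c * cinner u (A v) + cnj c * cinner v (A u) + cnj c * c * cinner v (A v)" for c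
  proof -
    have cv: "c *\<^sub>C v \<in> H" "u + c *\<^sub>C v \<in> H"
      using uv csubspace unfolding csubspace_iff by blast+
    then have "complex_of_real (Re (cinner (u + c *\<^sub>C v) (A (u + c *\<^sub>C v)))) =
        cinner (u + c *\<^sub>C v) (A (u + c *\<^sub>C v))"
      using A by (auto simp: positive_op_def complex_nonneg_Reals_iff complex_eq_iff)
    moreover have "A (u + c *\<^sub>C v) = A u + c *\<^sub>C A v"
      using A uv cv unfolding positive_op_def bounded_op_def by metis
    ultimately show ?thesis
      by (simp add: cinner.add_left cinner.add_right cinner_scaleC_left cinner_scaleC_right algebra_simps)
  qed
  \<comment> \<open>Weighting by \<open>cnj c\<close> and summing over the four roots of unity keeps
    only the coefficient of \<open>c\<close>.\<close>
  show ?thesis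
    by (subst q) (simp add: algebra_simps complex_eq_iff)
qed

lemma
  assumes uv: "u \<in> H" "v \<in> H"
  shows integrable_density_kernel: "integrable \<mu> (density_kernel \<mu> u v)"
    and integral_density_kernel:
      "S \<in> sets L \<Longrightarrow> (\<integral>x. indicator S x *\<^sub>R density_kernel \<mu> u v x \<partial>\<mu>) = cinner u (M S v)"
proof -
  have H: "u + c *\<^sub>C v \<in> H" for c
    using uv csubspace unfolding csubspace_iff by blast
  show "integrable \<mu> (density_kernel \<mu> u v)"
    unfolding density_kernel_def
    by (intro integrable_divide_zero Bochner_Integration.integrable_sum integrable_mult_right integrable_of_real
        integrable_quadratic_density H)
  assume S: "S \<in> sets L"
  have int: "integrable \<mu> (\<lambda>x. indicator S x * quadratic_density \<mu> (u + c *\<^sub>C v) x)" for c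
    using integrable_real_mult_indicator[OF _ integrable_quadratic_density[OF H], of S c] S
    by (simp add: sets_\<mu> mult.commute)
  have "(\<integral>x. indicator S x *\<^sub>R density_kernel \<mu> u v x \<partial>\<mu>) =
      (\<integral>x. (\<Sum>c\<in>{1, -1, \<i>, -\<i>}. cnj c *
        complex_of_real (indicator S x * quadratic_density \<mu> (u + c *\<^sub>C v) x)) / 4 \<partial>\<mu>)"
    by (intro Bochner_Integration.integral_cong refl)
      (simp add: density_kernel_def scaleR_conv_of_real sum_distrib_left mult_ac)
  also have "\<dots> = (\<Sum>c\<in>{1, -1, \<i>, -\<i>}. cnj c *
        complex_of_real (\<integral>x. indicator S x * quadratic_density \<mu> (u + c *\<^sub>C v) x \<partial>\<mu>)) / 4"
    by (subst integral_divide_zero, subst Bochner_Integration.integral_sum)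
      (intro integrable_mult_right integrable_of_real int,
        simp only: integral_mult_right_zero integral_complex_of_real)
  also have "\<dots> = cinner u (M S v)"
    by (simp only: integral_quadratic_density[OF H S] polarization[OF positive[OF S] uv, symmetric])
  finally show "(\<integral>x. indicator S x *\<^sub>R density_kernel \<mu> u v x \<partial>\<mu>) = cinner u (M S v)" .
qed

text \<open>For one finite set and one choice of coefficients, integrating over arbitrary
  \<open>S\<close> gives the form of the positive operator \<open>M S\<close>, hence nonnegativity
  almost everywhere. A single null set suffices for countably many such choices; the other
  coefficients are limits from the countable dense set \<open>C\<close>.\<close>

lemma AE_psd_density_kernel:
  assumes Y: "countable Y" "Y \<subseteq> H"
  shows "AE x in \<mu>. psd_kernel Y (\<lambda>u v. density_kernel \<mu> u v x)"
proof -
  obtain C :: "complex set" where C: "countable C" "\<And>X. open X \<Longrightarrow> X \<noteq> {} \<Longrightarrow> \<exists>d\<in>C. d \<in> X"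
    using countable_dense_setE by blast
  have closure_C: "closure C = UNIV"
  proof (rule ccontr)
    assume "closure C \<noteq> UNIV"
    then obtain d where "d \<in> C" "d \<in> - closure C"
      using C(2)[of "- closure C"] by (auto simp: open_Compl)
    then show False using closure_subset by blast
  qed
  let ?h = "\<lambda>I c x. \<Sum>u\<in>I. \<Sum>v\<in>I. cnj (c u) * c v * density_kernel \<mu> u v x"
  have "AE x in \<mu>. \<forall>I\<in>{I. finite I \<and> I \<subseteq> Y}. \<forall>c\<in>PiE I (\<lambda>_. C). 0 \<le> ?h I c x"
  proof (intro AE_ball_countable')
    show "countable {I. finite I \<and> I \<subseteq> Y}"
      using countable_Collect_finite_subset[OF Y(1)] by (simp add: conj_commute)
    fix I assume "I \<in> {I. finite I \<and> I \<subseteq> Y}"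
    then have I: "finite I" "I \<subseteq> H" using Y(2) by auto
    show "countable (PiE I (\<lambda>_. C))"
      using I C(1) by (intro countable_PiE)
    fix c :: "'h \<Rightarrow> complex"
    have int: "integrable \<mu> (\<lambda>x. cnj (c u) * c v * density_kernel \<mu> u v x)" if "u \<in> I" "v \<in> I" for u v
      using that I by (intro integrable_mult_right integrable_density_kernel) auto
    show "AE x in \<mu>. 0 \<le> ?h I c x"
    proof (rule AE_complex_nonneg_of_set_integral_nonneg)
      show "integrable \<mu> (?h I c)"
        by (intro Bochner_Integration.integrable_sum int)
      fix S assume "S \<in> sets \<mu>"
      then have S: "S \<in> sets L" by (simp add: sets_\<mu>)
      have ind: "integrable \<mu> (\<lambda>x. indicator S x *\<^sub>R density_kernel \<mu> u v x)" if "u \<in> I" "v \<in> I" for u v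
        using that I \<open>S \<in> sets \<mu>\<close> by (intro integrable_mult_indicator integrable_density_kernel) auto
      have "(\<integral>x. indicator S x *\<^sub>R ?h I c x \<partial>\<mu>) =
          (\<integral>x. (\<Sum>u\<in>I. \<Sum>v\<in>I. cnj (c u) * c v * (indicator S x *\<^sub>R density_kernel \<mu> u v x)) \<partial>\<mu>)"
        by (intro Bochner_Integration.integral_cong refl) (simp add: scaleR_sum_right)
      also have "\<dots> = (\<Sum>u\<in>I. \<Sum>v\<in>I. cnj (c u) * c v * (\<integral>x. indicator S x *\<^sub>R density_kernel \<mu> u v x \<partial>\<mu>))"
        by (subst Bochner_Integration.integral_sum,
            intro Bochner_Integration.integrable_sum integrable_mult_right ind, assumption+,
            intro sum.cong refl, subst Bochner_Integration.integral_sum,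
            intro integrable_mult_right ind, assumption+, simp only: integral_mult_right_zero)
      also have "\<dots> = (\<Sum>u\<in>I. \<Sum>v\<in>I. cnj (c u) * c v * cinner u (M S v))"
        using I S by (intro sum.cong refl arg_cong2[where f="(*)"] integral_density_kernel) auto
      also have "0 \<le> \<dots>"
        by (rule psd_kernelD[OF positive_op_psd_kernel[OF csubspace positive[OF S]] I])
      finally show "0 \<le> (\<integral>x. indicator S x *\<^sub>R ?h I c x \<partial>\<mu>)" .
    qed
  qed
  then show ?thesis
  proof eventually_elim
    case (elim x)
    show ?case
    proof (rule psd_kernelI)
      fix I and c :: "'h \<Rightarrow> complex" assume I: "finite I" "I \<subseteq> Y"
      have "\<exists>s. (\<forall>n. s n \<in> C) \<and> s \<longlonglongrightarrow> c u" for u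
        using closure_C unfolding closure_sequential[symmetric] by simp
      then obtain s where s: "\<And>u n. s u n \<in> C" "\<And>u. s u \<longlonglongrightarrow> c u" by metis
      have "?h I (\<lambda>u. s u n) x \<in> \<real>\<^sub>\<ge>\<^sub>0" for n
      proof -
        have "I \<in> {I. finite I \<and> I \<subseteq> Y}" "restrict (\<lambda>u. s u n) I \<in> PiE I (\<lambda>_. C)"
          using I s(1) by auto
        then have "0 \<le> ?h I (restrict (\<lambda>u. s u n) I) x"
          by (rule bspec[OF bspec[OF elim]])
        also have "?h I (restrict (\<lambda>u. s u n) I) x = ?h I (\<lambda>u. s u n) x"
          by (intro sum.cong refl) simp
        finally show ?thesis by (simp only: nonneg_Reals_iff)
      qed
      moreover have "(\<lambda>n. ?h I (\<lambda>u. s u n) x) \<longlonglongrightarrow> ?h I c x"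
        by (intro tendsto_sum tendsto_mult tendsto_cnj tendsto_const s)
      ultimately have "?h I c x \<in> \<real>\<^sub>\<ge>\<^sub>0"
        by (rule closed_sequentially[OF closed_nonneg_Reals_complex])
      then show "0 \<le> ?h I c x" by (simp only: nonneg_Reals_iff)
    qed
  qed
qed

end

end

text \<open>Positivity is demanded at every point and not almost everywhere, so that products of the
  kernels over the sites are positive at every point without tracking null sets of the product
  measure.\<close>

definition pov_density ::
  "'h::complex_hilbert_space set \<Rightarrow> 'l measure \<Rightarrow> ('l set \<Rightarrow> 'h \<Rightarrow> 'h) \<Rightarrow> 'h set \<Rightarrow> 'l measure \<Rightarrow>
    ('h \<Rightarrow> 'h \<Rightarrow> 'l \<Rightarrow> complex) \<Rightarrow> bool"
where
  "pov_density H L M Y \<mu> g \<longleftrightarrow>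
     (\<forall>u\<in>Y. \<forall>v\<in>Y. integrable \<mu> (g u v) \<and>
       (\<forall>S\<in>sets L. (\<integral>x. indicator S x *\<^sub>R g u v x \<partial>\<mu>) = cinner u (M S v))) \<and>
     (\<forall>x. psd_kernel Y (\<lambda>u v. g u v x))"

text \<open>The quantifier order matters: \<open>\<mu>\<close> is fixed before the countable set
  \<open>Y\<close>, and only \<open>g\<close> depends on \<open>Y\<close>. Densities belonging to
  different approximating sequences thus refer to the same measure.\<close>

lemma pov_density_exists:
  assumes "separable_hilbert_subspace H" "pov_measure H L M"
  shows "\<exists>\<mu>. finite_measure \<mu> \<and> sets \<mu> = sets L \<and>
    (\<forall>Y. countable Y \<longrightarrow> Y \<subseteq> H \<longrightarrow> (\<exists>g. pov_density H L M Y \<mu> g))"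
proof -
  interpret pov_hilbert H L M
    using assms by unfold_locales
  obtain \<mu> where \<mu>: "finite_measure \<mu>" "sets \<mu> = sets L"
    "\<And>v. v \<in> H \<Longrightarrow> absolutely_continuous \<mu> (vector_measure v)"
    using vector_measure_dominated by blast
  have "\<exists>g. pov_density H L M Y \<mu> g" if Y: "countable Y" "Y \<subseteq> H" for Y
  proof -
    obtain Z where Z: "Z \<in> null_sets \<mu>"
      "{x \<in> space \<mu>. \<not> psd_kernel Y (\<lambda>u v. density_kernel \<mu> u v x)} \<subseteq> Z"
      using AE_psd_density_kernel[OF \<mu> Y] unfolding eventually_ae_filter by blast
    \<comment> \<open>Replacing the kernel by zero on the exceptional set keeps all integrals and
      makes it positive everywhere, as the zero kernel is positive.\<close>
    define g where "g u v x = indicator (space \<mu> - Z) x *\<^sub>R density_kernel \<mu> u v x" for u v x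
    have "pov_density H L M Y \<mu> g"
      unfolding pov_density_def
    proof (intro conjI ballI allI)
      fix u v assume "u \<in> Y" "v \<in> Y"
      then have uv: "u \<in> H" "v \<in> H" using Y by auto
      have Z': "space \<mu> - Z \<in> sets \<mu>" using Z(1) by auto
      have meas: "density_kernel \<mu> u v \<in> borel_measurable \<mu>"
        using integrable_density_kernel[OF \<mu> uv] by auto
      show int: "integrable \<mu> (g u v)"
        unfolding g_def by (intro integrable_mult_indicator Z' integrable_density_kernel[OF \<mu> uv])
      fix S assume S: "S \<in> sets L"
      have "(\<integral>x. indicator S x *\<^sub>R g u v x \<partial>\<mu>) = (\<integral>x. indicator S x *\<^sub>R density_kernel \<mu> u v x \<partial>\<mu>)"
      proof (rule integral_cong_AE)
        show "(\<lambda>x. indicator S x *\<^sub>R g u v x) \<in> borel_measurable \<mu>"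
          using S \<mu>(2) int by (intro borel_measurable_scaleR borel_measurable_indicator) auto
        show "(\<lambda>x. indicator S x *\<^sub>R density_kernel \<mu> u v x) \<in> borel_measurable \<mu>"
          using S \<mu>(2) meas by (intro borel_measurable_scaleR borel_measurable_indicator) auto
        have "AE x in \<mu>. x \<notin> Z" using Z(1) by (rule AE_not_in)
        moreover have "AE x in \<mu>. x \<in> space \<mu>" by simp
        ultimately show "AE x in \<mu>. indicator S x *\<^sub>R g u v x = indicator S x *\<^sub>R density_kernel \<mu> u v x"
          by eventually_elim (simp add: g_def)
      qed
      also have "\<dots> = cinner u (M S v)"
        by (rule integral_density_kernel[OF \<mu> uv S])
      finally show "(\<integral>x. indicator S x *\<^sub>R g u v x \<partial>\<mu>) = cinner u (M S v)" .
    next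
      fix x
      show "psd_kernel Y (\<lambda>u v. g u v x)"
      proof (cases "x \<in> space \<mu> - Z")
        case True
        then have "psd_kernel Y (\<lambda>u v. density_kernel \<mu> u v x)" using Z(2) by auto
        with True show ?thesis by (simp add: g_def)
      next
        case False
        then show ?thesis by (simp add: g_def psd_kernel_def)
      qed
    qed
    then show ?thesis by blast
  qed
  with \<mu> show ?thesis by blast
qed

subsection \<open>Densities of joint probabilities\<close>

text \<open>Summable increments make the telescoping series converge absolutely almost everywhere
  and allow termwise integration over every \<open>S\<close>. The limit function does not depend on
  \<open>S\<close>, so a single density reproduces all the limits of set integrals.\<close>

lemma L1_fast_limit:
  fixes h :: "nat \<Rightarrow> 'a \<Rightarrow> real"
  assumes int: "\<And>m. integrable M (h m)" and nonneg: "\<And>m x. 0 \<le> h m x"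
    and bound: "\<And>m. (\<integral>x. \<bar>h (Suc m) x - h m x\<bar> \<partial>M) \<le> r m" and r: "summable r"
  shows "\<exists>f\<in>borel_measurable M. \<forall>S\<in>sets M. \<forall>l.
    (\<lambda>m. \<integral>x. indicator S x * h m x \<partial>M) \<longlonglongrightarrow> l \<longrightarrow>
      (\<integral>\<^sup>+x. f x * indicator S x \<partial>M) = ennreal l"
proof -
  define d where "d m x = h (Suc m) x - h m x" for m x
  have int_d: "integrable M (d m)" for m
    unfolding d_def by (intro Bochner_Integration.integrable_diff int)
  note [measurable] = borel_measurable_integrable[OF int] borel_measurable_integrable[OF int_d]
  have r_nn: "0 \<le> r m" for m
    by (rule order_trans[OF _ bound[of m]]) (rule integral_nonneg_AE, simp)
  have "(\<integral>\<^sup>+x. (\<Sum>m. ennreal \<bar>d m x\<bar>) \<partial>M) = (\<Sum>m. \<integral>\<^sup>+x. ennreal \<bar>d m x\<bar> \<partial>M)"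
    by (rule nn_integral_suminf) measurable
  also have "\<dots> = (\<Sum>m. ennreal (\<integral>x. \<bar>d m x\<bar> \<partial>M))"
    by (intro suminf_cong nn_integral_eq_integral integrable_abs int_d) simp
  also have "\<dots> \<le> (\<Sum>m. ennreal (r m))"
    unfolding d_def by (intro suminf_le ennreal_leI bound) auto
  also have "\<dots> = ennreal (suminf r)"
    by (rule suminf_ennreal2[OF r_nn r])
  finally have "(\<integral>\<^sup>+x. (\<Sum>m. ennreal \<bar>d m x\<bar>) \<partial>M) \<noteq> \<infinity>"
    by (auto simp: top_unique)
  then have "AE x in M. (\<Sum>m. ennreal \<bar>d m x\<bar>) \<noteq> \<infinity>"
    by (intro nn_integral_PInf_AE) measurable
  then have summ: "AE x in M. summable (\<lambda>m. \<bar>d m x\<bar>)"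
    by eventually_elim (auto intro: summable_suminf_not_top)
  \<comment> \<open>Where the series diverges this value is arbitrary and possibly negative; that
    set is null, and \<open>ennreal\<close> truncates the value there.\<close>
  define f where "f x = h 0 x + (\<Sum>m. d m x)" for x
  have sums: "(\<lambda>m. \<integral>x. indicator S x * d m x \<partial>M) sums (\<integral>x. indicator S x * (\<Sum>m. d m x) \<partial>M)"
    and int_suminf: "integrable M (\<lambda>x. indicator S x * (\<Sum>m. d m x))" if S: "S \<in> sets M" for S
  proof -
    have ind: "integrable M (\<lambda>x. indicator S x * d m x)" for m
      using integrable_real_mult_indicator[OF S int_d] by (simp add: mult.commute)
    have s1: "AE x in M. summable (\<lambda>m. norm (indicator S x * d m x))"
      using summ by eventually_elim (auto simp: abs_mult indicator_def)
    have s2: "summable (\<lambda>m. \<integral>x. norm (indicator S x * d m x) \<partial>M)"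
    proof (rule summable_comparison_test'[OF r])
      fix m
      have "(\<integral>x. norm (indicator S x * d m x) \<partial>M) \<le> (\<integral>x. \<bar>d m x\<bar> \<partial>M)"
        by (intro integral_mono integrable_norm integrable_abs int_d ind)
          (auto simp: abs_mult indicator_def)
      then show "norm (\<integral>x. norm (indicator S x * d m x) \<partial>M) \<le> r m"
        using bound[of m] by (simp add: d_def)
    qed
    have eq: "(\<Sum>m. indicator S x * d m x) = indicator S x * (\<Sum>m. d m x)" for x
      by (simp add: indicator_def)
    show "(\<lambda>m. \<integral>x. indicator S x * d m x \<partial>M) sums (\<integral>x. indicator S x * (\<Sum>m. d m x) \<partial>M)"
      "integrable M (\<lambda>x. indicator S x * (\<Sum>m. d m x))"
      using sums_integral[where f="\<lambda>m x. indicator S x * d m x", OF ind s1 s2]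
        integrable_suminf[where f="\<lambda>m x. indicator S x * d m x", OF ind s1 s2]
      by (simp_all only: eq)
  qed
  have f_nonneg: "AE x in M. 0 \<le> f x"
    using summ
  proof eventually_elim
    case (elim x)
    then have "(\<lambda>m. d m x) sums (\<Sum>m. d m x)"
      by (rule summable_sums[OF summable_rabs_cancel])
    then have "(\<lambda>m. h 0 x + (\<Sum>i<m. d i x)) \<longlonglongrightarrow> f x"
      unfolding f_def sums_def by (intro tendsto_add tendsto_const)
    moreover have "h 0 x + (\<Sum>i<m. d i x) = h m x" for m
      unfolding d_def by (simp add: sum_lessThan_telescope[of "\<lambda>i. h i x"])
    ultimately show ?case
      using nonneg by (intro LIMSEQ_le_const) auto
  qed
  show ?thesis
  proof (intro bexI[of _ "\<lambda>x. ennreal (f x)"] ballI allI impI)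
    show "(\<lambda>x. ennreal (f x)) \<in> borel_measurable M"
      unfolding f_def by measurable
    fix S l assume S: "S \<in> sets M" and l: "(\<lambda>m. \<integral>x. indicator S x * h m x \<partial>M) \<longlonglongrightarrow> l"
    have ind_h: "integrable M (\<lambda>x. indicator S x * h m x)" for m
      using integrable_real_mult_indicator[OF S int] by (simp add: mult.commute)
    have "(\<integral>x. indicator S x * h 0 x \<partial>M) + (\<Sum>i<m. \<integral>x. indicator S x * d i x \<partial>M) =
        (\<integral>x. indicator S x * h m x \<partial>M)" for m
    proof -
      have "(\<integral>x. indicator S x * d i x \<partial>M) =
          (\<integral>x. indicator S x * h (Suc i) x \<partial>M) - (\<integral>x. indicator S x * h i x \<partial>M)" for i
        unfolding d_def right_diff_distrib by (rule Bochner_Integration.integral_diff[OF ind_h ind_h])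
      then show ?thesis
        by (simp add: sum_lessThan_telescope[of "\<lambda>i. \<integral>x. indicator S x * h i x \<partial>M"])
    qed
    moreover have "(\<lambda>m. (\<integral>x. indicator S x * h 0 x \<partial>M) + (\<Sum>i<m. \<integral>x. indicator S x * d i x \<partial>M)) \<longlonglongrightarrow>
        (\<integral>x. indicator S x * h 0 x \<partial>M) + (\<integral>x. indicator S x * (\<Sum>m. d m x) \<partial>M)"
      using sums[OF S] unfolding sums_def by (intro tendsto_add tendsto_const)
    ultimately have "l = (\<integral>x. indicator S x * h 0 x \<partial>M) + (\<integral>x. indicator S x * (\<Sum>m. d m x) \<partial>M)"
      using l LIMSEQ_unique by simp
    also have "\<dots> = (\<integral>x. f x * indicator S x \<partial>M)"
      by (subst Bochner_Integration.integral_add[symmetric, OF ind_h int_suminf[OF S]])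
        (simp add: f_def algebra_simps)
    finally have l_eq: "l = (\<integral>x. f x * indicator S x \<partial>M)" .
    have "integrable M (\<lambda>x. f x * indicator S x)"
      using Bochner_Integration.integrable_add[OF ind_h[of 0] int_suminf[OF S]]
      by (simp add: f_def algebra_simps)
    then have "(\<integral>\<^sup>+x. ennreal (f x * indicator S x) \<partial>M) = ennreal l"
      unfolding l_eq using f_nonneg by (intro nn_integral_eq_integral) auto
    moreover have "ennreal (f x * indicator S x) = ennreal (f x) * indicator S x" for x
      by (simp add: indicator_def)
    ultimately show "(\<integral>\<^sup>+x. ennreal (f x) * indicator S x \<partial>M) = ennreal l"
      by simp
  qed
qed

text \<open>The quadratic form of a kernel is continuous in \<open>L\<^sup>1\<close> along Hilbert space limits by this inequality.\<close>

lemma psd_kernel_quadratic_diff: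
  assumes psd: "psd_kernel X K" and J: "finite J" "J \<subseteq> X" and t: "0 < t"
  defines "Q \<equiv> \<lambda>b. Re (\<Sum>x\<in>J. \<Sum>y\<in>J. cnj (b x) * b y * K x y)"
  shows "\<bar>Q a - Q b\<bar> \<le> (t * Q (\<lambda>x. a x - b x) + Q (\<lambda>x. a x + b x) / t) / 2"
proof -
  have "0 \<le> t * Q (\<lambda>x. a x - b x) + Q (\<lambda>x. a x + b x) / t + 2 * s * (Q a - Q b)"
    if s: "s = 1 \<or> s = -1" for s :: real
  proof -
    define p where "p = complex_of_real (sqrt t)"
    define q where "q = complex_of_real (s / sqrt t)"
    have pq: "cnj p = p" "cnj q = q" "p * p = complex_of_real t" "q * q = complex_of_real (1 / t)"
      "p * q = complex_of_real s"
      using t s by (auto simp: p_def q_def of_real_mult[symmetric] simp del: of_real_mult of_real_divide)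
    \<comment> \<open>The cross terms of the form at \<open>c\<close> add up to
      \<open>2 * s * (Q a - Q b)\<close>, so positivity for \<open>s = 1\<close> and
      \<open>s = -1\<close> bounds the difference from both sides. Weighting by \<open>t\<close>
      replaces the square roots of Cauchy-Schwarz by an expression linear in the two forms, which
      can be integrated.\<close>
    define c where "c x = p * (a x - b x) + q * (a x + b x)" for x
    have "cnj (c x) * c y * K x y =
        p * p * (cnj (a x - b x) * (a y - b y) * K x y) + q * q * (cnj (a x + b x) * (a y + b y) * K x y)
        + 2 * (p * q) * (cnj (a x) * a y * K x y - cnj (b x) * b y * K x y)" for x y
      by (simp add: c_def pq(1,2) algebra_simps)
    then have "(\<Sum>x\<in>J. \<Sum>y\<in>J. cnj (c x) * c y * K x y) =
        complex_of_real t * (\<Sum>x\<in>J. \<Sum>y\<in>J. cnj (a x - b x) * (a y - b y) * K x y) +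
        complex_of_real (1 / t) * (\<Sum>x\<in>J. \<Sum>y\<in>J. cnj (a x + b x) * (a y + b y) * K x y) +
        complex_of_real (2 * s) * ((\<Sum>x\<in>J. \<Sum>y\<in>J. cnj (a x) * a y * K x y) -
          (\<Sum>x\<in>J. \<Sum>y\<in>J. cnj (b x) * b y * K x y))"
      unfolding pq by (simp only: sum.distrib sum_distrib_left[symmetric] sum_subtractf of_real_mult of_real_numeral)
    moreover have Re: "Re (complex_of_real t * A + complex_of_real u * B + complex_of_real r * (C - D)) =
        t * Re A + u * Re B + r * (Re C - Re D)" for A B C D u r
      by simp
    ultimately have "Q c = t * Q (\<lambda>x. a x - b x) + (1 / t) * Q (\<lambda>x. a x + b x) + 2 * s * (Q a - Q b)"
      unfolding Q_def by (simp only: Re)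
    moreover have "0 \<le> Q c"
      using psd_kernelD[OF psd J, of c] by (simp add: Q_def less_eq_complex_def)
    ultimately show ?thesis by simp
  qed
  from this[of 1] this[of "-1"]
  have "2 * (Q a - Q b) \<le> t * Q (\<lambda>x. a x - b x) + Q (\<lambda>x. a x + b x) / t"
    "2 * (Q b - Q a) \<le> t * Q (\<lambda>x. a x - b x) + Q (\<lambda>x. a x + b x) / t"
    by simp_all
  moreover have "\<bar>p - q\<bar> \<le> Z / 2" if "2 * (p - q) \<le> Z" "2 * (q - p) \<le> Z" for p q Z :: real
  proof (rule abs_leI)
    show "p - q \<le> Z / 2" "- (p - q) \<le> Z / 2"
      using that by (simp_all add: field_simps)
  qed
  ultimately show ?thesis by blast
qed

section \<open>Product kernels and the densities of states\<close>

context tensor_product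
begin

context
  fixes L :: "nat \<Rightarrow> 'l measure" and M :: "nat \<Rightarrow> 'l set \<Rightarrow> 'h \<Rightarrow> 'h" and \<mu> :: "nat \<Rightarrow> 'l measure"
  assumes pov: "\<And>n. n \<in> {1..N} \<Longrightarrow> pov_measure (H n) (L n) (M n)"
    and fin: "\<And>n. finite_measure (\<mu> n)"
    and sets_\<mu>: "\<And>n. n \<in> {1..N} \<Longrightarrow> sets (\<mu> n) = sets (L n)"
    and dens: "\<And>n Y. n \<in> {1..N} \<Longrightarrow> countable Y \<Longrightarrow> Y \<subseteq> H n \<Longrightarrow> \<exists>g. pov_density (H n) (L n) (M n) Y (\<mu> n) g"
begin

interpretation product_sigma_finite \<mu>
  by (intro product_sigma_finite.intro finite_measure.sigma_finite_measure fin)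

lemma positive_M:
  assumes "D \<in> (\<Pi> n\<in>{1..N}. sets (L n))" "n \<in> {1..N}"
  shows "positive_op (H n) (M n (D n))"
  using assms pov[OF assms(2)] unfolding pov_measure_def by blast

lemma box_sets: "D \<in> (\<Pi> n\<in>{1..N}. sets (L n)) \<Longrightarrow> PiE {1..N} D \<in> sets (PiM {1..N} \<mu>)"
  using sets_\<mu> by (intro sets_PiM_I_finite) auto

lemma box_space: "PiE {1..N} (\<lambda>n. space (L n)) = space (PiM {1..N} \<mu>)"
  unfolding space_PiM using sets_eq_imp_space_eq[OF sets_\<mu>] by (intro PiE_cong) simp

text \<open>The kernels of the sites, taken in independent variables, multiply to a kernel on
  product vectors: positive by the Schur product theorem, with integrals over boxes that factorise
  by Fubini.\<close>

lemma product_kernel: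
  assumes X: "countable X" "X \<subseteq> P"
  shows "\<exists>K. (\<forall>\<omega>. psd_kernel X (K \<omega>)) \<and>
    (\<forall>x\<in>X. \<forall>y\<in>X. integrable (PiM {1..N} \<mu>) (\<lambda>\<omega>. K \<omega> x y)) \<and>
    (\<forall>x\<in>X. \<forall>y\<in>X. \<forall>D\<in>\<Pi> n\<in>{1..N}. sets (L n).
      (\<integral>\<omega>. indicator (PiE {1..N} D) \<omega> *\<^sub>R K \<omega> x y \<partial>PiM {1..N} \<mu>) =
      (\<Prod>n=1..N. cinner (x n) (M n (D n) (y n))))"
proof -
  have "\<exists>g. pov_density (H n) (L n) (M n) ((\<lambda>x. x n) ` X) (\<mu> n) g" if n: "n \<in> {1..N}" for n
  proof (rule dens[OF n])
    show "(\<lambda>x. x n) ` X \<subseteq> H n"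
      by (rule image_subsetI, rule Pi_mem[OF subsetD[OF X(2)] n])
  qed (use X in auto)
  then obtain g where g: "\<And>n. n \<in> {1..N} \<Longrightarrow> pov_density (H n) (L n) (M n) ((\<lambda>x. x n) ` X) (\<mu> n) (g n)"
    by metis
  have int: "integrable (\<mu> n) (g n (x n) (y n))" if "n \<in> {1..N}" "x \<in> X" "y \<in> X" for n x y
    using g[OF that(1)] that(2,3) unfolding pov_density_def by blast
  have integral: "(\<integral>t. indicator S t *\<^sub>R g n (x n) (y n) t \<partial>\<mu> n) = cinner (x n) (M n S (y n))"
    if "n \<in> {1..N}" "x \<in> X" "y \<in> X" "S \<in> sets (L n)" for n x y S
    using g[OF that(1)] that(2-) unfolding pov_density_def by blast
  have psd: "psd_kernel X (\<lambda>x y. g n (x n) (y n) t)" if n: "n \<in> {1..N}" for n t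
    by (rule psd_kernel_vimage[of "(\<lambda>x. x n) ` X"]) (use g[OF n] in \<open>auto simp: pov_density_def\<close>)
  define K where "K \<omega> x y = (\<Prod>n=1..N. g n (x n) (y n) (\<omega> n))" for \<omega> x y
  have "psd_kernel X (K \<omega>)" for \<omega>
    unfolding K_def by (intro psd_kernel_prod psd)
  moreover have "integrable (PiM {1..N} \<mu>) (\<lambda>\<omega>. K \<omega> x y)" if "x \<in> X" "y \<in> X" for x y
    unfolding K_def using that by (intro product_integrable_prod int) auto
  moreover have "(\<integral>\<omega>. indicator (PiE {1..N} D) \<omega> *\<^sub>R K \<omega> x y \<partial>PiM {1..N} \<mu>) =
      (\<Prod>n=1..N. cinner (x n) (M n (D n) (y n)))"
    if x: "x \<in> X" and y: "y \<in> X" and D: "D \<in> (\<Pi> n\<in>{1..N}. sets (L n))" for x y D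
  proof -
    have "(\<integral>\<omega>. indicator (PiE {1..N} D) \<omega> *\<^sub>R K \<omega> x y \<partial>PiM {1..N} \<mu>) =
        (\<integral>\<omega>. (\<Prod>n=1..N. indicator (D n) (\<omega> n) *\<^sub>R g n (x n) (y n) (\<omega> n)) \<partial>PiM {1..N} \<mu>)"
    proof (intro Bochner_Integration.integral_cong refl)
      fix \<omega> assume "\<omega> \<in> space (PiM {1..N} \<mu>)"
      then have ext: "\<omega> \<in> extensional {1..N}" by (simp add: space_PiM PiE_def)
      show "indicator (PiE {1..N} D) \<omega> *\<^sub>R K \<omega> x y =
          (\<Prod>n=1..N. indicator (D n) (\<omega> n) *\<^sub>R g n (x n) (y n) (\<omega> n))"
      proof (cases "\<omega> \<in> PiE {1..N} D")
        case True
        then show ?thesis by (auto simp: K_def intro!: prod.cong dest: PiE_mem)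
      next
        case False
        then obtain n where "n \<in> {1..N}" "\<omega> n \<notin> D n"
          using ext unfolding PiE_def Pi_def by blast
        then have "(\<Prod>n=1..N. indicator (D n) (\<omega> n) *\<^sub>R g n (x n) (y n) (\<omega> n)) = 0"
          by (intro prod_zero bexI[of _ n]) simp_all
        with False show ?thesis by simp
      qed
    qed
    also have "\<dots> = (\<Prod>n=1..N. \<integral>t. indicator (D n) t *\<^sub>R g n (x n) (y n) t \<partial>\<mu> n)"
      using D sets_\<mu> x y
      by (intro product_integral_prod integrable_mult_indicator int) auto
    also have "\<dots> = (\<Prod>n=1..N. cinner (x n) (M n (D n) (y n)))"
      using D x y by (intro prod.cong refl integral) auto
    finally show ?thesis .
  qed
  ultimately show ?thesis by blast
qed

text \<open>The approximants \<open>v m\<close> of \<open>w\<close> involve only countably many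
  product vectors, collected in \<open>X\<close>, so one positive kernel \<open>K\<close> serves
  them all. The densities of the \<open>v m\<close> then form a fast Cauchy sequence in L1, whose
  limit has the right integral over each box by continuity of the bounded tensor operator.\<close>

lemma vector_density:
  "\<exists>f. f \<in> borel_measurable (PiM {1..N} \<mu>) \<and> (\<forall>D\<in>\<Pi> n\<in>{1..N}. sets (L n).
    (\<integral>\<^sup>+\<omega>. f \<omega> * indicator (PiE {1..N} D) \<omega> \<partial>PiM {1..N} \<mu>) =
      ennreal (Re (cinner w (tensor_op N H T (\<lambda>n. M n (D n)) w))))"
proof -
  let ?\<Omega> = "PiM {1..N} \<mu>"
  have "\<exists>I c. finite I \<and> I \<subseteq> P \<and> norm ((\<Sum>x\<in>I. c x *\<^sub>C T x) - w) \<le> (1/2) ^ Suc m" for m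
  proof -
    have "w \<in> closure (cspan (T ` P))" using dense by simp
    then obtain v where v: "v \<in> cspan (T ` P)" "dist v w < (1/2) ^ Suc m"
      unfolding closure_approachable by (metis zero_less_power half_gt_zero_iff zero_less_one)
    obtain I c where "finite I" "I \<subseteq> P" "v = (\<Sum>x\<in>I. c x *\<^sub>C T x)"
      using v(1) by (rule cspan_image_explicit)
    with v(2) show ?thesis by (auto simp: dist_norm intro!: exI[of _ I] exI[of _ c])
  qed
  then obtain I c where I: "\<And>m. finite (I m)" "\<And>m. I m \<subseteq> P"
    "\<And>m. norm ((\<Sum>x\<in>I m. c m x *\<^sub>C T x) - w) \<le> (1/2) ^ Suc m"
    by metis
  \<comment> \<open>Increasing index sets let two consecutive approximants be written over the same
    set, with \<open>a m\<close> zero outside \<open>I m\<close>.\<close>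
  define J where "J m = (\<Union>l\<le>m. I l)" for m
  define X where "X = (\<Union>m. I m)"
  define a where "a m x = (if x \<in> I m then c m x else 0)" for m x
  define v where "v m = (\<Sum>x\<in>I m. c m x *\<^sub>C T x)" for m
  have J: "finite (J m)" "J m \<subseteq> X" "J m \<subseteq> P" for m
    using I by (auto simp: J_def X_def)
  have IJ: "l \<le> m \<Longrightarrow> I l \<subseteq> J m" for l m by (auto simp: J_def)
  have X: "countable X" "X \<subseteq> P"
    using I(1,2) by (auto simp: X_def intro: countable_finite)
  have v_eq: "v l = (\<Sum>x\<in>J m. a l x *\<^sub>C T x)" if "l \<le> m" for l m
    unfolding v_def using IJ[OF that] J(1)[of m]
    by (intro sum.mono_neutral_cong_left) (auto simp: a_def scaleC.zero_left)
  have "\<exists>K. (\<forall>\<omega>. psd_kernel X (K \<omega>)) \<and>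
    (\<forall>x\<in>X. \<forall>y\<in>X. integrable ?\<Omega> (\<lambda>\<omega>. K \<omega> x y)) \<and>
    (\<forall>x\<in>X. \<forall>y\<in>X. \<forall>D\<in>\<Pi> n\<in>{1..N}. sets (L n).
      (\<integral>\<omega>. indicator (PiE {1..N} D) \<omega> *\<^sub>R K \<omega> x y \<partial>?\<Omega>) =
      (\<Prod>n=1..N. cinner (x n) (M n (D n) (y n))))"
    by (rule product_kernel[OF X])
  then obtain K where K: "(\<forall>\<omega>. psd_kernel X (K \<omega>)) \<and>
    (\<forall>x\<in>X. \<forall>y\<in>X. integrable ?\<Omega> (\<lambda>\<omega>. K \<omega> x y)) \<and>
    (\<forall>x\<in>X. \<forall>y\<in>X. \<forall>D\<in>\<Pi> n\<in>{1..N}. sets (L n).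
      (\<integral>\<omega>. indicator (PiE {1..N} D) \<omega> *\<^sub>R K \<omega> x y \<partial>?\<Omega>) =
      (\<Prod>n=1..N. cinner (x n) (M n (D n) (y n))))"
    by (rule exE)
  have psd: "psd_kernel X (K \<omega>)" for \<omega>
    using K by blast
  have int_K: "integrable ?\<Omega> (\<lambda>\<omega>. K \<omega> x y)" if "x \<in> X" "y \<in> X" for x y
    using K that by blast
  have integral_K: "(\<integral>\<omega>. indicator (PiE {1..N} D) \<omega> *\<^sub>R K \<omega> x y \<partial>?\<Omega>) =
      (\<Prod>n=1..N. cinner (x n) (M n (D n) (y n)))"
    if "x \<in> X" "y \<in> X" "D \<in> (\<Pi> n\<in>{1..N}. sets (L n))" for x y D
    using K that by blast
  define Q where "Q m b \<omega> = Re (\<Sum>x\<in>J m. \<Sum>y\<in>J m. cnj (b x) * b y * K \<omega> x y)" for m b \<omega>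
  have Q_nonneg: "0 \<le> Q m b \<omega>" for m b \<omega>
    using psd_kernelD[OF psd J(1,2)] by (simp add: Q_def less_eq_complex_def)
  have int_Q: "integrable ?\<Omega> (Q m b)" for m b
    unfolding Q_def using J(2)[of m]
    by (intro integrable_Re Bochner_Integration.integrable_sum integrable_mult_right int_K) auto
  have integral_Q: "(\<integral>\<omega>. indicator (PiE {1..N} D) \<omega> * Q m b \<omega> \<partial>?\<Omega>) =
      Re (cinner (\<Sum>x\<in>J m. b x *\<^sub>C T x) (tensor_op N H T (\<lambda>n. M n (D n)) (\<Sum>x\<in>J m. b x *\<^sub>C T x)))"
    if D: "D \<in> (\<Pi> n\<in>{1..N}. sets (L n))" for D m b
  proof -
    have ind: "integrable ?\<Omega> (\<lambda>\<omega>. indicator (PiE {1..N} D) \<omega> *\<^sub>R K \<omega> x y)" if "x \<in> J m" "y \<in> J m" for x y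
      using that J(2)[of m] by (intro integrable_mult_indicator box_sets[OF D] int_K) auto
    let ?s = "\<lambda>\<omega>. \<Sum>x\<in>J m. \<Sum>y\<in>J m. cnj (b x) * b y * (indicator (PiE {1..N} D) \<omega> *\<^sub>R K \<omega> x y)"
    have int_s: "integrable ?\<Omega> ?s"
      by (intro Bochner_Integration.integrable_sum integrable_mult_right ind)
    have "(\<integral>\<omega>. indicator (PiE {1..N} D) \<omega> * Q m b \<omega> \<partial>?\<Omega>) = (\<integral>\<omega>. Re (?s \<omega>) \<partial>?\<Omega>)"
    proof (intro Bochner_Integration.integral_cong refl)
      fix \<omega>
      have "?s \<omega> = indicator (PiE {1..N} D) \<omega> *\<^sub>R (\<Sum>x\<in>J m. \<Sum>y\<in>J m. cnj (b x) * b y * K \<omega> x y)"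
        by (simp only: scaleR_sum_right mult_scaleR_right)
      then show "indicator (PiE {1..N} D) \<omega> * Q m b \<omega> = Re (?s \<omega>)"
        by (simp only: Q_def scaleR_complex.sel)
    qed
    also have "\<dots> = Re (\<integral>\<omega>. ?s \<omega> \<partial>?\<Omega>)"
      by (rule integral_Re[OF int_s])
    also have "(\<integral>\<omega>. ?s \<omega> \<partial>?\<Omega>) = (\<Sum>x\<in>J m. \<Sum>y\<in>J m. cnj (b x) * b y *
        (\<integral>\<omega>. indicator (PiE {1..N} D) \<omega> *\<^sub>R K \<omega> x y \<partial>?\<Omega>))"
      by (subst Bochner_Integration.integral_sum,
          intro Bochner_Integration.integrable_sum integrable_mult_right ind, assumption+,
          intro sum.cong refl, subst Bochner_Integration.integral_sum,
          intro integrable_mult_right ind, assumption+, simp only: integral_mult_right_zero)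
    also have "\<dots> = (\<Sum>x\<in>J m. \<Sum>y\<in>J m. cnj (b x) * b y * (\<Prod>n=1..N. cinner (x n) (M n (D n) (y n))))"
      using J(2)[of m] D by (intro sum.cong refl arg_cong2[where f="(*)"] integral_K) auto
    also have "\<dots> = cinner (\<Sum>x\<in>J m. b x *\<^sub>C T x)
        (tensor_op N H T (\<lambda>n. M n (D n)) (\<Sum>x\<in>J m. b x *\<^sub>C T x))"
      by (rule cinner_tensor_op[OF positive_M[OF D] J(3) J(3), symmetric])
    finally show ?thesis .
  qed
  \<comment> \<open>Over the whole space the POV measures give the identity; this is how control in
    Hilbert norm becomes control in L1.\<close>
  have norm_Q: "(\<integral>\<omega>. Q m b \<omega> \<partial>?\<Omega>) = (norm (\<Sum>x\<in>J m. b x *\<^sub>C T x))\<^sup>2" for m b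
  proof -
    have D: "(\<lambda>n. space (L n)) \<in> (\<Pi> n\<in>{1..N}. sets (L n))" by auto
    have "tensor_op N H T (\<lambda>n. M n (space (L n))) = (\<lambda>v. v)"
      using pov by (intro tensor_op_eq_id positive_M[OF D]) (auto simp: pov_measure_def)
    then have "(\<integral>\<omega>. indicator (space ?\<Omega>) \<omega> * Q m b \<omega> \<partial>?\<Omega>) = (norm (\<Sum>x\<in>J m. b x *\<^sub>C T x))\<^sup>2"
      using integral_Q[OF D, of m b] by (simp only: box_space cinner_self Re_complex_of_real)
    moreover have "(\<integral>\<omega>. indicator (space ?\<Omega>) \<omega> * Q m b \<omega> \<partial>?\<Omega>) = (\<integral>\<omega>. Q m b \<omega> \<partial>?\<Omega>)"
      by (intro Bochner_Integration.integral_cong refl) simp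
    ultimately show ?thesis by simp
  qed
  define h where "h m = Q m (a m)" for m
  have h_Suc: "h m = Q (Suc m) (a m)" for m
  proof
    fix \<omega>
    have "(\<Sum>x\<in>J m. \<Sum>y\<in>J m. cnj (a m x) * a m y * K \<omega> x y) = (\<Sum>x\<in>J (Suc m). \<Sum>y\<in>J (Suc m). cnj (a m x) * a m y * K \<omega> x y)"
    proof -
      have sub: "J m \<subseteq> J (Suc m)" by (simp add: J_def SUP_subset_mono)
      have 0: "a m x = 0" if "x \<in> J (Suc m) - J m" for x
        using that IJ[of m m] by (auto simp: a_def)
      have "(\<Sum>y\<in>J m. cnj (a m x) * a m y * K \<omega> x y) = (\<Sum>y\<in>J (Suc m). cnj (a m x) * a m y * K \<omega> x y)" for x
        by (rule sum.mono_neutral_left[OF J(1) sub]) (simp add: 0)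
      moreover have "(\<Sum>x\<in>J m. \<Sum>y\<in>J (Suc m). cnj (a m x) * a m y * K \<omega> x y) =
          (\<Sum>x\<in>J (Suc m). \<Sum>y\<in>J (Suc m). cnj (a m x) * a m y * K \<omega> x y)"
        by (rule sum.mono_neutral_left[OF J(1) sub]) (simp add: 0)
      ultimately show ?thesis by simp
    qed
    then show "h m \<omega> = Q (Suc m) (a m) \<omega>" by (simp only: h_def Q_def)
  qed
  \<comment> \<open>From the quadratic inequality with \<open>t = 2 ^ m\<close>: the difference
    \<open>v (Suc m) - v m\<close> has norm at most \<open>(1/2) ^ m\<close> and the sum at most
    \<open>2 * norm w + 2\<close>, so both terms are multiples of \<open>(1/2) ^ m\<close>.\<close>
  define C where "C = (1 + (2 * norm w + 2)\<^sup>2) / 2"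
  have bound: "(\<integral>\<omega>. \<bar>h (Suc m) \<omega> - h m \<omega>\<bar> \<partial>?\<Omega>) \<le> C * (1/2) ^ m" for m
  proof -
    let ?J = "J (Suc m)"
    let ?d = "\<lambda>x. a (Suc m) x - a m x" and ?s = "\<lambda>x. a (Suc m) x + a m x"
    have vd: "(\<Sum>x\<in>?J. ?d x *\<^sub>C T x) = v (Suc m) - v m" and vs: "(\<Sum>x\<in>?J. ?s x *\<^sub>C T x) = v (Suc m) + v m"
      using v_eq[of "Suc m" "Suc m"] v_eq[of m "Suc m"]
      by (simp_all add: scaleC.diff_left scaleC_add_left sum_subtractf sum.distrib)
    have pw: "(1/2) ^ Suc m = (1/2) * (1/2 :: real) ^ m" "(1/2) ^ Suc (Suc m) = (1/4) * (1/2 :: real) ^ m"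
      "0 < (1/2 :: real) ^ m" "(1/2 :: real) ^ m \<le> 1"
      by (simp_all add: power_le_one)
    have "norm (v (Suc m) - v m) = norm ((v (Suc m) - w) - (v m - w))" by simp
    also have "\<dots> \<le> norm (v (Suc m) - w) + norm (v m - w)" by (rule norm_triangle_ineq4)
    also have "\<dots> \<le> (1/2) ^ m" using I(3)[of m] I(3)[of "Suc m"] pw by (simp only: v_def)
    finally have d: "(norm (v (Suc m) - v m))\<^sup>2 \<le> ((1/2) ^ m)\<^sup>2" by (intro power_mono) auto
    have "norm (v (Suc m) + v m) = norm ((v (Suc m) - w) + ((v m - w) + 2 *\<^sub>R w))"
      by (simp add: scaleR_2)
    also have "\<dots> \<le> norm (v (Suc m) - w) + (norm (v m - w) + norm (2 *\<^sub>R w))"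
      by (intro norm_triangle_le add_mono norm_triangle_ineq order_refl)
    also have "\<dots> \<le> 2 * norm w + 2"
      using I(3)[of m] I(3)[of "Suc m"] pw unfolding v_def by simp
    finally have s: "(norm (v (Suc m) + v m))\<^sup>2 \<le> (2 * norm w + 2)\<^sup>2" by (intro power_mono) auto
    have "(\<integral>\<omega>. \<bar>h (Suc m) \<omega> - h m \<omega>\<bar> \<partial>?\<Omega>) \<le>
        (\<integral>\<omega>. (2 ^ m * Q (Suc m) ?d \<omega> + Q (Suc m) ?s \<omega> / 2 ^ m) / 2 \<partial>?\<Omega>)"
    proof (rule integral_mono)
      show "integrable ?\<Omega> (\<lambda>\<omega>. \<bar>h (Suc m) \<omega> - h m \<omega>\<bar>)"
        unfolding h_def by (intro integrable_abs Bochner_Integration.integrable_diff int_Q)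
      show "integrable ?\<Omega> (\<lambda>\<omega>. (2 ^ m * Q (Suc m) ?d \<omega> + Q (Suc m) ?s \<omega> / 2 ^ m) / 2)"
        by (intro integrable_divide_zero Bochner_Integration.integrable_add integrable_mult_right int_Q)
      fix \<omega>
      show "\<bar>h (Suc m) \<omega> - h m \<omega>\<bar> \<le> (2 ^ m * Q (Suc m) ?d \<omega> + Q (Suc m) ?s \<omega> / 2 ^ m) / 2"
        unfolding h_Suc[of m] unfolding h_def Q_def
        by (rule psd_kernel_quadratic_diff[OF psd J(1,2)]) simp
    qed
    also have "\<dots> = (2 ^ m * (norm (v (Suc m) - v m))\<^sup>2 + (norm (v (Suc m) + v m))\<^sup>2 / 2 ^ m) / 2"
    proof -
      have "integrable ?\<Omega> (\<lambda>\<omega>. 2 ^ m * Q (Suc m) ?d \<omega>)" "integrable ?\<Omega> (\<lambda>\<omega>. Q (Suc m) ?s \<omega> / 2 ^ m)"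
        by (intro integrable_divide_zero integrable_mult_right int_Q)+
      then show ?thesis
        by (simp add: norm_Q vd vs del: One_nat_def)
    qed
    also have "\<dots> \<le> (2 ^ m * ((1/2) ^ m)\<^sup>2 + (2 * norm w + 2)\<^sup>2 / 2 ^ m) / 2"
      using d s by (intro divide_right_mono add_mono mult_left_mono) auto
    also have "\<dots> = C * (1/2) ^ m"
      by (simp add: C_def power2_eq_square power_divide field_simps)
    finally show ?thesis .
  qed
  have summable: "summable (\<lambda>m. C * (1/2) ^ m)"
    by (intro summable_mult summable_geometric) simp
  have int_h: "integrable ?\<Omega> (h m)" and h_nonneg: "0 \<le> h m \<omega>" for m \<omega>
    unfolding h_def by (fact int_Q, fact Q_nonneg)
  obtain f where f: "f \<in> borel_measurable ?\<Omega>"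
    "\<forall>S\<in>sets ?\<Omega>. \<forall>l. (\<lambda>m. \<integral>\<omega>. indicator S \<omega> * h m \<omega> \<partial>?\<Omega>) \<longlonglongrightarrow> l \<longrightarrow>
      (\<integral>\<^sup>+\<omega>. f \<omega> * indicator S \<omega> \<partial>?\<Omega>) = ennreal l"
    using L1_fast_limit[OF int_h h_nonneg bound summable] by (rule bexE)
  have "v \<longlonglongrightarrow> w"
  proof (rule LIM_zero_cancel, rule Lim_null_comparison)
    show "\<forall>\<^sub>F m in sequentially. norm (v m - w) \<le> (1/2) ^ Suc m"
      using I(3) by (simp add: v_def)
    show "(\<lambda>m. (1/2 :: real) ^ Suc m) \<longlonglongrightarrow> 0"
      by (intro LIMSEQ_Suc LIMSEQ_power_zero) simp
  qed
  have "(\<integral>\<^sup>+\<omega>. f \<omega> * indicator (PiE {1..N} D) \<omega> \<partial>?\<Omega>) =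
      ennreal (Re (cinner w (tensor_op N H T (\<lambda>n. M n (D n)) w)))"
    if D: "D \<in> (\<Pi> n\<in>{1..N}. sets (L n))" for D
  proof (rule f(2)[THEN bspec, OF box_sets[OF D], THEN spec, THEN mp])
    have B: "bounded_linear (tensor_op N H T (\<lambda>n. M n (D n)))"
      by (intro bounded_op_UNIV_bounded_linear bounded_tensor_op positive_M[OF D])
    have "(\<lambda>m. Re (cinner (v m) (tensor_op N H T (\<lambda>n. M n (D n)) (v m)))) \<longlonglongrightarrow>
        Re (cinner w (tensor_op N H T (\<lambda>n. M n (D n)) w))"
      by (rule tendsto_Re[OF cinner.tendsto[OF \<open>v \<longlonglongrightarrow> w\<close> bounded_linear.tendsto[OF B \<open>v \<longlonglongrightarrow> w\<close>]]])
    then show "(\<lambda>m. \<integral>\<omega>. indicator (PiE {1..N} D) \<omega> * h m \<omega> \<partial>?\<Omega>) \<longlonglongrightarrow>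
        Re (cinner w (tensor_op N H T (\<lambda>n. M n (D n)) w))"
      by (simp only: h_def integral_Q[OF D] v_eq[OF order_refl, symmetric])
  qed
  with f(1) show ?thesis by blast
qed

text \<open>The nonnegative densities of the vector states \<open>w k\<close> refer to the same
  product measure and may be summed under the integral. Nonnegativity of the trace is recorded
  because \<open>ennreal\<close> of a real part determines the complex number only then.\<close>

lemma state_density:
  assumes \<rho>: "density_operator \<rho>"
  shows "\<exists>f. f \<in> borel_measurable (PiM {1..N} \<mu>) \<and> (\<forall>D\<in>\<Pi> n\<in>{1..N}. sets (L n).
    0 \<le> op_trace (\<rho> \<circ> tensor_op N H T (\<lambda>n. M n (D n))) \<and>
    (\<integral>\<^sup>+\<omega>. f \<omega> * indicator (PiE {1..N} D) \<omega> \<partial>PiM {1..N} \<mu>) =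
      ennreal (Re (op_trace (\<rho> \<circ> tensor_op N H T (\<lambda>n. M n (D n))))))"
proof -
  let ?\<Omega> = "PiM {1..N} \<mu>"
  obtain w :: "nat \<Rightarrow> 'k" where w: "\<forall>F. positive_op UNIV F \<longrightarrow>
      (\<lambda>k. cinner (w k) (F (w k))) sums op_trace (\<rho> \<circ> F)"
    using density_operator_trace[OF \<rho>] by (rule exE)
  obtain f where f: "\<forall>k. f k \<in> borel_measurable ?\<Omega> \<and> (\<forall>D\<in>\<Pi> n\<in>{1..N}. sets (L n).
    (\<integral>\<^sup>+\<omega>. f k \<omega> * indicator (PiE {1..N} D) \<omega> \<partial>?\<Omega>) =
      ennreal (Re (cinner (w k) (tensor_op N H T (\<lambda>n. M n (D n)) (w k)))))"
    using choice[OF allI[OF vector_density], of w] by (rule exE)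
  then have [measurable]: "f k \<in> borel_measurable ?\<Omega>" for k
    by blast
  have "0 \<le> op_trace (\<rho> \<circ> tensor_op N H T (\<lambda>n. M n (D n))) \<and>
    (\<integral>\<^sup>+\<omega>. (\<Sum>k. f k \<omega>) * indicator (PiE {1..N} D) \<omega> \<partial>?\<Omega>) =
      ennreal (Re (op_trace (\<rho> \<circ> tensor_op N H T (\<lambda>n. M n (D n)))))"
    if D: "D \<in> (\<Pi> n\<in>{1..N}. sets (L n))" for D
  proof
    let ?F = "tensor_op N H T (\<lambda>n. M n (D n))"
    have pos: "positive_op UNIV ?F"
      by (intro positive_tensor_op positive_M[OF D])
    then have sums: "(\<lambda>k. cinner (w k) (?F (w k))) sums op_trace (\<rho> \<circ> ?F)"
      using w by blast
    have nn: "0 \<le> Re (cinner (w k) (?F (w k)))" "Im (cinner (w k) (?F (w k))) = 0" for k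
      using pos by (auto simp: positive_op_def complex_nonneg_Reals_iff)
    have "0 \<le> Re (op_trace (\<rho> \<circ> ?F))"
      using sums_le[OF nn(1) sums_zero sums_Re[OF sums]] by simp
    moreover have "Im (op_trace (\<rho> \<circ> ?F)) = 0"
      using sums_Im[OF sums] nn(2) sums_unique2[OF _ sums_zero] by simp
    ultimately show "0 \<le> op_trace (\<rho> \<circ> ?F)"
      by (simp add: less_eq_complex_def)
    have [measurable]: "PiE {1..N} D \<in> sets ?\<Omega>" by (rule box_sets[OF D])
    have "(\<integral>\<^sup>+\<omega>. (\<Sum>k. f k \<omega>) * indicator (PiE {1..N} D) \<omega> \<partial>?\<Omega>) =
        (\<integral>\<^sup>+\<omega>. (\<Sum>k. f k \<omega> * indicator (PiE {1..N} D) \<omega>) \<partial>?\<Omega>)"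
      by simp
    also have "\<dots> = (\<Sum>k. \<integral>\<^sup>+\<omega>. f k \<omega> * indicator (PiE {1..N} D) \<omega> \<partial>?\<Omega>)"
      by (rule nn_integral_suminf) measurable
    also have "\<dots> = (\<Sum>k. ennreal (Re (cinner (w k) (?F (w k)))))"
      using f D by simp
    also have "\<dots> = ennreal (Re (op_trace (\<rho> \<circ> ?F)))"
      by (rule suminf_ennreal_eq[OF nn(1) sums_Re[OF sums]])
    finally show "(\<integral>\<^sup>+\<omega>. (\<Sum>k. f k \<omega>) * indicator (PiE {1..N} D) \<omega> \<partial>?\<Omega>) =
      ennreal (Re (op_trace (\<rho> \<circ> ?F)))" .
  qed
  moreover have "(\<lambda>\<omega>. \<Sum>k. f k \<omega>) \<in> borel_measurable ?\<Omega>"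
    by measurable
  ultimately show ?thesis by blast
qed

end

end

subsection \<open>Conditional distributions\<close>

text \<open>
  On arbitrary measurable spaces regular conditional distributions need not exist; they do here
  because the joint distribution has a density with respect to a product measure.
\<close>

definition conditional :: "'l measure \<Rightarrow> ('w \<Rightarrow> 'l \<Rightarrow> ennreal) \<Rightarrow> 'w \<Rightarrow> 'l measure" where
  "conditional m h \<omega> = density m (\<lambda>y. h \<omega> y / (\<integral>\<^sup>+y. h \<omega> y \<partial>m))"

lemma sets_conditional: "sets (conditional m h \<omega>) = sets m"
  by (simp add: conditional_def)

context
  fixes \<kappa> :: "'w measure" and m :: "'l measure" and h :: "'w \<Rightarrow> 'l \<Rightarrow> ennreal"
  assumes m: "finite_measure m"
    and h: "case_prod h \<in> borel_measurable (\<kappa> \<Otimes>\<^sub>M m)"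
    and finite_h: "(\<integral>\<^sup>+\<omega>. (\<integral>\<^sup>+y. h \<omega> y \<partial>m) \<partial>\<kappa>) \<noteq> \<infinity>"
begin

interpretation finite_measure m by (rule m)

lemma measurable_section: "\<omega> \<in> space \<kappa> \<Longrightarrow> h \<omega> \<in> borel_measurable m"
  using measurable_Pair2[OF h] by simp

lemma measurable_partial:
  assumes D: "D \<in> sets m"
  shows "(\<lambda>\<omega>. \<integral>\<^sup>+y. h \<omega> y * indicator D y \<partial>m) \<in> borel_measurable \<kappa>"
proof (rule borel_measurable_nn_integral)
  have "(\<lambda>z. case_prod h z * indicator D (snd z)) \<in> borel_measurable (\<kappa> \<Otimes>\<^sub>M m)"
    by (intro borel_measurable_times_ennreal h measurable_compose[OF measurable_snd] borel_measurable_indicator D)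
  then show "(\<lambda>(\<omega>, y). h \<omega> y * indicator D y) \<in> borel_measurable (\<kappa> \<Otimes>\<^sub>M m)"
    by (simp add: case_prod_unfold)
qed

lemma measurable_marginal: "(\<lambda>\<omega>. \<integral>\<^sup>+y. h \<omega> y \<partial>m) \<in> borel_measurable \<kappa>"
  by (rule borel_measurable_nn_integral[OF h])

abbreviation "marginal \<equiv> density \<kappa> (\<lambda>\<omega>. \<integral>\<^sup>+y. h \<omega> y \<partial>m)"

lemma emeasure_conditional:
  assumes "\<omega> \<in> space \<kappa>" "D \<in> sets m"
  shows "emeasure (conditional m h \<omega>) D = (\<integral>\<^sup>+y. h \<omega> y * indicator D y \<partial>m) / (\<integral>\<^sup>+y. h \<omega> y \<partial>m)"
proof -
  note [measurable] = measurable_section[OF assms(1)] assms(2)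
  have "emeasure (conditional m h \<omega>) D = (\<integral>\<^sup>+y. (h \<omega> y * indicator D y) / (\<integral>\<^sup>+y. h \<omega> y \<partial>m) \<partial>m)"
    unfolding conditional_def
    by (subst emeasure_density) (auto intro!: nn_integral_cong simp: indicator_def)
  also have "\<dots> = (\<integral>\<^sup>+y. h \<omega> y * indicator D y \<partial>m) / (\<integral>\<^sup>+y. h \<omega> y \<partial>m)"
    by (rule nn_integral_divide) measurable
  finally show ?thesis .
qed

text \<open>Normalisation can fail only where the integral of \<open>h \<omega>\<close> is zero or
  infinite. The first set is null for \<open>marginal\<close> because its density vanishes there,
  the second by \<open>finite_h\<close>.\<close>

lemma AE_prob_space_conditional: "AE \<omega> in marginal. prob_space (conditional m h \<omega>)"
proof (subst AE_density[OF measurable_marginal])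
  have "AE \<omega> in \<kappa>. (\<integral>\<^sup>+y. h \<omega> y \<partial>m) \<noteq> \<infinity>"
    by (rule nn_integral_PInf_AE[OF measurable_marginal finite_h])
  moreover have "AE \<omega> in \<kappa>. \<omega> \<in> space \<kappa>" by simp
  ultimately show "AE \<omega> in \<kappa>. 0 < (\<integral>\<^sup>+y. h \<omega> y \<partial>m) \<longrightarrow> prob_space (conditional m h \<omega>)"
  proof eventually_elim
    case (elim \<omega>)
    have "(\<integral>\<^sup>+y. h \<omega> y * indicator (space m) y \<partial>m) = (\<integral>\<^sup>+y. h \<omega> y \<partial>m)"
      by (intro nn_integral_cong) simp
    then show ?case
      using elim emeasure_conditional[of \<omega> "space m"]
      by (auto intro!: prob_spaceI simp: sets_eq_imp_space_eq[OF sets_conditional] less_top)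
  qed
qed

lemma measurable_measure_conditional:
  assumes D: "D \<in> sets m"
  shows "(\<lambda>\<omega>. measure (conditional m h \<omega>) D) \<in> borel_measurable marginal"
proof -
  note [measurable] = measurable_partial[OF D] measurable_marginal
  have "(\<lambda>\<omega>. enn2real ((\<integral>\<^sup>+y. h \<omega> y * indicator D y \<partial>m) / (\<integral>\<^sup>+y. h \<omega> y \<partial>m))) \<in> borel_measurable \<kappa>"
    by measurable
  also have "?this \<longleftrightarrow> (\<lambda>\<omega>. measure (conditional m h \<omega>) D) \<in> borel_measurable \<kappa>"
    by (intro measurable_cong) (simp add: measure_def emeasure_conditional[OF _ D])
  finally show ?thesis by simp
qed

text \<open>The density of \<open>marginal\<close> cancels the normalising denominator. Where the
  denominator is zero, so is the numerator, which it dominates; where it is infinite the set is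
  null.\<close>

lemma integral_conditional:
  assumes D: "D \<in> sets m" and B: "B \<in> sets \<kappa>"
  shows "(\<integral>\<omega>. measure (conditional m h \<omega>) D * indicator B \<omega> \<partial>marginal) =
    enn2real (\<integral>\<^sup>+\<omega>. (\<integral>\<^sup>+y. h \<omega> y * indicator D y \<partial>m) * indicator B \<omega> \<partial>\<kappa>)"
proof -
  let ?F = "\<lambda>\<omega>. \<integral>\<^sup>+y. h \<omega> y * indicator D y \<partial>m" and ?G = "\<lambda>\<omega>. \<integral>\<^sup>+y. h \<omega> y \<partial>m"
  note [measurable] = measurable_partial[OF D] measurable_marginal B
  have "(\<integral>\<omega>. measure (conditional m h \<omega>) D * indicator B \<omega> \<partial>marginal) =
      enn2real (\<integral>\<^sup>+\<omega>. ennreal (measure (conditional m h \<omega>) D * indicator B \<omega>) \<partial>marginal)"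
  proof (rule integral_eq_nn_integral)
    show "(\<lambda>\<omega>. measure (conditional m h \<omega>) D * indicator B \<omega>) \<in> borel_measurable marginal"
      by (intro borel_measurable_times measurable_measure_conditional D) measurable
  qed simp
  also have "(\<integral>\<^sup>+\<omega>. ennreal (measure (conditional m h \<omega>) D * indicator B \<omega>) \<partial>marginal) =
      (\<integral>\<^sup>+\<omega>. (?F \<omega> / ?G \<omega>) * indicator B \<omega> \<partial>marginal)"
  proof (rule nn_integral_cong_AE)
    have "AE \<omega> in marginal. \<omega> \<in> space \<kappa>"
      using AE_space[of marginal] by simp
    with AE_prob_space_conditional
    show "AE \<omega> in marginal. ennreal (measure (conditional m h \<omega>) D * indicator B \<omega>) =
        (?F \<omega> / ?G \<omega>) * indicator B \<omega>"
    proof eventually_elim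
      case (elim \<omega>)
      interpret C: prob_space "conditional m h \<omega>" by (rule elim)
      show ?case
        using emeasure_conditional[OF elim(2) D] C.emeasure_eq_measure[of D]
        by (simp add: indicator_def)
    qed
  qed
  also have "\<dots> = (\<integral>\<^sup>+\<omega>. ?G \<omega> * ((?F \<omega> / ?G \<omega>) * indicator B \<omega>) \<partial>\<kappa>)"
    by (rule nn_integral_density) measurable
  also have "\<dots> = (\<integral>\<^sup>+\<omega>. ?F \<omega> * indicator B \<omega> \<partial>\<kappa>)"
  proof (rule nn_integral_cong_AE)
    have "AE \<omega> in \<kappa>. ?G \<omega> \<noteq> \<infinity>"
      by (rule nn_integral_PInf_AE[OF measurable_marginal finite_h])
    then show "AE \<omega> in \<kappa>. ?G \<omega> * ((?F \<omega> / ?G \<omega>) * indicator B \<omega>) = ?F \<omega> * indicator B \<omega>"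
    proof eventually_elim
      case (elim \<omega>)
      have "?F \<omega> \<le> ?G \<omega>"
        by (intro nn_integral_mono) (simp add: indicator_def)
      moreover have "?G \<omega> * (?F \<omega> / ?G \<omega>) = ?F \<omega>" if "?G \<omega> \<noteq> 0"
        using that elim by (simp add: ennreal_times_divide mult.commute[of "?G \<omega>"] mult_divide_eq_ennreal)
      ultimately show ?case
        by (cases "?G \<omega> = 0") (simp_all add: mult.assoc[symmetric])
    qed
  qed
  finally show ?thesis .
qed

end

subsection \<open>The LHV model\<close>

theorem proposition4:
  fixes N S\<^sub>1 :: nat
    and H :: "nat \<Rightarrow> 'h::complex_hilbert_space set"
    and T :: "(nat \<Rightarrow> 'h) \<Rightarrow> 'k::complex_hilbert_space"
    and \<rho> :: "'k \<Rightarrow> 'k"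
  assumes "N \<ge> 1"
    and "\<And>n. n \<in> {1..N} \<Longrightarrow> separable_hilbert_subspace (H n)"
    and "hilbert_tensor_product N H T"
    and "density_operator \<rho>"
    and "S\<^sub>1 \<ge> 2"
  shows "admits_lhv_description TYPE('l) N (\<lambda>n. if n = 1 then S\<^sub>1 else 1) H T \<rho>"
  unfolding admits_lhv_description_def
proof (intro allI impI)
  note [simp del] = One_nat_def
  define S where "S = (\<lambda>n::nat. if n = 1 then S\<^sub>1 else 1)"
  fix L :: "nat \<Rightarrow> nat \<Rightarrow> 'l measure" and M
  assume "epr_local_family N (\<lambda>n. if n = 1 then S\<^sub>1 else 1) H L M"
  then have pov: "pov_measure (H n) (L n s) (M n s)" if "n \<in> {1..N}" "s \<in> {1..S n}" for n s
    using that unfolding epr_local_family_def S_def by blast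
  interpret tensor_product N H T
    using assms(2,3) by unfold_locales (auto simp: separable_hilbert_subspace_def)

  \<comment> \<open>Joint densities, one for each setting of site 1\<close>
  have "\<exists>\<mu>. finite_measure \<mu> \<and> sets \<mu> = sets (L n s) \<and>
      (\<forall>Y. countable Y \<longrightarrow> Y \<subseteq> H n \<longrightarrow> (\<exists>g. pov_density (H n) (L n s) (M n s) Y \<mu> g))"
    if "n \<in> {1..N}" "s \<in> {1..S n}" for n s
    by (rule pov_density_exists[OF assms(2)[OF that(1)] pov[OF that]])
  then obtain \<mu>0 where \<mu>0: "\<And>n s. n \<in> {1..N} \<Longrightarrow> s \<in> {1..S n} \<Longrightarrow> finite_measure (\<mu>0 n s)"
    "\<And>n s. n \<in> {1..N} \<Longrightarrow> s \<in> {1..S n} \<Longrightarrow> sets (\<mu>0 n s) = sets (L n s)"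
    "\<And>n s Y. n \<in> {1..N} \<Longrightarrow> s \<in> {1..S n} \<Longrightarrow> countable Y \<Longrightarrow> Y \<subseteq> H n \<Longrightarrow>
      \<exists>g. pov_density (H n) (L n s) (M n s) Y (\<mu>0 n s) g"
    by metis
  \<comment> \<open>On \<open>{1..N}\<close> every admissible joint setting has this form, so the
    single number \<open>t\<close> stands for it.\<close>
  define \<sigma> where "\<sigma> t = (\<lambda>n::nat. if n = 1 then t else 1)" for t :: nat
  have \<sigma>: "\<sigma> t n \<in> {1..S n}" if "t \<in> {1..S\<^sub>1}" for t n
    using that by (simp add: \<sigma>_def S_def)
  \<comment> \<open>A family of sigma-finite measures must be given at every index; outside
    \<open>{1..N}\<close> the empty space fills in.\<close>
  define \<mu> where "\<mu> t n = (if n \<in> {1..N} then \<mu>0 n (\<sigma> t n) else count_space {})" for t n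
  have fin: "finite_measure (\<mu> t n)" if "t \<in> {1..S\<^sub>1}" for t n
    using \<mu>0(1) \<sigma>[OF that] by (auto simp: \<mu>_def intro: finite_measure_count_space)
  have sets_\<mu>: "sets (\<mu> t n) = sets (L n (\<sigma> t n))" if "t \<in> {1..S\<^sub>1}" "n \<in> {1..N}" for t n
    using \<mu>0(2) \<sigma>[OF that(1)] that(2) by (simp add: \<mu>_def)
  define p where "p t D = op_trace (\<rho> \<circ> tensor_op N H T (\<lambda>n. M n (\<sigma> t n) (D n)))" for t D
  define \<D> where "\<D> t = (\<Pi> n\<in>{1..N}. sets (L n (\<sigma> t n)))" for t
  have ex_f: "\<exists>f. f \<in> borel_measurable (PiM {1..N} (\<mu> t)) \<and> (\<forall>D\<in>\<D> t. 0 \<le> p t D \<and>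
    (\<integral>\<^sup>+\<omega>. f \<omega> * indicator (PiE {1..N} D) \<omega> \<partial>PiM {1..N} (\<mu> t)) = ennreal (Re (p t D)))"
    if t: "t \<in> {1..S\<^sub>1}" for t
    unfolding p_def \<D>_def
    by (rule state_density[of "\<lambda>n. L n (\<sigma> t n)" "\<lambda>n. M n (\<sigma> t n)", OF _ fin[OF t] sets_\<mu>[OF t] _ assms(4)])
      (use pov \<mu>0(3) \<sigma>[OF t] in \<open>auto simp: \<mu>_def\<close>)
  obtain f where f0: "\<forall>t\<in>{1..S\<^sub>1}. f t \<in> borel_measurable (PiM {1..N} (\<mu> t)) \<and> (\<forall>D\<in>\<D> t. 0 \<le> p t D \<and>
    (\<integral>\<^sup>+\<omega>. f t \<omega> * indicator (PiE {1..N} D) \<omega> \<partial>PiM {1..N} (\<mu> t)) = ennreal (Re (p t D)))"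
    using bchoice[OF ballI[OF ex_f]] by (rule exE)
  have f: "f t \<in> borel_measurable (PiM {1..N} (\<mu> t))" if "t \<in> {1..S\<^sub>1}" for t
    using f0 that by blast
  have p_nonneg: "0 \<le> p t D" if "t \<in> {1..S\<^sub>1}" "D \<in> \<D> t" for t D
    using f0 that by blast
  have f_box: "(\<integral>\<^sup>+\<omega>. f t \<omega> * indicator (PiE {1..N} D) \<omega> \<partial>PiM {1..N} (\<mu> t)) = ennreal (Re (p t D))"
    if "t \<in> {1..S\<^sub>1}" "D \<in> \<D> t" for t D
    using f0 that by blast

  \<comment> \<open>Splitting off site 1\<close>
  have N: "{1..N} = insert 1 {2..N}" "1 \<notin> {2..N}" "1 \<in> {1..N}"
    using assms(1) by auto
  have one: "1 \<in> {1..S\<^sub>1}" using assms(5) by simp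
  \<comment> \<open>Away from site 1 the reference measures do not depend on \<open>t\<close>, so
    all marginals have densities over one base. For \<open>N = 1\<close> it is the one-point product
    over no sites.\<close>
  define \<kappa> where "\<kappa> = PiM {2..N} (\<mu> 1)"
  have \<kappa>: "PiM {2..N} (\<mu> t) = \<kappa>" for t
    unfolding \<kappa>_def by (intro PiM_cong refl) (auto simp: \<mu>_def \<sigma>_def)
  define h where "h t x y = f t (x(1 := y))" for t x y
  have h: "case_prod (h t) \<in> borel_measurable (\<kappa> \<Otimes>\<^sub>M \<mu> t 1)" if t: "t \<in> {1..S\<^sub>1}" for t
  proof -
    have "(\<lambda>(x, y). x(1 := y)) \<in> PiM {2..N} (\<mu> t) \<Otimes>\<^sub>M \<mu> t 1 \<rightarrow>\<^sub>M PiM (insert 1 {2..N}) (\<mu> t)"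
      by (rule measurable_add_dim)
    from measurable_compose[OF this, of "f t" borel] f[OF t] show ?thesis
      by (simp add: N(1)[symmetric] \<kappa> h_def[abs_def] case_prod_unfold)
  qed
  \<comment> \<open>Integrating out site 1 first exposes the weight of \<open>D 1\<close> given the
    other outcomes, before normalisation.\<close>
  have fiber: "(\<integral>\<^sup>+x. (\<integral>\<^sup>+y. h t x y * indicator (D 1) y \<partial>\<mu> t 1) * indicator (PiE {2..N} D) x \<partial>\<kappa>) =
      ennreal (Re (p t D))" if t: "t \<in> {1..S\<^sub>1}" and D: "D \<in> \<D> t" for t D
  proof -
    interpret product_sigma_finite "\<mu> t"
      by (intro product_sigma_finite.intro finite_measure.sigma_finite_measure fin t)
    have box: "PiE {1..N} D \<in> sets (PiM {1..N} (\<mu> t))"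
      using D sets_\<mu>[OF t] by (intro sets_PiM_I_finite) (auto simp: \<D>_def)
    have D1: "D 1 \<in> sets (\<mu> t 1)"
      using D sets_\<mu>[OF t N(3)] N(3) by (auto simp: \<D>_def)
    have "ennreal (Re (p t D)) = (\<integral>\<^sup>+x. f t x * indicator (PiE {1..N} D) x \<partial>PiM {1..N} (\<mu> t))"
      by (rule f_box[OF t D, symmetric])
    also have "\<dots> = (\<integral>\<^sup>+x. (\<integral>\<^sup>+y. f t (x(1 := y)) * indicator (PiE {1..N} D) (x(1 := y)) \<partial>\<mu> t 1) \<partial>PiM {2..N} (\<mu> t))"
      using f[OF t] box unfolding N(1)
      by (intro product_nn_integral_insert) (auto simp: N(2))
    also have "\<dots> = (\<integral>\<^sup>+x. (\<integral>\<^sup>+y. h t x y * indicator (D 1) y * indicator (PiE {2..N} D) x \<partial>\<mu> t 1) \<partial>\<kappa>)"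
      unfolding \<kappa>
    proof (intro nn_integral_cong)
      fix x y assume x: "x \<in> space \<kappa>"
      then have "x \<in> extensional {2..N}" by (simp add: \<kappa>_def space_PiM PiE_def)
      then have "x(1 := y) \<in> PiE {1..N} D \<longleftrightarrow> y \<in> D 1 \<and> x \<in> PiE {2..N} D"
        unfolding N(1) using N(2) by (auto simp: PiE_iff extensional_def)
      then show "f t (x(1 := y)) * indicator (PiE {1..N} D) (x(1 := y)) =
          h t x y * indicator (D 1) y * indicator (PiE {2..N} D) x"
        by (simp add: h_def indicator_def)
    qed
    also have "\<dots> = (\<integral>\<^sup>+x. (\<integral>\<^sup>+y. h t x y * indicator (D 1) y \<partial>\<mu> t 1) * indicator (PiE {2..N} D) x \<partial>\<kappa>)"
      using D1 by (intro nn_integral_cong nn_integral_multc borel_measurable_times_ennreal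
          borel_measurable_indicator measurable_Pair2[OF h[OF t], simplified])
    finally show ?thesis ..
  qed
  have space1: "(\<integral>\<^sup>+y. h t \<omega> y * indicator (space (L 1 t)) y \<partial>\<mu> t 1) = (\<integral>\<^sup>+y. h t \<omega> y \<partial>\<mu> t 1)"
    if "t \<in> {1..S\<^sub>1}" for t \<omega>
    using sets_eq_imp_space_eq[OF sets_\<mu>[OF that N(3)]]
    by (intro nn_integral_cong) (simp add: \<sigma>_def)

  \<comment> \<open>The law of the outcomes at the other sites\<close>
  define full where "full t = (\<lambda>n. space (L n (\<sigma> t n)))" for t
  have full: "full t \<in> \<D> t" for t by (auto simp: full_def \<D>_def)
  have pos: "positive_op (H n) (M n (\<sigma> t n) (D n))" if "t \<in> {1..S\<^sub>1}" "D \<in> \<D> t" "n \<in> {1..N}" for t D n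
    using pov[OF that(3) \<sigma>[OF that(1)]] that unfolding pov_measure_def \<D>_def by blast
  have id: "M n (\<sigma> t n) (space (L n (\<sigma> t n))) x = x" if "t \<in> {1..S\<^sub>1}" "n \<in> {1..N}" "x \<in> H n" for t n x
    using pov[OF that(2) \<sigma>[OF that(1)]] that(3) unfolding pov_measure_def by blast
  have p_full: "p t (full t) = 1" if t: "t \<in> {1..S\<^sub>1}" for t
  proof -
    have "tensor_op N H T (\<lambda>n. M n (\<sigma> t n) (full t n)) = (\<lambda>v. v)"
      by (rule tensor_op_eq_id) (use pos[OF t full] in \<open>simp_all add: full_def id[OF t]\<close>)
    then show ?thesis
      using assms(4) by (simp add: p_def density_operator_def comp_def)
  qed
  have marginal_finite: "(\<integral>\<^sup>+\<omega>. (\<integral>\<^sup>+y. h t \<omega> y \<partial>\<mu> t 1) \<partial>\<kappa>) = 1" if t: "t \<in> {1..S\<^sub>1}" for t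
  proof -
    have "space \<kappa> = PiE {2..N} (full t)"
      unfolding \<kappa>[symmetric, of t] space_PiM
      by (intro PiE_cong) (use sets_eq_imp_space_eq[OF sets_\<mu>[OF t]] in \<open>auto simp: full_def\<close>)
    then have "(\<integral>\<^sup>+\<omega>. (\<integral>\<^sup>+y. h t \<omega> y \<partial>\<mu> t 1) \<partial>\<kappa>) =
        (\<integral>\<^sup>+\<omega>. (\<integral>\<^sup>+y. h t \<omega> y \<partial>\<mu> t 1) * indicator (PiE {2..N} (full t)) \<omega> \<partial>\<kappa>)"
      by (intro nn_integral_cong) simp
    also have "\<dots> = ennreal (Re (p t (full t)))"
      using fiber[OF t full] by (simp add: full_def \<sigma>_def space1[OF t] del: fun_upd_apply)
    finally show ?thesis by (simp add: p_full[OF t])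
  qed
  define \<nu> where "\<nu> t = density \<kappa> (\<lambda>\<omega>. \<integral>\<^sup>+y. h t \<omega> y \<partial>\<mu> t 1)" for t
  have \<nu>_box: "emeasure (\<nu> t) (PiE {2..N} D) = ennreal (Re (p 1 (D(1 := space (L 1 1)))))"
    if t: "t \<in> {1..S\<^sub>1}" and D: "\<And>n. n \<in> {2..N} \<Longrightarrow> D n \<in> sets (\<mu> 1 n)" for t D
  proof -
    have L: "D n \<in> sets (L n 1)" if "n \<in> {2..N}" for n
      using D[OF that] sets_\<mu>[OF one, of n] that by (auto simp: \<sigma>_def)
    have D': "D(1 := space (L 1 s)) \<in> \<D> s" for s
      unfolding \<D>_def using L N by (auto simp: \<sigma>_def)
    have "PiE {2..N} D \<in> sets \<kappa>"
      unfolding \<kappa>_def using D by (intro sets_PiM_I_finite) auto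
    then have "emeasure (\<nu> t) (PiE {2..N} D) =
        (\<integral>\<^sup>+\<omega>. (\<integral>\<^sup>+y. h t \<omega> y \<partial>\<mu> t 1) * indicator (PiE {2..N} D) \<omega> \<partial>\<kappa>)"
      unfolding \<nu>_def by (intro emeasure_density measurable_marginal[OF fin[OF t] h[OF t]]) (auto simp: marginal_finite[OF t])
    also have "\<dots> = ennreal (Re (p t (D(1 := space (L 1 t)))))"
    proof -
      have "PiE {2..N} (D(1 := space (L 1 t))) = PiE {2..N} D"
        by (rule PiE_cong) auto
      then show ?thesis
        using fiber[OF t D'] by (simp only: fun_upd_same space1[OF t])
    qed
    \<comment> \<open>No-signalling: if site 1 registers its whole outcome space, its operator is
      the identity on \<open>H 1\<close> at every setting, and the tensor operator no longer sees
      \<open>t\<close>.\<close>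
    also have "p t (D(1 := space (L 1 t))) = p 1 (D(1 := space (L 1 1)))"
    proof -
      have "tensor_op N H T (\<lambda>n. M n (\<sigma> t n) ((D(1 := space (L 1 t))) n)) =
          tensor_op N H T (\<lambda>n. M n (\<sigma> 1 n) ((D(1 := space (L 1 1))) n))"
      proof (rule tensor_op_cong)
        fix n x assume n: "n \<in> {1..N}" and x: "x \<in> H n"
        show "M n (\<sigma> t n) ((D(1 := space (L 1 t))) n) x = M n (\<sigma> 1 n) ((D(1 := space (L 1 1))) n) x"
        proof (cases "n = 1")
          case True
          then show ?thesis
            using id[OF t n x] id[OF one n x] by (simp add: \<sigma>_def)
        qed (simp add: \<sigma>_def)
      qed (use pos[OF t D'] pos[OF one D'] in auto)
      then show ?thesis by (simp add: p_def)
    qed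
    finally show ?thesis .
  qed
  \<comment> \<open>Boxes generate the sigma-algebra and are stable under intersection, and the
    whole space is itself a box of finite mass; hence agreement on boxes is agreement of
    measures.\<close>
  have \<nu>_eq: "\<nu> t = \<nu> 1" if t: "t \<in> {1..S\<^sub>1}" for t
  proof (rule measure_eqI_PiM_finite[of "{2..N}" _ "\<mu> 1" _ "\<lambda>_. space \<kappa>"])
    show "sets (\<nu> t) = sets (PiM {2..N} (\<mu> 1))" "sets (\<nu> 1) = sets (PiM {2..N} (\<mu> 1))"
      by (simp_all add: \<nu>_def \<kappa>_def)
    show "emeasure (\<nu> t) (PiE {2..N} D) = emeasure (\<nu> 1) (PiE {2..N} D)"
      if "\<And>n. n \<in> {2..N} \<Longrightarrow> D n \<in> sets (\<mu> 1 n)" for D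
      using \<nu>_box[OF t that] \<nu>_box[OF one that] by simp
    show "range (\<lambda>_. space \<kappa>) \<subseteq> prod_algebra {2..N} (\<mu> 1)"
      by (auto simp: \<kappa>_def space_PiM intro!: prod_algebraI_finite)
    show "(\<Union>i. space \<kappa>) = space (PiM {2..N} (\<mu> 1))" by (simp add: \<kappa>_def)
    show "emeasure (\<nu> t) (space \<kappa>) \<noteq> \<infinity>"
      using \<nu>_box[OF t, of "\<lambda>n. space (\<mu> 1 n)"] by (simp add: \<kappa>_def space_PiM)
  qed simp
  have sets_\<nu>: "sets (\<nu> t) = sets \<kappa>" and space_\<nu>: "space (\<nu> t) = space \<kappa>" for t
    by (simp_all add: \<nu>_def)
  have prob: "prob_space (\<nu> 1)"
  proof (rule prob_spaceI)
    have "emeasure (\<nu> 1) (space (\<nu> 1)) = (\<integral>\<^sup>+\<omega>. (\<integral>\<^sup>+y. h 1 \<omega> y \<partial>\<mu> 1 1) * indicator (space \<kappa>) \<omega> \<partial>\<kappa>)"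
      unfolding space_\<nu> unfolding \<nu>_def
      by (intro emeasure_density measurable_marginal[OF fin[OF one] h[OF one]]) (auto simp: marginal_finite[OF one])
    also have "\<dots> = (\<integral>\<^sup>+\<omega>. (\<integral>\<^sup>+y. h 1 \<omega> y \<partial>\<mu> 1 1) \<partial>\<kappa>)"
      by (intro nn_integral_cong) simp
    finally show "emeasure (\<nu> 1) (space (\<nu> 1)) = 1" by (simp add: marginal_finite[OF one])
  qed
  \<comment> \<open>The conditional law at setting \<open>s\<close> is normalised by the density of
    \<open>\<nu> s\<close>. As all \<open>\<nu> s\<close> coincide, these laws live on one
    probability space although each comes from a different joint density.\<close>
  define R where "R n s \<omega> = (if n = 1 then conditional (\<mu> s 1) (h s) \<omega> else return (L n 1) (\<omega> n))" for n s :: nat and \<omega>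
  have coord: "\<omega> n \<in> space (L n 1)" if "\<omega> \<in> space \<kappa>" "n \<in> {2..N}" for \<omega> n
    using that sets_eq_imp_space_eq[OF sets_\<mu>[OF one, of n]]
    by (auto simp: \<kappa>_def space_PiM \<sigma>_def dest: PiE_mem)

  \<comment> \<open>Verification of the model\<close>
  have "lhv_model N S L (joint_prob N H T \<rho> M) (\<nu> 1) R"
    unfolding lhv_model_def
  proof (intro conjI ballI)
    have "(\<Sum>n\<in>{2..N}. S n) = (\<Sum>n\<in>{2..N}. 1)"
      by (intro sum.cong refl) (simp add: S_def)
    then have "(\<Sum>n=1..N. S n) = S\<^sub>1 + (N - 1)"
      unfolding N(1) using N(2) by (simp add: S_def)
    then show "N < (\<Sum>n=1..N. S n)"
      using assms(1,5) by simp
  next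
    show "prob_space (\<nu> 1)" by (rule prob)
  next
    fix n s assume n: "n \<in> {1..N}" and s: "s \<in> {1..S n}"
    show "AE \<omega> in \<nu> 1. prob_space (R n s \<omega>) \<and> sets (R n s \<omega>) = sets (L n s)"
    proof (cases "n = 1")
      case True
      then have t: "s \<in> {1..S\<^sub>1}" using s by (simp add: S_def)
      have "AE \<omega> in \<nu> s. prob_space (conditional (\<mu> s 1) (h s) \<omega>)"
        unfolding \<nu>_def
        by (rule AE_prob_space_conditional[OF fin[OF t] h[OF t]]) (simp add: marginal_finite[OF t])
      then show ?thesis
        unfolding \<nu>_eq[OF t]
        by eventually_elim (use True sets_\<mu>[OF t N(3)] in \<open>simp add: R_def sets_conditional \<sigma>_def\<close>)
    next
      case False
      then have "s = 1" "n \<in> {2..N}" using n s by (auto simp: S_def)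
      have "AE \<omega> in \<nu> 1. \<omega> \<in> space \<kappa>" using AE_space[of "\<nu> 1"] by (simp add: space_\<nu>)
      then show ?thesis
        by eventually_elim (use False \<open>s = 1\<close> coord \<open>n \<in> {2..N}\<close> in \<open>auto simp: R_def intro!: prob_space_return\<close>)
    qed
  next
    fix n s D assume n: "n \<in> {1..N}" and s: "s \<in> {1..S n}" and D: "D \<in> sets (L n s)"
    show "(\<lambda>\<omega>. measure (R n s \<omega>) D) \<in> borel_measurable (\<nu> 1)"
    proof (cases "n = 1")
      case True
      then have t: "s \<in> {1..S\<^sub>1}" using s by (simp add: S_def)
      have "(\<lambda>\<omega>. measure (conditional (\<mu> s 1) (h s) \<omega>) D) \<in> borel_measurable (\<nu> s)"
        unfolding \<nu>_def using D True sets_\<mu>[OF t N(3)]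
        by (intro measurable_measure_conditional[OF fin[OF t] h[OF t]]) (simp_all add: marginal_finite[OF t] \<sigma>_def)
      then show ?thesis
        unfolding \<nu>_eq[OF t] by (simp add: R_def True)
    next
      case False
      then have s1: "s = 1" and n2: "n \<in> {2..N}" using n s by (auto simp: S_def)
      have "(\<lambda>\<omega>. \<omega> n) \<in> \<kappa> \<rightarrow>\<^sub>M \<mu> 1 n"
        unfolding \<kappa>_def using n2 by (rule measurable_component_singleton)
      moreover have "D \<in> sets (\<mu> 1 n)"
        using D s1 sets_\<mu>[OF one n] False by (simp add: \<sigma>_def)
      ultimately have "(\<lambda>\<omega>. indicator D (\<omega> n) :: real) \<in> borel_measurable \<kappa>"
        by (intro measurable_compose[OF _ borel_measurable_indicator])
      then show ?thesis
        using D s1 False by (simp add: R_def measure_return measurable_cong_sets[OF sets_\<nu> refl])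
    qed
  next
    fix s D assume s: "s \<in> (\<Pi> n\<in>{1..N}. {1..S n})" and D: "D \<in> (\<Pi> n\<in>{1..N}. sets (L n (s n)))"
    define t where "t = s 1"
    have t: "t \<in> {1..S\<^sub>1}" using s N(3) by (auto simp: t_def S_def dest: Pi_mem)
    have s_eq: "s n = \<sigma> t n" if "n \<in> {1..N}" for n
      using Pi_mem[OF s that] by (auto simp: \<sigma>_def t_def S_def split: if_splits)
    have Dt: "D \<in> \<D> t"
      using D s_eq by (auto simp: \<D>_def Pi_iff)
    have D1: "D 1 \<in> sets (\<mu> t 1)" using Dt N(3) sets_\<mu>[OF t N(3)] by (auto simp: \<D>_def)
    have D2: "D n \<in> sets (L n 1)" "D n \<in> sets (\<mu> 1 n)" if "n \<in> {2..N}" for n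
    proof -
      have n: "n \<in> {1..N}" "n \<noteq> 1" using that by auto
      have "D n \<in> sets (L n (\<sigma> t n))" using Dt n(1) unfolding \<D>_def by (rule Pi_mem)
      then show "D n \<in> sets (L n 1)" "D n \<in> sets (\<mu> 1 n)"
        using n sets_\<mu>[OF one n(1)] by (simp_all add: \<sigma>_def)
    qed
    have "joint_prob N H T \<rho> M s D = p t D"
    proof -
      have "tensor_op N H T (\<lambda>n. M n (s n) (D n)) = tensor_op N H T (\<lambda>n. M n (\<sigma> t n) (D n))"
        by (rule tensor_op_cong) (use pos[OF t Dt] s_eq in auto)
      then show ?thesis by (simp add: joint_prob_def p_def)
    qed
    also have "p t D = complex_of_real (Re (p t D))"
      using p_nonneg[OF t Dt] by (simp add: less_eq_complex_def complex_eq_iff)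
    \<comment> \<open>Nonnegativity of \<open>p t D\<close> is essential, since
      \<open>ennreal\<close> would send a negative value to zero.\<close>
    also have "Re (p t D) = enn2real (\<integral>\<^sup>+\<omega>. (\<integral>\<^sup>+y. h t \<omega> y * indicator (D 1) y \<partial>\<mu> t 1) * indicator (PiE {2..N} D) \<omega> \<partial>\<kappa>)"
      using p_nonneg[OF t Dt] by (simp add: fiber[OF t Dt] less_eq_complex_def)
    also have "\<dots> = (\<integral>\<omega>. measure (conditional (\<mu> t 1) (h t) \<omega>) (D 1) * indicator (PiE {2..N} D) \<omega> \<partial>\<nu> t)"
      unfolding \<nu>_def
    proof (rule integral_conditional[OF fin[OF t] h[OF t], symmetric])
      show "PiE {2..N} D \<in> sets \<kappa>"
        unfolding \<kappa>_def using D2(2) by (intro sets_PiM_I_finite) auto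
    qed (simp_all add: marginal_finite[OF t] D1)
    also have "\<dots> = (\<integral>\<omega>. (\<Prod>n=1..N. measure (R n (s n) \<omega>) (D n)) \<partial>\<nu> 1)"
      unfolding \<nu>_eq[OF t]
    proof (intro Bochner_Integration.integral_cong refl)
      fix \<omega> assume "\<omega> \<in> space (\<nu> 1)"
      then have \<omega>: "\<omega> \<in> extensional {2..N}" by (simp add: space_\<nu> \<kappa>_def space_PiM PiE_def)
      have "(\<Prod>n=1..N. measure (R n (s n) \<omega>) (D n)) =
          measure (conditional (\<mu> t 1) (h t) \<omega>) (D 1) * (\<Prod>n\<in>{2..N}. measure (R n (s n) \<omega>) (D n))"
        unfolding N(1) using N(2) by (simp add: R_def t_def)
      also have "(\<Prod>n\<in>{2..N}. measure (R n (s n) \<omega>) (D n)) = (\<Prod>n\<in>{2..N}. indicator (D n) (\<omega> n))"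
        by (intro prod.cong refl) (use D2(1) in \<open>auto simp: R_def measure_return\<close>)
      \<comment> \<open>Deterministic answers multiply to the indicator of a box. Points of the
        product space are extensional, so one outside the box must miss some
        \<open>D n\<close>.\<close>
      also have "\<dots> = indicator (PiE {2..N} D) \<omega>"
      proof (cases "\<omega> \<in> PiE {2..N} D")
        case True
        then show ?thesis by (auto intro!: prod.neutral dest: PiE_mem)
      next
        case False
        then obtain n where "n \<in> {2..N}" "\<omega> n \<notin> D n"
          using \<omega> unfolding PiE_def Pi_def by blast
        then have "(\<Prod>n\<in>{2..N}. indicator (D n) (\<omega> n) :: real) = 0"
          by (intro prod_zero bexI[of _ n]) simp_all
        with False show ?thesis by simp
      qed
      finally show "measure (conditional (\<mu> t 1) (h t) \<omega>) (D 1) * indicator (PiE {2..N} D) \<omega> =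
          (\<Prod>n=1..N. measure (R n (s n) \<omega>) (D n))" by simp
    qed
    finally show "joint_prob N H T \<rho> M s D =
        complex_of_real (\<integral>\<omega>. (\<Prod>n=1..N. measure (R n (s n) \<omega>) (D n)) \<partial>\<nu> 1)" .
  qed
  then show "admits_lhv_model N (\<lambda>n. if n = 1 then S\<^sub>1 else 1) L (joint_prob N H T \<rho> M)"
    unfolding S_def by (rule admits_lhv_modelI)
qed

end
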